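(* Let $d\geq 2$ be an integer. For discrete groups, the $M_d$-approximation property ($M_d$-AP) is stable under direct products, semidirect products, and free products. That is, if $G_1$ and $G_2$ are discrete groups satisfying $M_d$-AP, then the direct product $G_1\times G_2$ satisfies $M_d$-AP, every semidirect product $G_1\ltimes G_2$ associated with an action of $G_1$ on $G_2$ by group automorphisms satisfies $M_d$-AP, and the free product $G_1\ast G_2$ satisfies $M_d$-AP.
   Context: Let $G$ be a discrete group and $d\ge 2$ an integer. A bounded function $\varphi:G\to\mathbb{C}$ is an $M_d$-multiplier of $G$ if there are Hilbert spaces $\mathcal{H}_0,\ldots,\mathcal{H}_d$ with $\mathcal{H}_0=\mathcal{H}_d=\mathbb{C}$ and bounded maps $\xi_i:G\to\mathbf{B}(\mathcal{H}_i,\mathcal{H}_{i-1})$ ($i=1,\ldots,d$) such that $$\varphi(t_1\cdots t_d)=\xi_1(t_1)\cdots\xi_d(t_d)1\quad\text{for all } t_1,\ldots,t_d\in G,$$ where $\mathbf{B}(E,F)$ denotes the bounded linear operators from $E$ to $F$. $M_d(G)$ is the space of all $M_d$-multipliers, with norm $\|\varphi\|_{M_d(G)}=\inf\{\sup_{t_1\in G}\|\xi_1(t_1)\|\cdots\sup_{t_d\in G}\|\xi_d(t_d)\|\}$, the infimum being over all such decompositions. $X_d(G)$ is the completion of $\ell^1(G)$ for the norm $\|g\|_{X_d(G)}=\sup\{|\sum_{t\in G}\varphi(t)g(t)| : \varphi\in M_d(G),\ \|\varphi\|_{M_d(G)}\le 1\}$. It is known that $X_d(G)^*=M_d(G)$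 for the duality $\langle\varphi,g\rangle=\sum_{t\in G}\varphi(t)g(t)$, $g\in\ell^1(G)$. The group $G$ has the $M_d$-AP if the constant function $1$ belongs to the $\sigma(M_d(G),X_d(G))$-closure (weak*-closure), in $M_d(G)$, of the space of finitely supported functions $G\to\mathbb{C}$. *)

theory Defs
  imports "HOL-Analysis.Analysis" "HOL-Algebra.Bij"
begin

section \<open>Complex Hilbert spaces on explicit carriers\<close>

text \<open>The spaces in a factorization of a multiplier vary with the multiplier, so they are
  structures on subsets of a type rather than types.\<close>

record 'v cspace =
  vecs :: "'v set"
  vzero :: 'v
  vadd :: "'v \<Rightarrow> 'v \<Rightarrow> 'v"
  vscale :: "complex \<Rightarrow> 'v \<Rightarrow> 'v"
  vinner :: "'v \<Rightarrow> 'v \<Rightarrow> complex"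

definition vnorm :: "'v cspace \<Rightarrow> 'v \<Rightarrow> real" where
  "vnorm H x = sqrt (Re (vinner H x x))"

definition vdist :: "'v cspace \<Rightarrow> 'v \<Rightarrow> 'v \<Rightarrow> real" where
  "vdist H x y = vnorm H (vadd H x (vscale H (- 1) y))"

locale complex_hilbert_space =
  fixes H :: "'v cspace"
  assumes zero_closed: "vzero H \<in> vecs H"
    and add_closed: "\<lbrakk>x \<in> vecs H; y \<in> vecs H\<rbrakk> \<Longrightarrow> vadd H x y \<in> vecs H"
    and scale_closed: "x \<in> vecs H \<Longrightarrow> vscale H a x \<in> vecs H"
    and add_assoc: "\<lbrakk>x \<in> vecs H; y \<in> vecs H; z \<in> vecs H\<rbrakk>
          \<Longrightarrow> vadd H (vadd H x y) z = vadd H x (vadd H y z)"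
    and add_commute: "\<lbrakk>x \<in> vecs H; y \<in> vecs H\<rbrakk> \<Longrightarrow> vadd H x y = vadd H y x"
    and add_zero: "x \<in> vecs H \<Longrightarrow> vadd H x (vzero H) = x"
    and add_neg: "x \<in> vecs H \<Longrightarrow> vadd H x (vscale H (- 1) x) = vzero H"
    and scale_one: "x \<in> vecs H \<Longrightarrow> vscale H 1 x = x"
    and scale_scale: "x \<in> vecs H \<Longrightarrow> vscale H a (vscale H b x) = vscale H (a * b) x"
    and scale_add: "\<lbrakk>x \<in> vecs H; y \<in> vecs H\<rbrakk>
          \<Longrightarrow> vscale H a (vadd H x y) = vadd H (vscale H a x) (vscale H a y)"
    and add_scale: "x \<in> vecs H
          \<Longrightarrow> vscale H (a + b) x = vadd H (vscale H a x) (vscale H b x)"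
    and inner_add: "\<lbrakk>x \<in> vecs H; y \<in> vecs H; z \<in> vecs H\<rbrakk>
          \<Longrightarrow> vinner H (vadd H x y) z = vinner H x z + vinner H y z"
    and inner_scale: "\<lbrakk>x \<in> vecs H; y \<in> vecs H\<rbrakk>
          \<Longrightarrow> vinner H (vscale H a x) y = a * vinner H x y"
    and inner_commute: "\<lbrakk>x \<in> vecs H; y \<in> vecs H\<rbrakk> \<Longrightarrow> vinner H y x = cnj (vinner H x y)"
    and inner_pos: "\<lbrakk>x \<in> vecs H; x \<noteq> vzero H\<rbrakk> \<Longrightarrow> Re (vinner H x x) > 0"
    and complete: "\<lbrakk>\<And>n::nat. u n \<in> vecs H;
            \<And>e. e > 0 \<Longrightarrow> \<exists>N. \<forall>m\<ge>N. \<forall>n\<ge>N. vdist H (u m) (u n) < e\<rbrakk>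
          \<Longrightarrow> \<exists>x\<in>vecs H. (\<lambda>n. vdist H (u n) x) \<longlonglongrightarrow> 0"

definition bounded_op :: "'v cspace \<Rightarrow> 'w cspace \<Rightarrow> ('v \<Rightarrow> 'w) \<Rightarrow> bool" where
  "bounded_op E F T \<longleftrightarrow>
     T \<in> vecs E \<rightarrow> vecs F \<and>
     (\<forall>x\<in>vecs E. \<forall>y\<in>vecs E. T (vadd E x y) = vadd F (T x) (T y)) \<and>
     (\<forall>a. \<forall>x\<in>vecs E. T (vscale E a x) = vscale F a (T x)) \<and>
     (\<exists>C. \<forall>x\<in>vecs E. vnorm F (T x) \<le> C * vnorm E x)"

definition op_norm :: "'v cspace \<Rightarrow> 'w cspace \<Rightarrow> ('v \<Rightarrow> 'w) \<Rightarrow> real" where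
  "op_norm E F T = (SUP x\<in>{x\<in>vecs E. vnorm E x \<le> 1}. vnorm F (T x))"

text \<open>The Hilbert space \<open>\<complex>\<close>, sitting in a sum type next to room for further Hilbert spaces, so
  that all spaces of one factorization live on the same type.\<close>

definition scalar_space :: "(complex + 'v) cspace" where
  "scalar_space = \<lparr>vecs = range Inl, vzero = Inl 0,
     vadd = (\<lambda>x y. Inl (projl x + projl y)),
     vscale = (\<lambda>a x. Inl (a * projl x)),
     vinner = (\<lambda>x y. projl x * cnj (projl y))\<rparr>"


section \<open>Multipliers\<close>

text \<open>\<open>\<phi>(t\<^sub>1 \<cdots> t\<^sub>d) = \<xi>\<^sub>1(t\<^sub>1) \<cdots> \<xi>\<^sub>d(t\<^sub>d) 1\<close>, with \<open>\<xi>\<^sub>i\<close> bounded maps from \<open>G\<close> to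
  \<open>B(H\<^sub>i, H\<^bsub>i-1\<^esub>)\<close> and \<open>H\<^sub>0 = H\<^sub>d = \<complex>\<close>.\<close>

definition Md_factorization ::
  "nat \<Rightarrow> ('a, 'b) monoid_scheme \<Rightarrow> (nat \<Rightarrow> (complex + 'v) cspace)
    \<Rightarrow> (nat \<Rightarrow> 'a \<Rightarrow> complex + 'v \<Rightarrow> complex + 'v) \<Rightarrow> ('a \<Rightarrow> complex) \<Rightarrow> bool" where
  "Md_factorization d G H \<xi> \<phi> \<longleftrightarrow>
     H 0 = scalar_space \<and> H d = scalar_space \<and>
     (\<forall>i\<le>d. complex_hilbert_space (H i)) \<and>
     (\<forall>i\<in>{1..d}. (\<forall>t\<in>carrier G. bounded_op (H i) (H (i - 1)) (\<xi> i t)) \<and>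
        bdd_above ((\<lambda>t. op_norm (H i) (H (i - 1)) (\<xi> i t)) ` carrier G)) \<and>
     (\<forall>t\<in>{1..d} \<rightarrow> carrier G.
        Inl (\<phi> (foldr (\<lambda>i x. t i \<otimes>\<^bsub>G\<^esub> x) [1..<Suc d] \<one>\<^bsub>G\<^esub>)) =
        foldr (\<lambda>i. \<xi> i (t i)) [1..<Suc d] (Inl 1))"

definition Md_bound ::
  "nat \<Rightarrow> ('a, 'b) monoid_scheme \<Rightarrow> (nat \<Rightarrow> (complex + 'v) cspace)
    \<Rightarrow> (nat \<Rightarrow> 'a \<Rightarrow> complex + 'v \<Rightarrow> complex + 'v) \<Rightarrow> real" where
  "Md_bound d G H \<xi> = (\<Prod>i=1..d. SUP t\<in>carrier G. op_norm (H i) (H (i - 1)) (\<xi> i t))"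

text \<open>HOL cannot quantify over all Hilbert spaces inside a definition, so the two definitions below
  use Hilbert spaces whose vectors are taken from \<open>'a list \<Rightarrow> complex\<close>. This loses nothing: by the
  lemma \<open>Md_factorization_universe\<close> at the end of this theory, a factorization through Hilbert
  spaces on an arbitrary type yields one through such spaces, with at most the same bound.
  Functions on \<open>G\<close> are represented by functions that are extensional on \<open>carrier G\<close>.\<close>

definition Md :: "nat \<Rightarrow> ('a, 'b) monoid_scheme \<Rightarrow> ('a \<Rightarrow> complex) set" where
  "Md d G = {\<phi> \<in> extensional (carrier G). bounded (\<phi> ` carrier G) \<and>
     (\<exists>(H :: nat \<Rightarrow> (complex + ('a list \<Rightarrow> complex)) cspace) \<xi>. Md_factorization d G H \<xi> \<phi>)}"

definition Md_norm :: "nat \<Rightarrow> ('a, 'b) monoid_scheme \<Rightarrow> ('a \<Rightarrow> complex) \<Rightarrow> real" where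
  "Md_norm d G \<phi> = Inf {Md_bound d G H \<xi> |
     (H :: nat \<Rightarrow> (complex + ('a list \<Rightarrow> complex)) cspace) \<xi>. Md_factorization d G H \<xi> \<phi>}"

section \<open>The predual and the approximation property\<close>

definition l1 :: "('a, 'b) monoid_scheme \<Rightarrow> ('a \<Rightarrow> complex) set" where
  "l1 G = {g \<in> extensional (carrier G). (\<lambda>t. norm (g t)) summable_on carrier G}"

definition duality :: "('a, 'b) monoid_scheme \<Rightarrow> ('a \<Rightarrow> complex) \<Rightarrow> ('a \<Rightarrow> complex) \<Rightarrow> complex" where
  "duality G \<phi> g = (\<Sum>\<^sub>\<infinity>t\<in>carrier G. \<phi> t * g t)"

definition Xd_norm :: "nat \<Rightarrow> ('a, 'b) monoid_scheme \<Rightarrow> ('a \<Rightarrow> complex) \<Rightarrow> real" where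
  "Xd_norm d G g = (SUP \<phi>\<in>{\<phi> \<in> Md d G. Md_norm d G \<phi> \<le> 1}. norm (duality G \<phi> g))"

definition Xd_dist :: "nat \<Rightarrow> ('a, 'b) monoid_scheme \<Rightarrow> ('a \<Rightarrow> complex) \<Rightarrow> ('a \<Rightarrow> complex) \<Rightarrow> real" where
  "Xd_dist d G g h = Xd_norm d G (\<lambda>t\<in>carrier G. g t - h t)"

text \<open>The completion \<open>X\<^sub>d(G)\<close> of \<open>\<ell>\<^sup>1(G)\<close> is realized as the set of classes of Cauchy sequences
  modulo sequences converging to 0; the pairing with \<open>M\<^sub>d(G)\<close> is extended by continuity.\<close>

definition Xd_cauchy :: "nat \<Rightarrow> ('a, 'b) monoid_scheme \<Rightarrow> (nat \<Rightarrow> 'a \<Rightarrow> complex) set" where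
  "Xd_cauchy d G = {u. range u \<subseteq> l1 G \<and>
     (\<forall>e>0. \<exists>N. \<forall>m\<ge>N. \<forall>n\<ge>N. Xd_dist d G (u m) (u n) < e)}"

definition Xd :: "nat \<Rightarrow> ('a, 'b) monoid_scheme \<Rightarrow> (nat \<Rightarrow> 'a \<Rightarrow> complex) set set" where
  "Xd d G = Xd_cauchy d G //
     {(u, v) \<in> Xd_cauchy d G \<times> Xd_cauchy d G. (\<lambda>n. Xd_dist d G (u n) (v n)) \<longlonglongrightarrow> 0}"

definition Xd_pairing ::
  "('a, 'b) monoid_scheme \<Rightarrow> ('a \<Rightarrow> complex) \<Rightarrow> (nat \<Rightarrow> 'a \<Rightarrow> complex) set \<Rightarrow> complex" where
  "Xd_pairing G \<phi> x = (THE z. \<forall>u\<in>x. (\<lambda>n. duality G \<phi> (u n)) \<longlonglongrightarrow> z)"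

text \<open>\<open>\<sigma>(M\<^sub>d(G), X\<^sub>d(G))\<close>: the initial topology for the pairings with elements of \<open>X\<^sub>d(G)\<close>.\<close>

definition Md_weak_star :: "nat \<Rightarrow> ('a, 'b) monoid_scheme \<Rightarrow> ('a \<Rightarrow> complex) topology" where
  "Md_weak_star d G = pullback_topology (Md d G) (\<lambda>\<phi>. \<lambda>x\<in>Xd d G. Xd_pairing G \<phi> x)
     (product_topology (\<lambda>_. euclidean) (Xd d G))"

definition finsupp_fun :: "('a, 'b) monoid_scheme \<Rightarrow> ('a \<Rightarrow> complex) set" where
  "finsupp_fun G = {\<phi> \<in> extensional (carrier G). finite {t \<in> carrier G. \<phi> t \<noteq> 0}}"

definition Md_AP :: "nat \<Rightarrow> ('a, 'b) monoid_scheme \<Rightarrow> bool" where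
  "Md_AP d G \<longleftrightarrow> (\<lambda>t\<in>carrier G. 1) \<in> Md_weak_star d G closure_of finsupp_fun G"


section \<open>Semidirect and free products of groups\<close>

text \<open>For an action \<open>\<alpha>\<close> of \<open>G\<close> on \<open>N\<close>, the pair \<open>(s, x)\<close> stands for the product \<open>x s\<close>, and
  \<open>s x s\<^sup>-\<^sup>1 = \<alpha> s x\<close>.\<close>

definition semidirect_product ::
  "('a, 'c) monoid_scheme \<Rightarrow> ('a \<Rightarrow> 'b \<Rightarrow> 'b) \<Rightarrow> ('b, 'e) monoid_scheme \<Rightarrow> ('a \<times> 'b) monoid" where
  "semidirect_product G \<alpha> N =
     \<lparr>carrier = carrier G \<times> carrier N,
      mult = (\<lambda>(s, x) (t, y). (s \<otimes>\<^bsub>G\<^esub> t, x \<otimes>\<^bsub>N\<^esub> \<alpha> s y)),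
      one = (\<one>\<^bsub>G\<^esub>, \<one>\<^bsub>N\<^esub>)\<rparr>"

text \<open>Elements of the free product are the reduced words: lists of non-identity letters, no two
  neighbouring ones from the same factor. A product is formed by prepending the letters of the left
  word to the right word one at a time, from right to left, merging and cancelling where needed.\<close>

fun prepend_letter ::
  "('a, 'c) monoid_scheme \<Rightarrow> ('b, 'e) monoid_scheme \<Rightarrow> 'a + 'b \<Rightarrow> ('a + 'b) list \<Rightarrow> ('a + 'b) list" where
  "prepend_letter G H (Inl x) (Inl y # w) =
     (if x \<otimes>\<^bsub>G\<^esub> y = \<one>\<^bsub>G\<^esub> then w else Inl (x \<otimes>\<^bsub>G\<^esub> y) # w)"
| "prepend_letter G H (Inr x) (Inr y # w) =
     (if x \<otimes>\<^bsub>H\<^esub> y = \<one>\<^bsub>H\<^esub> then w else Inr (x \<otimes>\<^bsub>H\<^esub> y) # w)"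
| "prepend_letter G H a w = a # w"

definition reduced_words ::
  "('a, 'c) monoid_scheme \<Rightarrow> ('b, 'e) monoid_scheme \<Rightarrow> ('a + 'b) list set" where
  "reduced_words G H =
     {w. set w \<subseteq> (carrier G - {\<one>\<^bsub>G\<^esub>}) <+> (carrier H - {\<one>\<^bsub>H\<^esub>}) \<and>
         successively (\<lambda>a b. isl a \<noteq> isl b) w}"

definition free_product ::
  "('a, 'c) monoid_scheme \<Rightarrow> ('b, 'e) monoid_scheme \<Rightarrow> ('a + 'b) list monoid" where
  "free_product G H =
     \<lparr>carrier = reduced_words G H, mult = (\<lambda>u v. foldr (prepend_letter G H) u v), one = []\<rparr>"

lemma group_semidirect_product:
  assumes "group G" "group N" "\<alpha> \<in> hom G (AutoGroup N)"
  shows "group (semidirect_product G \<alpha> N)"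
proof -
  interpret G: group G by fact
  interpret N: group N by fact
  interpret A: group "AutoGroup N" by (rule N.AutoGroup)
  have aut: "\<alpha> s \<in> auto N" if "s \<in> carrier G" for s
    using assms(3) that by (auto simp: hom_def AutoGroup_def)
  have cl: "\<alpha> s x \<in> carrier N" if "s \<in> carrier G" "x \<in> carrier N" for s x
    using aut[OF that(1)] that(2) by (auto simp: auto_def hom_def)
  have mu: "\<alpha> s (x \<otimes>\<^bsub>N\<^esub> y) = \<alpha> s x \<otimes>\<^bsub>N\<^esub> \<alpha> s y"
    if "s \<in> carrier G" "x \<in> carrier N" "y \<in> carrier N" for s x y
    using aut[OF that(1)] that(2,3) by (auto simp: auto_def hom_def)
  have comp: "\<alpha> (s \<otimes>\<^bsub>G\<^esub> t) x = \<alpha> s (\<alpha> t x)"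
    if "s \<in> carrier G" "t \<in> carrier G" "x \<in> carrier N" for s t x
    using hom_mult[OF assms(3) that(1,2)] aut[OF that(1)] aut[OF that(2)] that(3)
    by (auto simp: AutoGroup_def BijGroup_def auto_def compose_def)
  have "\<alpha> \<one>\<^bsub>G\<^esub> = \<one>\<^bsub>AutoGroup N\<^esub>"
    using hom_one[OF assms(3) G.is_group A.is_group] .
  then have one: "\<alpha> \<one>\<^bsub>G\<^esub> x = x" if "x \<in> carrier N" for x
    using that by (simp add: AutoGroup_def BijGroup_def)
  have inv: "\<alpha> (inv\<^bsub>G\<^esub> s) (inv\<^bsub>N\<^esub> x) \<otimes>\<^bsub>N\<^esub> \<alpha> (inv\<^bsub>G\<^esub> s) x = \<one>\<^bsub>N\<^esub>"
    if "s \<in> carrier G" "x \<in> carrier N" for s x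
  proof -
    have "\<alpha> (inv\<^bsub>G\<^esub> s) \<one>\<^bsub>N\<^esub> = \<one>\<^bsub>N\<^esub>"
      using aut[of "inv\<^bsub>G\<^esub> s"] that(1) hom_one[of "\<alpha> (inv\<^bsub>G\<^esub> s)" N N]
      by (auto simp: auto_def)
    then show ?thesis
      using mu[of "inv\<^bsub>G\<^esub> s" "inv\<^bsub>N\<^esub> x" x] that by simp
  qed
  show ?thesis
  proof (rule groupI)
    fix p q r
    assume "p \<in> carrier (semidirect_product G \<alpha> N)" "q \<in> carrier (semidirect_product G \<alpha> N)"
      "r \<in> carrier (semidirect_product G \<alpha> N)"
    then show "p \<otimes>\<^bsub>semidirect_product G \<alpha> N\<^esub> q \<otimes>\<^bsub>semidirect_product G \<alpha> N\<^esub> r =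
        p \<otimes>\<^bsub>semidirect_product G \<alpha> N\<^esub> (q \<otimes>\<^bsub>semidirect_product G \<alpha> N\<^esub> r)"
      by (auto simp: semidirect_product_def comp mu cl G.m_assoc N.m_assoc)
  next
    fix p assume "p \<in> carrier (semidirect_product G \<alpha> N)"
    then show "\<exists>q\<in>carrier (semidirect_product G \<alpha> N).
        q \<otimes>\<^bsub>semidirect_product G \<alpha> N\<^esub> p = \<one>\<^bsub>semidirect_product G \<alpha> N\<^esub>"
      by (intro bexI[of _ "(inv\<^bsub>G\<^esub> fst p, \<alpha> (inv\<^bsub>G\<^esub> fst p) (inv\<^bsub>N\<^esub> snd p))"])
        (auto simp: semidirect_product_def inv cl)
  qed (auto simp: semidirect_product_def one cl)
qed

lemma group_free_product:
  assumes "group G" "group H"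
  shows "group (free_product G H)"
proof -
  interpret G: group G by fact
  interpret H: group H by fact
  let ?p = "prepend_letter G H" and ?R = "reduced_words G H"
  let ?L = "(carrier G - {\<one>\<^bsub>G\<^esub>}) <+> (carrier H - {\<one>\<^bsub>H\<^esub>})"
  have cons: "a # w \<in> ?R \<longleftrightarrow> a \<in> ?L \<and> w \<in> ?R \<and> (\<forall>b w'. w = b # w' \<longrightarrow> isl a \<noteq> isl b)" for a w
    by (cases w) (auto simp: reduced_words_def)
  have p_closed: "?p a w \<in> ?R" if "a \<in> ?L" "w \<in> ?R" for a w
    using that by (cases a; cases w; cases "hd w") (auto simp: cons)
  have p_Cons: "?p a w = a # w" if "a # w \<in> ?R" for a w
    using that by (cases a; cases w; cases "hd w") (auto simp: cons)
  have invG: "x \<otimes>\<^bsub>G\<^esub> y = \<one>\<^bsub>G\<^esub> \<Longrightarrow> x \<otimes>\<^bsub>G\<^esub> (y \<otimes>\<^bsub>G\<^esub> z) = z"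
    if "x \<in> carrier G" "y \<in> carrier G" "z \<in> carrier G" for x y z
    using that by (simp flip: G.m_assoc)
  have invH: "x \<otimes>\<^bsub>H\<^esub> y = \<one>\<^bsub>H\<^esub> \<Longrightarrow> x \<otimes>\<^bsub>H\<^esub> (y \<otimes>\<^bsub>H\<^esub> z) = z"
    if "x \<in> carrier H" "y \<in> carrier H" "z \<in> carrier H" for x y z
    using that by (simp flip: H.m_assoc)
  have mergeG: "?p (Inl x) (?p (Inl y) w) =
      (if x \<otimes>\<^bsub>G\<^esub> y = \<one>\<^bsub>G\<^esub> then w else ?p (Inl (x \<otimes>\<^bsub>G\<^esub> y)) w)"
    if "w \<in> ?R" "Inl x \<in> ?L" "Inl y \<in> ?L" for x y w
  proof (cases "\<exists>z w'. w = Inl z # w'")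
    case False
    then have "?p (Inl u) w = Inl u # w" for u
      using that(1) by (cases w; cases "hd w") auto
    then show ?thesis by simp
  next
    case True
    then obtain z w' where w: "w = Inl z # w'" by blast
    have x: "x \<in> carrier G" "x \<noteq> \<one>\<^bsub>G\<^esub>" and y: "y \<in> carrier G" "y \<noteq> \<one>\<^bsub>G\<^esub>" and z: "z \<in> carrier G" "z \<noteq> \<one>\<^bsub>G\<^esub>"
      using that by (auto simp: w cons)
    have w'R: "Inl x # w' \<in> ?R" using that by (auto simp: w cons)
    show ?thesis
    proof (cases "y \<otimes>\<^bsub>G\<^esub> z = \<one>\<^bsub>G\<^esub>")
      case True
      have "x \<otimes>\<^bsub>G\<^esub> y \<otimes>\<^bsub>G\<^esub> z = x" using True x y z by (simp add: G.m_assoc)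
      moreover have "x \<otimes>\<^bsub>G\<^esub> y = \<one>\<^bsub>G\<^esub> \<Longrightarrow> x = z"
        using True x y z calculation by simp
      ultimately show ?thesis using True x p_Cons[OF w'R] by (auto simp: w)
    next
      case False
      have "x \<otimes>\<^bsub>G\<^esub> y = \<one>\<^bsub>G\<^esub> \<Longrightarrow> x \<otimes>\<^bsub>G\<^esub> (y \<otimes>\<^bsub>G\<^esub> z) = z" by (rule invG) (use x y z in auto)
      then show ?thesis using False x y z by (auto simp: w G.m_assoc)
    qed
  qed
  have mergeH: "?p (Inr x) (?p (Inr y) w) =
      (if x \<otimes>\<^bsub>H\<^esub> y = \<one>\<^bsub>H\<^esub> then w else ?p (Inr (x \<otimes>\<^bsub>H\<^esub> y)) w)"
    if "w \<in> ?R" "Inr x \<in> ?L" "Inr y \<in> ?L" for x y w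
  proof (cases "\<exists>z w'. w = Inr z # w'")
    case False
    then have "?p (Inr u) w = Inr u # w" for u
      using that(1) by (cases w; cases "hd w") auto
    then show ?thesis by simp
  next
    case True
    then obtain z w' where w: "w = Inr z # w'" by blast
    have x: "x \<in> carrier H" "x \<noteq> \<one>\<^bsub>H\<^esub>" and y: "y \<in> carrier H" "y \<noteq> \<one>\<^bsub>H\<^esub>" and z: "z \<in> carrier H" "z \<noteq> \<one>\<^bsub>H\<^esub>"
      using that by (auto simp: w cons)
    have w'R: "Inr x # w' \<in> ?R" using that by (auto simp: w cons)
    show ?thesis
    proof (cases "y \<otimes>\<^bsub>H\<^esub> z = \<one>\<^bsub>H\<^esub>")
      case True
      have "x \<otimes>\<^bsub>H\<^esub> y \<otimes>\<^bsub>H\<^esub> z = x" using True x y z by (simp add: H.m_assoc)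
      moreover have "x \<otimes>\<^bsub>H\<^esub> y = \<one>\<^bsub>H\<^esub> \<Longrightarrow> x = z"
        using True x y z calculation by simp
      ultimately show ?thesis using True x p_Cons[OF w'R] by (auto simp: w)
    next
      case False
      have "x \<otimes>\<^bsub>H\<^esub> y = \<one>\<^bsub>H\<^esub> \<Longrightarrow> x \<otimes>\<^bsub>H\<^esub> (y \<otimes>\<^bsub>H\<^esub> z) = z" by (rule invH) (use x y z in auto)
      then show ?thesis using False x y z by (auto simp: w H.m_assoc)
    qed
  qed
  have closed: "foldr ?p u v \<in> ?R" if "set u \<subseteq> ?L" "v \<in> ?R" for u v
    using that by (induction u) (auto intro!: p_closed)
  have letters: "set u \<subseteq> ?L" if "u \<in> ?R" for u using that by (simp add: reduced_words_def)
  have p_foldr: "foldr ?p (?p a v) w = ?p a (foldr ?p v w)"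
    if "a \<in> ?L" "v \<in> ?R" "w \<in> ?R" for a v w
  proof -
    consider (l) x y v' where "a = Inl x" "v = Inl y # v'" | (r) x y v' where "a = Inr x" "v = Inr y # v'"
      | (o) "?p a v = a # v"
      by (cases a; cases v; cases "hd v") auto
    then show ?thesis
    proof cases
      case l
      then have "foldr ?p v' w \<in> ?R" using closed[of v' w] letters[OF that(2)] that by simp
      then show ?thesis using l that mergeG[of "foldr ?p v' w" x y] letters[OF that(2)] by auto
    next
      case r
      then have "foldr ?p v' w \<in> ?R" using closed[of v' w] letters[OF that(2)] that by simp
      then show ?thesis using r that mergeH[of "foldr ?p v' w" x y] letters[OF that(2)] by auto
    qed simp
  qed
  have assoc: "foldr ?p (foldr ?p u v) w = foldr ?p u (foldr ?p v w)"
    if "set u \<subseteq> ?L" "v \<in> ?R" "w \<in> ?R" for u v w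
    using that by (induction u) (auto simp: p_foldr closed)
  have right_id: "foldr ?p u [] = u" if "u \<in> ?R" for u
    using that by (induction u) (auto simp: p_Cons cons)
  let ?i = "map_sum (m_inv G) (m_inv H)"
  have inv: "foldr ?p (rev (map ?i u)) u = []" if "u \<in> ?R" for u
    using that
  proof (induction u)
    case (Cons a u)
    have "?p (?i a) (a # u) = u" using Cons.prems by (cases a) (auto simp: cons)
    then show ?case using Cons by (simp add: cons)
  qed simp
  have inv_letters: "?i ` ?L \<subseteq> ?L" by auto
  show ?thesis
  proof (rule groupI)
    fix u v assume "u \<in> carrier (free_product G H)" "v \<in> carrier (free_product G H)"
    then show "u \<otimes>\<^bsub>free_product G H\<^esub> v \<in> carrier (free_product G H)"
      by (simp add: free_product_def closed letters)
  next
    fix u assume u: "u \<in> carrier (free_product G H)"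
    let ?j = "foldr ?p (rev (map ?i u)) []"
    have L: "set (rev (map ?i u)) \<subseteq> ?L"
      using inv_letters letters[of u] u by (simp add: free_product_def) blast
    have "?j \<in> ?R" by (rule closed[OF L]) (simp add: reduced_words_def)
    moreover have "foldr ?p ?j u = []"
      using assoc[OF L, of "[]" u] inv[of u] u by (simp add: free_product_def reduced_words_def)
    ultimately show "\<exists>v\<in>carrier (free_product G H).
        v \<otimes>\<^bsub>free_product G H\<^esub> u = \<one>\<^bsub>free_product G H\<^esub>"
      by (auto simp: free_product_def)
  next
    fix u v w assume "u \<in> carrier (free_product G H)" "v \<in> carrier (free_product G H)"
      "w \<in> carrier (free_product G H)"
    then show "u \<otimes>\<^bsub>free_product G H\<^esub> v \<otimes>\<^bsub>free_product G H\<^esub> w =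
        u \<otimes>\<^bsub>free_product G H\<^esub> (v \<otimes>\<^bsub>free_product G H\<^esub> w)"
      by (simp add: free_product_def assoc letters)
  qed (auto simp: free_product_def reduced_words_def)
qed


section \<open>Factorizations through arbitrary Hilbert spaces\<close>

text \<open>Each space is replaced by the closed span of the vectors that occur in the factorization. A vector
  of that span is determined by its inner products with those vectors, which are indexed by lists of
  group elements; so the span can be carried over to a set of functions \<open>'a list \<Rightarrow> complex\<close>.\<close>

context complex_hilbert_space
begin

lemma inner_add_right: "\<lbrakk>x \<in> vecs H; y \<in> vecs H; z \<in> vecs H\<rbrakk>
    \<Longrightarrow> vinner H z (vadd H x y) = vinner H z x + vinner H z y"
  using inner_commute[of "vadd H x y" z] inner_commute[of x z] inner_commute[of y z]
  by (simp add: inner_add add_closed)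

lemma inner_scale_right: "\<lbrakk>x \<in> vecs H; y \<in> vecs H\<rbrakk>
    \<Longrightarrow> vinner H y (vscale H a x) = cnj a * vinner H y x"
  using inner_commute[of "vscale H a x" y] inner_commute[of x y]
  by (simp add: inner_scale scale_closed)

lemma scale_zero: "x \<in> vecs H \<Longrightarrow> vscale H 0 x = vzero H"
  using add_scale[of x 1 "-1"] by (simp add: scale_one add_neg)

lemma inner_zero: "y \<in> vecs H \<Longrightarrow> vinner H (vzero H) y = 0"
  using inner_scale[of "vzero H" y 0] scale_zero[of "vzero H"] zero_closed by simp

lemma inner_self: assumes "x \<in> vecs H" shows "vinner H x x = of_real ((vnorm H x)\<^sup>2)"
proof -
  have "0 \<le> Re (vinner H x x)"
    using inner_pos[OF assms] inner_zero[OF zero_closed] by (cases "x = vzero H") auto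
  moreover have "Im (vinner H x x) = 0"
    using inner_commute[OF assms assms] by (simp add: complex_eq_iff)
  ultimately show ?thesis by (simp add: vnorm_def complex_eq_iff)
qed

lemma inner_nonneg: "x \<in> vecs H \<Longrightarrow> 0 \<le> Re (vinner H x x)"
  using inner_self[of x] by (metis Re_complex_of_real zero_le_power2)

lemma vnorm_nonneg: "x \<in> vecs H \<Longrightarrow> 0 \<le> vnorm H x"
  by (simp add: vnorm_def inner_nonneg)

lemma cauchy_schwarz:
  assumes "x \<in> vecs H" "y \<in> vecs H"
  shows "norm (vinner H x y) \<le> vnorm H x * vnorm H y"
proof (cases "y = vzero H")
  case True
  then show ?thesis
    using assms inner_commute[OF assms] by (simp add: inner_zero vnorm_def)
next
  case False
  define c where "c = vinner H x y"
  define N where "N = Re (vinner H y y)"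
  have N: "N > 0" "vinner H y y = of_real N"
    using inner_pos[OF assms(2) False] inner_self[OF assms(2)] by (auto simp: N_def)
  define z where "z = vadd H x (vscale H (- c / of_real N) y)"
  have z: "z \<in> vecs H" by (simp add: z_def assms add_closed scale_closed)
  have yx: "vinner H y x = cnj c" using inner_commute[OF assms] by (simp add: c_def)
  have "vinner H z z = vinner H x x - c * cnj c / of_real N"
  proof -
    define b where "b = - c / of_real N"
    have "vinner H z z = vinner H x x + cnj b * c + b * (cnj c + cnj b * of_real N)"
      unfolding z_def b_def[symmetric]
      using assms N(2) yx
      by (simp add: inner_add inner_add_right inner_scale inner_scale_right
        add_closed scale_closed distrib_left flip: c_def)
    moreover have "cnj b * of_real N = - cnj c" using N(1) by (simp add: b_def)
    ultimately show ?thesis by (simp add: b_def)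
  qed
  then have "Re (vinner H z z) = Re (vinner H x x) - (norm c)\<^sup>2 / N"
    by (simp add: complex_mult_cnj cmod_power2 flip: of_real_divide of_real_power of_real_add)
  moreover have "0 \<le> Re (vinner H z z)" by (rule inner_nonneg[OF z])
  ultimately have "(norm c)\<^sup>2 / N \<le> Re (vinner H x x)" by simp
  then have "(norm c)\<^sup>2 \<le> Re (vinner H x x) * N" using N(1) by (simp add: pos_divide_le_eq)
  also have "\<dots> = (vnorm H x * vnorm H y)\<^sup>2"
    using inner_self[OF assms(1)] inner_self[OF assms(2)] by (simp add: N_def power_mult_distrib)
  finally show ?thesis
    unfolding c_def by (rule power2_le_imp_le) (simp add: vnorm_nonneg assms)
qed

end

definition closed_subspace :: "'v cspace \<Rightarrow> 'v set \<Rightarrow> bool" where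
  "closed_subspace H L \<longleftrightarrow> L \<subseteq> vecs H \<and> vzero H \<in> L \<and>
     (\<forall>x\<in>L. \<forall>y\<in>L. vadd H x y \<in> L) \<and> (\<forall>a. \<forall>x\<in>L. vscale H a x \<in> L) \<and>
     (\<forall>u x. range u \<subseteq> L \<longrightarrow> x \<in> vecs H \<longrightarrow> (\<lambda>n::nat. vdist H (u n) x) \<longlonglongrightarrow> 0 \<longrightarrow> x \<in> L)"

lemma closed_subspaceI:
  assumes "L \<subseteq> vecs H" "vzero H \<in> L"
    and "\<And>x y. x \<in> L \<Longrightarrow> y \<in> L \<Longrightarrow> vadd H x y \<in> L"
    and "\<And>a x. x \<in> L \<Longrightarrow> vscale H a x \<in> L"
    and "\<And>u x. (\<And>n. u n \<in> L) \<Longrightarrow> x \<in> vecs H \<Longrightarrow> (\<lambda>n::nat. vdist H (u n) x) \<longlonglongrightarrow> 0 \<Longrightarrow> x \<in> L"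
  shows "closed_subspace H L"
  unfolding closed_subspace_def
  by (intro conjI allI ballI impI, fact, fact, simp add: assms(3), simp add: assms(4))
    (rule assms(5), auto)

lemma closed_subspaceD:
  assumes "closed_subspace H L" "\<And>n. u n \<in> L" "x \<in> vecs H" "(\<lambda>n::nat. vdist H (u n) x) \<longlonglongrightarrow> 0"
  shows "x \<in> L"
  using assms unfolding closed_subspace_def by (meson image_subsetI)

definition closed_span :: "'v cspace \<Rightarrow> 'v set \<Rightarrow> 'v set" where
  "closed_span H S = \<Inter> {L. closed_subspace H L \<and> S \<subseteq> L}"

context complex_hilbert_space
begin

lemma closed_subspace_vecs: "closed_subspace H (vecs H)"
  by (rule closed_subspaceI) (auto simp: zero_closed add_closed scale_closed)

lemma closed_subspace_closed_span:
  assumes "S \<subseteq> vecs H" shows "closed_subspace H (closed_span H S)"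
proof -
  have sub: "closed_span H S \<subseteq> vecs H" unfolding closed_span_def
    using closed_subspace_vecs assms by blast
  have span: "x \<in> closed_span H S"
    if "\<And>L. closed_subspace H L \<Longrightarrow> closed_span H S \<subseteq> L \<Longrightarrow> x \<in> L" for x
    using that unfolding closed_span_def by blast
  have zero: "vzero H \<in> closed_span H S"
    by (rule span) (simp add: closed_subspace_def)
  have add: "vadd H x y \<in> closed_span H S" if "x \<in> closed_span H S" "y \<in> closed_span H S" for x y
  proof (rule span)
    fix L assume "closed_subspace H L" "closed_span H S \<subseteq> L"
    then show "vadd H x y \<in> L" using that unfolding closed_subspace_def by (meson subsetD)
  qed
  have scale: "vscale H a x \<in> closed_span H S" if "x \<in> closed_span H S" for a x
  proof (rule span)
    fix L assume "closed_subspace H L" "closed_span H S \<subseteq> L"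
    then show "vscale H a x \<in> L" using that unfolding closed_subspace_def by (meson subsetD)
  qed
  have lim: "x \<in> closed_span H S"
    if u: "\<And>n. u n \<in> closed_span H S" "x \<in> vecs H" "(\<lambda>n::nat. vdist H (u n) x) \<longlonglongrightarrow> 0" for u x
  proof (rule span)
    fix L assume L: "closed_subspace H L" "closed_span H S \<subseteq> L"
    then have "range u \<subseteq> L" using u(1) by blast
    then show "x \<in> L" using L(1) u(2,3) unfolding closed_subspace_def by meson
  qed
  show ?thesis by (rule closed_subspaceI) (fact sub zero add scale lim)+
qed

lemma closed_subspace_orthogonal:
  assumes y: "y \<in> vecs H"
  shows "closed_subspace H {x \<in> vecs H. vinner H x y = 0}"
proof -
  have closed: "vinner H x y = 0" if u: "\<And>n. u n \<in> vecs H" "\<And>n. vinner H (u n) y = 0"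
    and x: "x \<in> vecs H" and lim: "(\<lambda>n::nat. vdist H (u n) x) \<longlonglongrightarrow> 0" for u x
  proof -
    have "norm (vinner H x y) \<le> vdist H (u n) x * vnorm H y" for n
      using cauchy_schwarz[of "vadd H (u n) (vscale H (-1) x)" y] u x y
      by (simp add: vdist_def add_closed scale_closed inner_add inner_scale)
    moreover have "(\<lambda>n. vdist H (u n) x * vnorm H y) \<longlonglongrightarrow> 0"
      using tendsto_mult_right[OF lim, of "vnorm H y"] by simp
    ultimately have "norm (vinner H x y) \<le> 0"
      by (intro LIMSEQ_le_const) auto
    then show ?thesis by simp
  qed
  show ?thesis
  proof (rule closed_subspaceI)
    fix u x
    assume "\<And>n. u n \<in> {x \<in> vecs H. vinner H x y = 0}" "x \<in> vecs H"
      "(\<lambda>n::nat. vdist H (u n) x) \<longlonglongrightarrow> 0"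
    then show "x \<in> {x \<in> vecs H. vinner H x y = 0}" using closed[of u x] by simp
  qed (use y in \<open>auto simp: zero_closed add_closed scale_closed inner_zero inner_add inner_scale\<close>)
qed

lemma closed_span_separated:
  assumes "S \<subseteq> vecs H" "x \<in> closed_span H S" "y \<in> closed_span H S"
    and "\<And>s. s \<in> S \<Longrightarrow> vinner H x s = vinner H y s"
  shows "x = y"
proof -
  have sub: "closed_span H S \<subseteq> vecs H"
    using closed_subspace_closed_span[OF assms(1)] by (simp add: closed_subspace_def)
  define h where "h = vadd H x (vscale H (-1) y)"
  have xy: "x \<in> vecs H" "y \<in> vecs H" using assms sub by auto
  have hK: "h \<in> closed_span H S"
    using assms closed_subspace_closed_span[OF assms(1)] by (auto simp: closed_subspace_def h_def)
  then have h: "h \<in> vecs H" using sub by auto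
  have "vinner H h s = 0" if "s \<in> S" for s
    using assms that xy by (auto simp: h_def inner_add inner_scale scale_closed subset_iff)
  then have "vinner H s h = 0" if "s \<in> S" for s
    using that inner_commute[OF h, of s] assms(1) by auto
  then have "h \<in> {x \<in> vecs H. vinner H x h = 0}"
    using closed_subspace_orthogonal[OF h] hK assms(1) unfolding closed_span_def by blast
  then have "h = vzero H" using inner_pos[OF h] by auto
  then have "vadd H y (vadd H x (vscale H (-1) y)) = y"
    using xy by (simp add: h_def add_zero)
  moreover have "vadd H y (vadd H x (vscale H (-1) y)) = x"
    using xy by (metis add_assoc add_commute add_neg add_zero scale_closed)
  ultimately show ?thesis by simp
qed

lemma bounded_op_vimage:
  assumes T: "bounded_op E H T" "complex_hilbert_space E" and L: "closed_subspace H L"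
  shows "closed_subspace E {x \<in> vecs E. T x \<in> L}"
proof -
  interpret E: complex_hilbert_space E by fact
  have Tv: "T x \<in> vecs H" if "x \<in> vecs E" for x using T that by (auto simp: bounded_op_def)
  have Ts: "T (vscale E a x) = vscale H a (T x)" if "x \<in> vecs E" for a x
    using T that by (auto simp: bounded_op_def)
  have Ta: "T (vadd E x y) = vadd H (T x) (T y)" if "x \<in> vecs E" "y \<in> vecs E" for x y
    using T that by (auto simp: bounded_op_def)
  obtain C where C: "\<And>x. x \<in> vecs E \<Longrightarrow> vnorm H (T x) \<le> C * vnorm E x"
    using T unfolding bounded_op_def by blast
  have T0: "T (vzero E) = vzero H"
    using Ts[OF E.zero_closed, of 0] by (simp add: E.scale_zero scale_zero Tv E.zero_closed)
  have closed: "T x \<in> L" if u: "\<And>n. u n \<in> vecs E" "\<And>n. T (u n) \<in> L"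
    and x: "x \<in> vecs E" and lim: "(\<lambda>n::nat. vdist E (u n) x) \<longlonglongrightarrow> 0" for u x
  proof -
    have upper: "vdist H (T (u n)) (T x) \<le> C * vdist E (u n) x" for n
      using C[of "vadd E (u n) (vscale E (-1) x)"] u x
      by (simp add: vdist_def Ta Ts E.add_closed E.scale_closed)
    have lower: "0 \<le> vdist H (T (u n)) (T x)" for n
      using u x by (simp add: vdist_def vnorm_nonneg Tv add_closed scale_closed)
    have "(\<lambda>n. C * vdist E (u n) x) \<longlonglongrightarrow> 0"
      using tendsto_mult_left[OF lim, of C] by simp
    then have lim': "(\<lambda>n. vdist H (T (u n)) (T x)) \<longlonglongrightarrow> 0"
      by (rule tendsto_sandwich[OF always_eventually always_eventually tendsto_const, rotated -1])
        (simp_all add: upper lower)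
    show ?thesis by (rule closed_subspaceD[OF L _ _ lim']) (simp_all add: u x Tv)
  qed
  have L': "vzero H \<in> L" "x \<in> L \<Longrightarrow> y \<in> L \<Longrightarrow> vadd H x y \<in> L" "x \<in> L \<Longrightarrow> vscale H a x \<in> L"
    for x y a
    using L by (simp_all add: closed_subspace_def)
  show ?thesis
  proof (rule closed_subspaceI)
    fix u x
    assume "\<And>n. u n \<in> {x \<in> vecs E. T x \<in> L}" "x \<in> vecs E"
      "(\<lambda>n::nat. vdist E (u n) x) \<longlonglongrightarrow> 0"
    then show "x \<in> {x \<in> vecs E. T x \<in> L}" using closed[of u x] by simp
  qed (auto simp: E.zero_closed E.add_closed E.scale_closed T0 Ta Ts L')
qed

end

definition transported :: "'v cspace \<Rightarrow> 'v set \<Rightarrow> ('v \<Rightarrow> 'w) \<Rightarrow> 'w cspace" where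
  "transported H K J = (let I = inv_into K J in
     \<lparr>vecs = J ` K, vzero = J (vzero H),
      vadd = (\<lambda>x y. J (vadd H (I x) (I y))),
      vscale = (\<lambda>a x. J (vscale H a (I x))),
      vinner = (\<lambda>x y. vinner H (I x) (I y))\<rparr>)"

lemma vnorm_transported: "inj_on J K \<Longrightarrow> x \<in> K \<Longrightarrow> vnorm (transported H K J) (J x) = vnorm H x"
  by (simp add: vnorm_def transported_def Let_def)

lemma complex_hilbert_space_transported:
  assumes "complex_hilbert_space H" "closed_subspace H K" and J: "inj_on J K"
  shows "complex_hilbert_space (transported H K J)"
proof -
  interpret complex_hilbert_space H by fact
  have K: "x \<in> K \<Longrightarrow> x \<in> vecs H" "vzero H \<in> K" "x \<in> K \<Longrightarrow> y \<in> K \<Longrightarrow> vadd H x y \<in> K"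
    "x \<in> K \<Longrightarrow> vscale H a x \<in> K" for x y a
    using assms(2) by (auto simp: closed_subspace_def)
  let ?H = "transported H K J"
  have vecs: "x \<in> vecs ?H \<longleftrightarrow> (\<exists>y\<in>K. x = J y)" for x by (auto simp: transported_def Let_def)
  have simps: "x \<in> K \<Longrightarrow> y \<in> K \<Longrightarrow> vadd ?H (J x) (J y) = J (vadd H x y)"
     "x \<in> K \<Longrightarrow> vscale ?H a (J x) = J (vscale H a x)"
     "x \<in> K \<Longrightarrow> y \<in> K \<Longrightarrow> vinner ?H (J x) (J y) = vinner H x y"
     "vzero ?H = J (vzero H)" for x y a
    using J by (auto simp: transported_def Let_def)
  have dist: "vdist ?H (J x) (J y) = vdist H x y" if "x \<in> K" "y \<in> K" for x y
    using that J K by (simp add: vdist_def simps vnorm_transported)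
  show ?thesis
  proof
    fix u :: "nat \<Rightarrow> 'b"
    assume u: "\<And>n. u n \<in> vecs ?H"
      and C: "\<And>e. e > 0 \<Longrightarrow> \<exists>N. \<forall>m\<ge>N. \<forall>n\<ge>N. vdist ?H (u m) (u n) < e"
    obtain v where v: "\<And>n. v n \<in> K" "\<And>n. u n = J (v n)" using u unfolding vecs by metis
    have "\<exists>x\<in>vecs H. (\<lambda>n. vdist H (v n) x) \<longlonglongrightarrow> 0"
      using C v by (intro complete) (auto simp: dist K)
    then obtain x where x: "x \<in> vecs H" "(\<lambda>n. vdist H (v n) x) \<longlonglongrightarrow> 0" by blast
    then have "x \<in> K" using assms(2) v(1) unfolding closed_subspace_def by blast
    then show "\<exists>x\<in>vecs ?H. (\<lambda>n. vdist ?H (u n) x) \<longlonglongrightarrow> 0"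
      using x v by (intro bexI[of _ "J x"]) (auto simp: vecs dist)
  next
    fix x y assume "x \<in> vecs ?H" "y \<in> vecs ?H"
    then obtain x' y' where "x' \<in> K" "y' \<in> K" "x = J x'" "y = J y'" by (auto simp: vecs)
    then show "vadd ?H x y = vadd ?H y x" and "vinner ?H y x = cnj (vinner ?H x y)"
      using add_commute[of x' y'] inner_commute[of x' y'] K(1) by (simp_all add: simps)
  next
    fix x assume "x \<in> vecs ?H" "x \<noteq> vzero ?H"
    then obtain x' where "x' \<in> K" "x = J x'" "x' \<noteq> vzero H" by (auto simp: vecs simps)
    then show "Re (vinner ?H x x) > 0"
      using inner_pos[of x'] K(1) by (simp add: simps)
  qed (auto simp: vecs simps K add_assoc add_zero add_neg scale_one scale_scale scale_add add_scale
      inner_add inner_scale)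
qed

lemma complex_hilbert_space_scalar: "complex_hilbert_space scalar_space"
proof
  fix u :: "nat \<Rightarrow> complex + 'v"
  have dist: "vdist scalar_space (Inl x) (Inl y :: complex + 'v) = dist x y" for x y
    by (simp add: vdist_def vnorm_def scalar_space_def dist_norm cmod_def power2_eq_square algebra_simps)
  assume u: "\<And>n. u n \<in> vecs scalar_space"
    and C: "\<And>e. e > 0 \<Longrightarrow> \<exists>N. \<forall>m\<ge>N. \<forall>n\<ge>N. vdist scalar_space (u m) (u n) < e"
  have "\<forall>n. \<exists>z. u n = Inl z" using u by (auto simp: scalar_space_def)
  then obtain v where v: "\<And>n. u n = Inl (v n)" by metis
  have "Cauchy v" using C unfolding v dist Cauchy_def by simp
  then obtain z where "v \<longlonglongrightarrow> z" using Cauchy_convergent_iff convergent_def by blast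
  then show "\<exists>x\<in>vecs scalar_space. (\<lambda>n. vdist scalar_space (u n) x) \<longlonglongrightarrow> 0"
    by (intro bexI[of _ "Inl z"]) (simp_all add: v dist tendsto_dist_iff[symmetric], simp add: scalar_space_def)
qed (auto simp: scalar_space_def algebra_simps complex_eq_iff sum_squares_gt_zero_iff)

lemma op_norm_le:
  assumes "complex_hilbert_space E" "bounded_op E F T" "x \<in> vecs E" "vnorm E x \<le> 1"
  shows "vnorm F (T x) \<le> op_norm E F T"
proof -
  interpret complex_hilbert_space E by fact
  obtain C where C: "\<And>x. x \<in> vecs E \<Longrightarrow> vnorm F (T x) \<le> C * vnorm E x"
    using assms unfolding bounded_op_def by blast
  have "vnorm F (T x) \<le> \<bar>C\<bar>" if "x \<in> vecs E" "vnorm E x \<le> 1" for x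
  proof -
    have "0 \<le> vnorm E x" by (rule vnorm_nonneg[OF that(1)])
    then have "C * vnorm E x \<le> \<bar>C\<bar> * 1" using that by (intro mult_mono) auto
    then show ?thesis using C[OF that(1)] by simp
  qed
  then show ?thesis using assms unfolding op_norm_def
    by (intro cSUP_upper bdd_aboveI2[of _ _ "\<bar>C\<bar>"]) auto
qed

lemma Md_factorization_universe:
  fixes H :: "nat \<Rightarrow> (complex + 'v) cspace" and G :: "('a, 'b) monoid_scheme"
  assumes F: "Md_factorization d G H \<xi> \<phi>" and ne: "carrier G \<noteq> {}"
  shows "\<exists>(H' :: nat \<Rightarrow> (complex + ('a list \<Rightarrow> complex)) cspace) \<xi>'.
           Md_factorization d G H' \<xi>' \<phi> \<and> Md_bound d G H' \<xi>' \<le> Md_bound d G H \<xi>"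
proof -
  have H: "complex_hilbert_space (H i)" if "i \<le> d" for i
    using F that by (simp add: Md_factorization_def)
  have H0d: "H 0 = scalar_space" "H d = scalar_space" using F by (simp_all add: Md_factorization_def)
  have \<xi>: "bounded_op (H i) (H (i - 1)) (\<xi> i t)" if "i \<in> {1..d}" "t \<in> carrier G" for i t
    using F that by (simp add: Md_factorization_def)
  define w where "w i t = foldr (\<lambda>j. \<xi> j (t j)) [Suc i..<Suc d] (Inl 1)" for i t
  have w_d: "w d t = Inl 1" for t by (simp add: w_def)
  have w_step: "w i t = \<xi> (Suc i) (t (Suc i)) (w (Suc i) t)" if "i < d" for i t
    using that by (simp add: w_def upt_conv_Cons del: upt_Suc)
  have w_vecs: "w i t \<in> vecs (H i)" if "i \<le> d" "t \<in> {1..d} \<rightarrow> carrier G" for i t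
    using that(1)
  proof (induction rule: inc_induct)
    case base show ?case by (simp add: w_d H0d scalar_space_def)
  next
    case (step n)
    moreover have "t (Suc n) \<in> carrier G" using step that(2) by (auto simp: Pi_iff)
    ultimately show ?case using \<xi>[of "Suc n" "t (Suc n)"] by (auto simp: w_step bounded_op_def)
  qed
  define S where "S i = {w i t | t. t \<in> {1..d} \<rightarrow> carrier G}" for i
  have S: "S i \<subseteq> vecs (H i)" if "i \<le> d" for i using w_vecs that by (auto simp: S_def)
  define e where "e i \<longleftrightarrow> i = 0 \<or> i = d" for i
  define K where "K i = (if e i then vecs (H i) else closed_span (H i) (S i))" for i
  define J :: "nat \<Rightarrow> complex + 'v \<Rightarrow> complex + ('a list \<Rightarrow> complex)" where
    "J i x = (if e i then Inl (projl x) else Inr (\<lambda>ts. vinner (H i) x (w i (\<lambda>j. ts ! j))))" for i x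
  have K: "closed_subspace (H i) (K i)" if "i \<le> d" for i
    using complex_hilbert_space.closed_subspace_vecs[OF H[OF that]]
      complex_hilbert_space.closed_subspace_closed_span[OF H[OF that] S[OF that]]
    by (simp add: K_def)
  have KH: "K i \<subseteq> vecs (H i)" if "i \<le> d" for i using K[OF that] by (simp add: closed_subspace_def)
  have K0: "vzero (H i) \<in> K i" if "i \<le> d" for i using K[OF that] by (simp add: closed_subspace_def)
  have SK: "S i \<subseteq> K i" if "i \<le> d" for i using S[OF that] by (auto simp: K_def closed_span_def)
  have J: "inj_on (J i) (K i)" if i: "i \<le> d" for i
  proof (cases "e i")
    case True
    then have "vecs (H i) = range Inl" using H0d by (auto simp: e_def scalar_space_def)
    then show ?thesis using True by (auto simp: inj_on_def J_def K_def)
  next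
    case False
    show ?thesis
    proof
      fix x y assume xy: "x \<in> K i" "y \<in> K i" "J i x = J i y"
      have "vinner (H i) x s = vinner (H i) y s" if s: "s \<in> S i" for s
      proof -
        obtain t where t: "s = w i t" using s by (auto simp: S_def)
        have "w i (\<lambda>j. map t [0..<Suc d] ! j) = w i t"
          unfolding w_def by (rule foldr_cong) (auto simp del: upt_Suc)
        then show ?thesis using xy(3) False fun_cong[of _ _ "map t [0..<Suc d]"]
          unfolding t J_def by (metis (no_types, lifting) sum.inject(2))
      qed
      then show "x = y"
        using xy complex_hilbert_space.closed_span_separated[OF H[OF i] S[OF i], of x y] False
        by (simp add: K_def)
    qed
  qed
  have \<xi>K: "\<xi> i t x \<in> K (i - 1)" if i: "i \<in> {1..d}" and t: "t \<in> carrier G" and x: "x \<in> K i" for i t x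
  proof (cases "e (i - 1)")
    case True
    have "\<xi> i t x \<in> vecs (H (i - 1))"
      using \<xi>[OF i t] KH[of i] x i by (auto simp: bounded_op_def)
    then show ?thesis using True by (simp add: K_def)
  next
    case False
    let ?L = "{x \<in> vecs (H i). \<xi> i t x \<in> K (i - 1)}"
    have "closed_subspace (H i) ?L"
      by (rule complex_hilbert_space.bounded_op_vimage[OF H \<xi>[OF i t] H K]) (use i in auto)
    moreover have "S i \<subseteq> ?L"
    proof
      fix s assume "s \<in> S i"
      then obtain r where r: "s = w i r" "r \<in> {1..d} \<rightarrow> carrier G" by (auto simp: S_def)
      have "w i (r(i := t)) = w i r"
        unfolding w_def by (rule foldr_cong) (auto simp del: upt_Suc)
      moreover have "w (i - 1) (r(i := t)) = \<xi> i t (w i (r(i := t)))"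
        using w_step[of "i - 1" "r(i := t)"] i by (cases i) auto
      ultimately have "\<xi> i t s = w (i - 1) (r(i := t))" using r by simp
      moreover have "w (i - 1) (r(i := t)) \<in> S (i - 1)"
        using r(2) t unfolding S_def by (intro CollectI exI[of _ "r(i := t)"]) auto
      ultimately show "s \<in> ?L" using SK[of "i - 1"] i r w_vecs[of i r] by auto (meson diff_le_self order_trans subsetD)
    qed
    ultimately have cs: "closed_span (H i) (S i) \<subseteq> ?L" by (auto simp: closed_span_def)
    show ?thesis
    proof (cases "e i")
      case False then show ?thesis using cs x by (auto simp: K_def)
    next
      case True
      then have id: "i = d" using i by (auto simp: e_def)
      obtain z where z: "x = Inl z" using KH[of i] x id H0d by (auto simp: scalar_space_def)
      obtain g where "g \<in> carrier G" using ne by blast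
      then have "Inl 1 \<in> S i" unfolding S_def id by (intro CollectI exI[of _ "\<lambda>_. g"]) (simp add: w_d)
      then have "Inl 1 \<in> ?L" using \<open>S i \<subseteq> ?L\<close> by auto
      then have "vscale (H i) z (Inl 1) \<in> ?L"
        using \<open>closed_subspace (H i) ?L\<close> unfolding closed_subspace_def by blast
      then show ?thesis by (simp add: z id H0d scalar_space_def)
    qed
  qed
  define H' where "H' i = (if e i then scalar_space else transported (H i) (K i) (J i))" for i
  define \<xi>' where "\<xi>' i t x = J (i - 1) (\<xi> i t (inv_into (K i) (J i) x))" for i t x
  have vecs': "vecs (H' i) = J i ` K i" if "i \<le> d" for i
    using H0d that by (auto simp: H'_def transported_def Let_def J_def K_def e_def scalar_space_def image_iff)
  have ops': "vadd (H' i) (J i x) (J i y) = J i (vadd (H i) x y)"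
      "vscale (H' i) a (J i x) = J i (vscale (H i) a x)"
      "vnorm (H' i) (J i x) = vnorm (H i) x"
    if "i \<le> d" "x \<in> K i" "y \<in> K i" for i x y a
  proof (atomize (full), cases "e i")
    case True
    then show "vadd (H' i) (J i x) (J i y) = J i (vadd (H i) x y) \<and>
        vscale (H' i) a (J i x) = J i (vscale (H i) a x) \<and>
        vnorm (H' i) (J i x) = vnorm (H i) x"
      using H0d by (auto simp: H'_def vnorm_def J_def[of i] e_def scalar_space_def)
  next
    case False
    then show "vadd (H' i) (J i x) (J i y) = J i (vadd (H i) x y) \<and>
        vscale (H' i) a (J i x) = J i (vscale (H i) a x) \<and>
        vnorm (H' i) (J i x) = vnorm (H i) x"
      using that J[OF that(1)] by (simp add: H'_def transported_def vnorm_def Let_def)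
  qed
  note ops'(1)[simp] ops'(2)[OF _ _ K0, simp] ops'(3)[OF _ _ K0, simp]
  have \<xi>' [simp]: "\<xi>' i t (J i x) = J (i - 1) (\<xi> i t x)" if "i \<le> d" "x \<in> K i" for i t x
    using J[OF that(1)] that by (simp add: \<xi>'_def)
  have Kadd [simp]: "vadd (H i) x y \<in> K i" "vscale (H i) a x \<in> K i"
    if "i \<le> d" "x \<in> K i" "y \<in> K i" for i x y a
    using K[OF that(1)] that by (auto simp: closed_subspace_def)
  note Kadd(2)[OF _ _ K0, simp]
  have H'hs: "complex_hilbert_space (H' i)" if "i \<le> d" for i
    using complex_hilbert_space_transported[OF H[OF that] K[OF that] J[OF that]]
      complex_hilbert_space_scalar by (auto simp: H'_def)
  have bop: "bounded_op (H' i) (H' (i - 1)) (\<xi>' i t)" if i: "i \<in> {1..d}" and t: "t \<in> carrier G" for i t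
  proof -
    have i': "i \<le> d" "i - 1 \<le> d" using i by auto
    obtain C where C: "\<And>x. x \<in> vecs (H i) \<Longrightarrow> vnorm (H (i - 1)) (\<xi> i t x) \<le> C * vnorm (H i) x"
      using \<xi>[OF i t] unfolding bounded_op_def by blast
    have lin: "\<xi> i t (vadd (H i) x y) = vadd (H (i - 1)) (\<xi> i t x) (\<xi> i t y)"
        "\<xi> i t (vscale (H i) a x) = vscale (H (i - 1)) a (\<xi> i t x)"
      if "x \<in> K i" "y \<in> K i" for x y a
      using \<xi>[OF i t] subsetD[OF KH[OF i'(1)] that(1)] subsetD[OF KH[OF i'(1)] that(2)]
      by (simp_all add: bounded_op_def)
    show ?thesis unfolding bounded_op_def vecs'[OF i'(1)] vecs'[OF i'(2)]
    proof (intro conjI ballI allI exI[of _ C] funcsetI; elim imageE; hypsubst)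
      fix x assume x: "x \<in> K i"
      note [simp] = i' i'(2)[simplified] x \<xi>K[OF i t x] \<xi>K[OF i t x, simplified] lin
      show "\<xi>' i t (J i x) \<in> J (i - 1) ` K (i - 1)" by simp
      show "vnorm (H' (i - 1)) (\<xi>' i t (J i x)) \<le> C * vnorm (H' i) (J i x)"
        using C[OF subsetD[OF KH[OF i'(1)] x]] by simp
      show "\<xi>' i t (vscale (H' i) a (J i x)) = vscale (H' (i - 1)) a (\<xi>' i t (J i x))" for a
        using lin(2)[OF x x] by simp
      fix y assume y: "y \<in> K i"
      show "\<xi>' i t (vadd (H' i) (J i x) (J i y)) = vadd (H' (i - 1)) (\<xi>' i t (J i x)) (\<xi>' i t (J i y))"
        using y \<xi>K[OF i t y] lin(1)[OF x y] by simp
    qed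
  qed
  have on: "op_norm (H' i) (H' (i - 1)) (\<xi>' i t) \<le> op_norm (H i) (H (i - 1)) (\<xi> i t)"
    "0 \<le> op_norm (H' i) (H' (i - 1)) (\<xi>' i t)"
    if i: "i \<in> {1..d}" and t: "t \<in> carrier G" for i t
  proof -
    have i': "i \<le> d" "i - 1 \<le> d" using i by auto
    interpret H': complex_hilbert_space "H' i" by (rule H'hs) fact
    interpret H'': complex_hilbert_space "H' (i - 1)" by (rule H'hs) fact
    have z: "vzero (H' i) \<in> {x \<in> vecs (H' i). vnorm (H' i) x \<le> 1}"
      using H'.zero_closed by (simp add: vnorm_def H'.inner_zero)
    show "op_norm (H' i) (H' (i - 1)) (\<xi>' i t) \<le> op_norm (H i) (H (i - 1)) (\<xi> i t)"
      unfolding op_norm_def[of "H' i"]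
    proof (rule cSUP_least)
      show "{x \<in> vecs (H' i). vnorm (H' i) x \<le> 1} \<noteq> {}" using z by blast
      fix y assume "y \<in> {x \<in> vecs (H' i). vnorm (H' i) x \<le> 1}"
      then obtain x where x: "y = J i x" "x \<in> K i" "vnorm (H i) x \<le> 1"
        by (auto simp: vecs'[OF i'(1)] ops'[OF i'(1)])
      then show "vnorm (H' (i - 1)) (\<xi>' i t y) \<le> op_norm (H i) (H (i - 1)) (\<xi> i t)"
        using op_norm_le[OF H[OF i'(1)] \<xi>[OF i t]] KH[OF i'(1)] \<xi>K[OF i t]
        by (auto simp: \<xi>'[OF i'(1)] i' i'(2)[simplified])
    qed
    have "\<xi>' i t (vzero (H' i)) \<in> vecs (H' (i - 1))"
      using bop[OF i t] H'.zero_closed by (auto simp: bounded_op_def)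
    then have "0 \<le> vnorm (H' (i - 1)) (\<xi>' i t (vzero (H' i)))"
      by (rule H''.vnorm_nonneg)
    also have "\<dots> \<le> op_norm (H' i) (H' (i - 1)) (\<xi>' i t)"
      using z by (intro op_norm_le[OF H'hs[OF i'(1)] bop[OF i t]]) auto
    finally show "0 \<le> op_norm (H' i) (H' (i - 1)) (\<xi>' i t)" .
  qed
  have bdd: "bdd_above ((\<lambda>t. op_norm (H i) (H (i - 1)) (\<xi> i t)) ` carrier G)"
    if "i \<in> {1..d}" for i
    using F that by (simp add: Md_factorization_def)
  have bdd': "bdd_above ((\<lambda>t. op_norm (H' i) (H' (i - 1)) (\<xi>' i t)) ` carrier G)"
    if i: "i \<in> {1..d}" for i
  proof -
    obtain M where "\<And>t. t \<in> carrier G \<Longrightarrow> op_norm (H i) (H (i - 1)) (\<xi> i t) \<le> M"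
      using bdd[OF i] by (auto simp: bdd_above_def)
    then show ?thesis using on(1)[OF i] by (intro bdd_aboveI2[of _ _ M]) (meson order_trans)
  qed
  have w': "foldr (\<lambda>j. \<xi>' j (t j)) [Suc i..<Suc d] (Inl 1) = J i (w i t)"
    if "i \<le> d" "t \<in> {1..d} \<rightarrow> carrier G" for i t
    using that(1)
  proof (induction rule: inc_induct)
    case base show ?case by (simp add: w_d J_def e_def)
  next
    case (step n)
    have "w (Suc n) t \<in> K (Suc n)" using SK[of "Suc n"] step(2) that(2) by (auto simp: S_def)
    then show ?case using step
      by (simp add: w_step \<xi>' upt_conv_Cons[of "Suc n"] del: upt_Suc)
  qed
  have fact': "Inl (\<phi> (foldr (\<lambda>i x. t i \<otimes>\<^bsub>G\<^esub> x) [1..<Suc d] \<one>\<^bsub>G\<^esub>)) =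
        foldr (\<lambda>i. \<xi>' i (t i)) [1..<Suc d] (Inl 1)" if t: "t \<in> {1..d} \<rightarrow> carrier G" for t
  proof -
    have "Inl (\<phi> (foldr (\<lambda>i x. t i \<otimes>\<^bsub>G\<^esub> x) [1..<Suc d] \<one>\<^bsub>G\<^esub>)) = w 0 t"
      using F t by (simp add: Md_factorization_def w_def del: upt_Suc)
    then have "J 0 (w 0 t) = Inl (\<phi> (foldr (\<lambda>i x. t i \<otimes>\<^bsub>G\<^esub> x) [1..<Suc d] \<one>\<^bsub>G\<^esub>))"
      by (metis J_def e_def sum.sel(1))
    then show ?thesis using w'[of 0 t] t by (simp del: upt_Suc)
  qed
  have "Md_factorization d G H' \<xi>' \<phi>"
    unfolding Md_factorization_def using H'hs bop bdd' fact' by (simp add: H'_def e_def del: upt_Suc)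
  moreover have "Md_bound d G H' \<xi>' \<le> Md_bound d G H \<xi>"
    unfolding Md_bound_def
  proof (intro prod_mono conjI)
    fix i assume i: "i \<in> {1..d}"
    obtain g where g: "g \<in> carrier G" using ne by blast
    show "0 \<le> (SUP t\<in>carrier G. op_norm (H' i) (H' (i - 1)) (\<xi>' i t))"
      using on(2)[OF i g] by (rule order_trans) (rule cSUP_upper[OF g bdd'[OF i]])
    show "(SUP t\<in>carrier G. op_norm (H' i) (H' (i - 1)) (\<xi>' i t))
        \<le> (SUP t\<in>carrier G. op_norm (H i) (H (i - 1)) (\<xi> i t))"
      by (rule cSUP_mono[OF ne bdd[OF i]]) (use on(1)[OF i] in blast)
  qed
  ultimately show ?thesis by blast
qed

end

theory Submission
  imports Defs "HOL-Library.Function_Algebras"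
begin

text \<open>By Hahn--Banach, \<open>G\<close> has the \<open>M\<^sub>d\<close>-AP iff every \<open>\<sigma>(M\<^sub>d(G), X\<^sub>d(G))\<close>-continuous functional \<open>L\<close> that
  vanishes at all point masses vanishes at the constant \<open>1\<close>. If \<open>\<Phi>: M\<^sub>d(K) \<rightarrow> M\<^sub>d(G)\<close> is bounded and
  each \<open>\<Phi>(\<phi>)(t)\<close> is a multiple of one value of \<open>\<phi>\<close>, then \<open>L \<circ> \<Phi>\<close> is again such a functional. So if
  \<open>L\<close> kills the image of the point masses under \<open>\<Phi>\<close> and \<open>K\<close> has the \<open>M\<^sub>d\<close>-AP, then \<open>L(\<Phi>(1)) = 0\<close>.

  For an extension with kernel \<open>K\<close> and quotient \<open>Q\<close>, extending by zero along the cosets of \<open>K\<close> shows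
  that \<open>L\<close> kills the indicators of cosets, and then inflation from \<open>Q\<close> shows that \<open>L(1) = 0\<close>.

  For a free product, write \<open>g = w x\<close> with \<open>x\<close> in one factor \<open>K\<close> and \<open>w\<close> not ending in that factor. The
  map taking \<open>\<phi>\<close> to \<open>g \<mapsto> \<phi>(x)\<close> if \<open>|w| = m\<close>, and to 0 otherwise, is bounded from \<open>M\<^sub>d(K)\<close> to \<open>M\<^sub>d(G)\<close> with
  a bound polynomial in \<open>m\<close>: this is the construction of uniformly bounded representations by
  Pytlik and Szwarc on the Bass--Serre tree, with coefficients in the Hilbert spaces of a factorization
  of \<open>\<phi>\<close>. By induction on \<open>m\<close>, \<open>L\<close> kills the indicators of spheres. The functions
  \<open>r\<^bsup>2n(g)\<^esup>\<close>, where \<open>n(g)\<close> counts the letters of \<open>g\<close> from the second factor, are positive definite, hence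
  of multiplier norm at most 1; they are combinations of spheres with geometrically decaying coefficients, so \<open>L\<close> kills
  them, and they tend to 1 as \<open>r \<rightarrow> 1\<close>.\<close>


text \<open>A factorization of phi on K through operators B_1, ..., B_d has to be carried to G as d
  operators, each depending on one group element. The vehicle is a cocycle c over an action of G on
  nodes: the operator of t moves the coordinate at y to t y and applies B_i(c(t, y)). A point vector
  only tests whether g y0 equals a given node; conjugating the operators by 1 - T, with T the
  passage to parents, replaces it by the chain of all ancestors. Then d operators in a row take the
  chain at y0 to the chain at g y0, and pairing with a node y1 tests whether y1 is an ancestor of g
  y0. With y1 a root at height m this is the indicator of a sphere. The cost is linear in m for each
  operator, since the action commutes with T off one geodesic. The induction on spheres alternates
  between the factors: a word of length m + 1 is one of length m with a further letter, so the
  sphere of radius m + 1 is a coset sphere of the other type minus a sphere of radius m. An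
  approximant of L sees finitely many group elements, so r^(2n) is expanded into spheres by finite
  sums only, and no series has to converge in the multiplier norm.\<close>

section \<open>Norms in Hilbert spaces with explicit carriers\<close>

context complex_hilbert_space
begin

lemma vnorm_power2: "x \<in> vecs H \<Longrightarrow> (vnorm H x)\<^sup>2 = Re (vinner H x x)"
  by (simp add: vnorm_def inner_nonneg)

lemma vnorm_zero [simp]: "vnorm H (vzero H) = 0"
  by (simp add: vnorm_def inner_zero zero_closed)

lemma vnorm_scale: "x \<in> vecs H \<Longrightarrow> vnorm H (vscale H a x) = norm a * vnorm H x"
proof (rule power2_eq_imp_eq)
  assume x: "x \<in> vecs H"
  have "vinner H (vscale H a x) (vscale H a x) = of_real ((norm a)\<^sup>2) * vinner H x x"
    using x by (simp add: inner_scale inner_scale_right scale_closed complex_norm_square mult_ac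
      del: of_real_power)
  then show "(vnorm H (vscale H a x))\<^sup>2 = (norm a * vnorm H x)\<^sup>2"
    using x by (simp add: vnorm_power2 scale_closed power_mult_distrib)
qed (simp_all add: vnorm_nonneg scale_closed)

lemma vnorm_triangle:
  assumes "x \<in> vecs H" "y \<in> vecs H"
  shows "vnorm H (vadd H x y) \<le> vnorm H x + vnorm H y"
proof (rule power2_le_imp_le)
  have "Re (vinner H x y) \<le> vnorm H x * vnorm H y"
    using cauchy_schwarz[OF assms] complex_Re_le_cmod order_trans by blast
  then show "(vnorm H (vadd H x y))\<^sup>2 \<le> (vnorm H x + vnorm H y)\<^sup>2"
    using assms inner_commute[OF assms]
    by (simp add: vnorm_power2 add_closed inner_add inner_add_right power2_sum)
qed (simp add: assms vnorm_nonneg)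

end

text \<open>Reading addition off the type lets finite sums of operators be written with \<^const>\<open>sum\<close>.\<close>

locale additive_hilbert_space = complex_hilbert_space H for H :: "'v::ab_group_add cspace" +
  assumes vzero_eq: "vzero H = 0"
    and vadd_eq: "\<lbrakk>x \<in> vecs H; y \<in> vecs H\<rbrakk> \<Longrightarrow> vadd H x y = x + y"
begin

lemma zero_mem [simp]: "0 \<in> vecs H"
  using zero_closed by (simp add: vzero_eq)

lemma plus_mem: "\<lbrakk>x \<in> vecs H; y \<in> vecs H\<rbrakk> \<Longrightarrow> x + y \<in> vecs H"
  using add_closed by (metis vadd_eq)

lemma scale_minus_one: "x \<in> vecs H \<Longrightarrow> vscale H (- 1) x = - x"
  using add_neg[of x] by (simp add: vadd_eq vzero_eq scale_closed eq_neg_iff_add_eq_0 add.commute)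

lemma minus_mem: "x \<in> vecs H \<Longrightarrow> - x \<in> vecs H"
  using scale_closed scale_minus_one by metis

lemma diff_mem: "\<lbrakk>x \<in> vecs H; y \<in> vecs H\<rbrakk> \<Longrightarrow> x - y \<in> vecs H"
  using plus_mem[of x "- y"] minus_mem by simp

lemma scale_zero_right [simp]: "vscale H a 0 = 0"
  using scale_scale[of 0 a 0] scale_zero[of 0] by (simp add: vzero_eq)

lemma inner_zero_left [simp]: "y \<in> vecs H \<Longrightarrow> vinner H 0 y = 0"
  using inner_zero vzero_eq by metis

lemma inner_zero_right [simp]: "y \<in> vecs H \<Longrightarrow> vinner H y 0 = 0"
  using inner_commute[of 0 y] by simp

lemma vnorm_0 [simp]: "vnorm H 0 = 0"
  using vnorm_zero vzero_eq by metis

lemma vnorm_minus: "x \<in> vecs H \<Longrightarrow> vnorm H (- x) = vnorm H x"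
  using vnorm_scale[of x "- 1"] by (simp add: scale_minus_one)

lemma vnorm_add_le: "\<lbrakk>x \<in> vecs H; y \<in> vecs H\<rbrakk> \<Longrightarrow> vnorm H (x + y) \<le> vnorm H x + vnorm H y"
  using vnorm_triangle by (metis vadd_eq)

lemma vdist_eq: "\<lbrakk>x \<in> vecs H; y \<in> vecs H\<rbrakk> \<Longrightarrow> vdist H x y = vnorm H (x - y)"
  by (simp add: vdist_def vadd_eq scale_closed scale_minus_one minus_mem)

lemma vnorm_eq_0: "x \<in> vecs H \<Longrightarrow> vnorm H x = 0 \<Longrightarrow> x = 0"
  using inner_pos[of x] vnorm_power2[of x] by (auto simp: vzero_eq)

lemma vnorm_add_power2_le:
  assumes "x \<in> vecs H" "y \<in> vecs H"
  shows "(vnorm H (x + y))\<^sup>2 \<le> 2 * (vnorm H x)\<^sup>2 + 2 * (vnorm H y)\<^sup>2"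
proof -
  have "(vnorm H (x + y))\<^sup>2 \<le> (vnorm H x + vnorm H y)\<^sup>2"
    by (intro power_mono vnorm_add_le assms vnorm_nonneg plus_mem)
  also have "\<dots> \<le> 2 * (vnorm H x)\<^sup>2 + 2 * (vnorm H y)\<^sup>2"
    using sum_squares_bound[of "vnorm H x" "vnorm H y"] by (simp add: power2_sum)
  finally show ?thesis .
qed

lemma norm_inner_le_sum_squares:
  assumes "x \<in> vecs H" "y \<in> vecs H"
  shows "norm (vinner H x y) \<le> (vnorm H x)\<^sup>2 + (vnorm H y)\<^sup>2"
proof -
  have "2 * (vnorm H x * vnorm H y) \<le> (vnorm H x)\<^sup>2 + (vnorm H y)\<^sup>2"
    using sum_squares_bound[of "vnorm H x" "vnorm H y"] by simp
  moreover have "0 \<le> vnorm H x * vnorm H y" using assms by (simp add: vnorm_nonneg)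
  ultimately show ?thesis using cauchy_schwarz[OF assms] by linarith
qed

end


section \<open>Square-summable functions\<close>

text \<open>The index runs over the whole type. A set of nodes enters only through the operators,
  which decide what happens to the other coordinates.\<close>

definition l2 :: "'v::ab_group_add cspace \<Rightarrow> ('y \<Rightarrow> 'v) cspace" where
  "l2 H = \<lparr>vecs = {f. range f \<subseteq> vecs H \<and> (\<lambda>y. (vnorm H (f y))\<^sup>2) summable_on UNIV},
     vzero = 0, vadd = (+), vscale = (\<lambda>a f y. vscale H a (f y)),
     vinner = (\<lambda>f g. \<Sum>\<^sub>\<infinity>y. vinner H (f y) (g y))\<rparr>"

lemma l2_mem: "f \<in> vecs (l2 H) \<longleftrightarrow>
    (\<forall>y. f y \<in> vecs H) \<and> (\<lambda>y. (vnorm H (f y))\<^sup>2) summable_on UNIV"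
  by (auto simp: l2_def)

lemma vscale_l2 [simp]: "vscale (l2 H) a f = (\<lambda>y. vscale H a (f y))"
  by (simp add: l2_def)

lemma vinner_l2: "vinner (l2 H) f g = (\<Sum>\<^sub>\<infinity>y. vinner H (f y) (g y))"
  by (simp add: l2_def)

context additive_hilbert_space
begin

lemma l2_inner_abs_summable:
  assumes "f \<in> vecs (l2 H)" "g \<in> vecs (l2 H)"
  shows "(\<lambda>y. norm (vinner H (f y) (g y))) summable_on UNIV"
proof (rule summable_on_comparison_test)
  show "(\<lambda>y. (vnorm H (f y))\<^sup>2 + (vnorm H (g y))\<^sup>2) summable_on UNIV"
    using assms by (intro summable_on_add) (auto simp: l2_mem)
qed (use assms in \<open>auto simp: l2_mem norm_inner_le_sum_squares\<close>)

lemma l2_inner_summable: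
  "\<lbrakk>f \<in> vecs (l2 H); g \<in> vecs (l2 H)\<rbrakk> \<Longrightarrow> (\<lambda>y. vinner H (f y) (g y)) summable_on UNIV"
  using l2_inner_abs_summable by (rule abs_summable_summable)

lemma l2_norm_sq: "f \<in> vecs (l2 H) \<Longrightarrow> (vnorm (l2 H) f)\<^sup>2 = (\<Sum>\<^sub>\<infinity>y. (vnorm H (f y))\<^sup>2)"
  and l2_inner_self: "f \<in> vecs (l2 H) \<Longrightarrow> vinner (l2 H) f f = of_real (\<Sum>\<^sub>\<infinity>y. (vnorm H (f y))\<^sup>2)"
proof -
  assume f: "f \<in> vecs (l2 H)"
  show *: "vinner (l2 H) f f = of_real (\<Sum>\<^sub>\<infinity>y. (vnorm H (f y))\<^sup>2)"
    using f infsum_bounded_linear_strong[OF _ bounded_linear_of_real[where 'a = complex],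
        of "\<lambda>y. (vnorm H (f y))\<^sup>2" UNIV] summable_on_of_real[of "\<lambda>y. (vnorm H (f y))\<^sup>2" UNIV, where 'a = complex]
    by (simp add: vinner_l2 inner_self l2_mem)
  have "0 \<le> (\<Sum>\<^sub>\<infinity>y. (vnorm H (f y))\<^sup>2)" by (rule infsum_nonneg) simp
  then show "(vnorm (l2 H) f)\<^sup>2 = (\<Sum>\<^sub>\<infinity>y. (vnorm H (f y))\<^sup>2)"
    by (simp add: vnorm_def[of "l2 H"] *)
qed

lemma l2_coord_le: "f \<in> vecs (l2 H) \<Longrightarrow> (vnorm H (f y))\<^sup>2 \<le> (vnorm (l2 H) f)\<^sup>2"
  using finite_sum_le_infsum[of "\<lambda>y. (vnorm H (f y))\<^sup>2" UNIV "{y}"] by (simp add: l2_norm_sq l2_mem)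

lemma l2_plus_mem:
  assumes "f \<in> vecs (l2 H)" "g \<in> vecs (l2 H)"
  shows "f + g \<in> vecs (l2 H)"
  unfolding l2_mem
proof
  show "(\<lambda>y. (vnorm H ((f + g) y))\<^sup>2) summable_on UNIV"
  proof (rule summable_on_comparison_test)
    show "(\<lambda>y. 2 * (vnorm H (f y))\<^sup>2 + 2 * (vnorm H (g y))\<^sup>2) summable_on UNIV"
      using assms by (intro summable_on_add summable_on_cmult_right) (auto simp: l2_mem)
  qed (use assms in \<open>auto simp: l2_mem vnorm_add_power2_le\<close>)
qed (use assms in \<open>auto simp: l2_mem plus_mem\<close>)

lemma l2_scale_mem:
  assumes "f \<in> vecs (l2 H)" shows "vscale (l2 H) a f \<in> vecs (l2 H)"
proof -
  have "(\<lambda>y. (norm a)\<^sup>2 * (vnorm H (f y))\<^sup>2) summable_on UNIV"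
    using assms by (intro summable_on_cmult_right) (auto simp: l2_mem)
  then show ?thesis using assms by (simp add: l2_mem scale_closed vnorm_scale power_mult_distrib)
qed

lemma l2_minus_mem: "f \<in> vecs (l2 H) \<Longrightarrow> - f \<in> vecs (l2 H)"
  by (simp add: l2_mem minus_mem vnorm_minus)

lemma l2_complete:
  assumes u: "\<And>n::nat. u n \<in> vecs (l2 H)"
    and cauchy: "\<And>e. e > 0 \<Longrightarrow> \<exists>N. \<forall>m\<ge>N. \<forall>n\<ge>N. vnorm (l2 H) (u m - u n) < e"
  shows "\<exists>f\<in>vecs (l2 H). (\<lambda>n. vnorm (l2 H) (u n - f)) \<longlonglongrightarrow> 0"
proof -
  have uv: "u n y \<in> vecs H" for n y using u by (simp add: l2_mem)
  have diff: "u m - u n \<in> vecs (l2 H)" for m n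
    using l2_plus_mem[OF u l2_minus_mem[OF u]] by simp
  have nn: "0 \<le> vnorm (l2 H) f" if "f \<in> vecs (l2 H)" for f
    unfolding vnorm_def l2_inner_self[OF that] by (simp add: infsum_nonneg)
  have coord: "vnorm H (f y) \<le> vnorm (l2 H) f" if "f \<in> vecs (l2 H)" for f y
    by (rule power2_le_imp_le[OF l2_coord_le[OF that] nn[OF that]])
  have "\<exists>x\<in>vecs H. (\<lambda>n. vdist H (u n y) x) \<longlonglongrightarrow> 0" for y
  proof (rule complete[OF uv])
    fix e :: real assume "e > 0"
    then obtain N where "\<forall>m\<ge>N. \<forall>n\<ge>N. vnorm (l2 H) (u m - u n) < e" using cauchy by blast
    moreover have "vdist H (u m y) (u n y) \<le> vnorm (l2 H) (u m - u n)" for m n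
      using coord[OF diff, of m n y] by (simp add: vdist_eq uv)
    ultimately show "\<exists>N. \<forall>m\<ge>N. \<forall>n\<ge>N. vdist H (u m y) (u n y) < e"
      by (meson le_less_trans)
  qed
  then obtain f where f: "\<And>y. f y \<in> vecs H" and lim': "\<And>y. (\<lambda>n. vdist H (u n y) (f y)) \<longlonglongrightarrow> 0"
    by metis
  have lim: "(\<lambda>n. vnorm H (u n y - f y)) \<longlonglongrightarrow> 0" for y
    using lim'[of y] by (simp add: vdist_eq uv f)
  \<comment> \<open>A Fatou argument: on a finite set of coordinates the Cauchy estimate passes to
    the coordinatewise limit, with a bound that does not depend on the set.\<close>
  have tail: "u n - f \<in> vecs (l2 H) \<and> vnorm (l2 H) (u n - f) \<le> e"
    if n: "n \<ge> N" and N: "\<And>m n. m \<ge> N \<Longrightarrow> n \<ge> N \<Longrightarrow> vnorm (l2 H) (u m - u n) < e" and e: "e > 0" for n N e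
  proof -
    have bound: "(\<Sum>y\<in>F. (vnorm H (u n y - f y))\<^sup>2) \<le> e\<^sup>2" if F: "finite F" for F
    proof (rule LIMSEQ_le_const2)
      have "(\<lambda>m. vnorm H (u n y - u m y)) \<longlonglongrightarrow> vnorm H (u n y - f y)" for y
      proof (rule LIMSEQ_I)
        fix r :: real assume "r > 0"
        then obtain M where M: "\<And>m. m \<ge> M \<Longrightarrow> vnorm H (u m y - f y) < r"
          using LIMSEQ_D[OF lim[of y]] by fastforce
        have "\<bar>vnorm H (u n y - u m y) - vnorm H (u n y - f y)\<bar> \<le> vnorm H (u m y - f y)" for m
        proof -
          have "vnorm H (f y - u m y) = vnorm H (u m y - f y)"
            using vnorm_minus[OF diff_mem[OF f uv], of y m y] by simp
          then show ?thesis
            using vnorm_add_le[OF diff_mem[OF uv uv] diff_mem[OF uv f], of n y m y m y y]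
              vnorm_add_le[OF diff_mem[OF uv f] diff_mem[OF f uv], of n y y y m y] by simp
        qed
        then show "\<exists>M. \<forall>m\<ge>M. norm (vnorm H (u n y - u m y) - vnorm H (u n y - f y)) < r"
          using M by (intro exI[of _ M]) (auto intro: le_less_trans)
      qed
      then show "(\<lambda>m. \<Sum>y\<in>F. (vnorm H (u n y - u m y))\<^sup>2) \<longlonglongrightarrow> (\<Sum>y\<in>F. (vnorm H (u n y - f y))\<^sup>2)"
        by (intro tendsto_intros)
      have "(\<Sum>y\<in>F. (vnorm H (u n y - u m y))\<^sup>2) \<le> e\<^sup>2" if "m \<ge> N" for m
      proof -
        have "(\<Sum>y\<in>F. (vnorm H ((u n - u m) y))\<^sup>2) \<le> (\<Sum>\<^sub>\<infinity>y. (vnorm H ((u n - u m) y))\<^sup>2)"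
          using diff[of n m] F by (intro finite_sum_le_infsum) (simp_all add: l2_mem)
        also have "\<dots> = (vnorm (l2 H) (u n - u m))\<^sup>2" by (simp add: l2_norm_sq[OF diff])
        also have "\<dots> \<le> e\<^sup>2" using N[OF n that] nn[OF diff] by (intro power_mono) auto
        finally show ?thesis by simp
      qed
      then show "\<exists>N. \<forall>m\<ge>N. (\<Sum>y\<in>F. (vnorm H (u n y - u m y))\<^sup>2) \<le> e\<^sup>2" by blast
    qed
    have mem: "u n - f \<in> vecs (l2 H)"
      unfolding l2_mem
    proof
      show "(\<lambda>y. (vnorm H ((u n - f) y))\<^sup>2) summable_on UNIV"
        using bound by (intro nonneg_bdd_above_summable_on bdd_aboveI2[of _ _ "e\<^sup>2"]) auto
    qed (simp add: diff_mem uv f)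
    have "(vnorm (l2 H) (u n - f))\<^sup>2 \<le> e\<^sup>2"
      unfolding l2_norm_sq[OF mem] using mem bound by (intro infsum_le_finite_sums) (auto simp: l2_mem)
    then show ?thesis using mem e by (auto intro: power2_le_imp_le)
  qed
  obtain N where "\<And>m n. m \<ge> N \<Longrightarrow> n \<ge> N \<Longrightarrow> vnorm (l2 H) (u m - u n) < 1" using cauchy[of 1] by auto
  then have "u N - f \<in> vecs (l2 H)" using tail[of N N 1] by simp
  \<comment> \<open>Membership of the limit comes from \<open>f = u N - (u N - f)\<close>, where
    both terms are square-summable.\<close>
  then have f: "f \<in> vecs (l2 H)" using l2_plus_mem[OF u l2_minus_mem, of "u N - f" N] by simp
  have "(\<lambda>n. vnorm (l2 H) (u n - f)) \<longlonglongrightarrow> 0"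
  proof (rule LIMSEQ_I)
    fix r :: real assume "r > 0"
    then obtain N where "\<And>m n. m \<ge> N \<Longrightarrow> n \<ge> N \<Longrightarrow> vnorm (l2 H) (u m - u n) < r / 2"
      using cauchy[of "r / 2"] by auto
    then have "vnorm (l2 H) (u n - f) < r" and "u n - f \<in> vecs (l2 H)" if "n \<ge> N" for n
      using tail[OF that, of "r / 2"] \<open>r > 0\<close> by auto
    then show "\<exists>N. \<forall>n\<ge>N. norm (vnorm (l2 H) (u n - f) - 0) < r"
      by (intro exI[of _ N]) (simp add: abs_of_nonneg[OF nn])
  qed
  then show ?thesis using f by blast
qed

lemma additive_hilbert_space_l2: "additive_hilbert_space (l2 H)"
proof
  have vadd: "vadd (l2 H) f g = f + g" for f g by (simp add: l2_def)
  have scale: "vscale (l2 H) (- 1) f = - f" if "f \<in> vecs (l2 H)" for f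
    using that by (simp add: l2_mem scale_minus_one fun_eq_iff)
  show "vzero (l2 H) = 0" by (simp add: l2_def)
  show "vzero (l2 H) \<in> vecs (l2 H)" by (simp add: l2_def)
  show "vinner (l2 H) (vadd (l2 H) f g) h = vinner (l2 H) f h + vinner (l2 H) g h"
    if "f \<in> vecs (l2 H)" "g \<in> vecs (l2 H)" "h \<in> vecs (l2 H)" for f g h
    using that infsum_add[OF l2_inner_summable l2_inner_summable, of f h g h]
      inner_add[of "f _" "g _" "h _"]
    by (simp add: vinner_l2 vadd l2_mem vadd_eq cong: infsum_cong)
  show "vinner (l2 H) (vscale (l2 H) a f) g = a * vinner (l2 H) f g"
    if "f \<in> vecs (l2 H)" "g \<in> vecs (l2 H)" for a f g
    using that by (simp add: vinner_l2 l2_mem inner_scale infsum_cmult_right')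
  show "vinner (l2 H) g f = cnj (vinner (l2 H) f g)"
    if "f \<in> vecs (l2 H)" "g \<in> vecs (l2 H)" for f g
    using that inner_commute[of "f _" "g _"] by (simp add: vinner_l2 l2_mem flip: infsum_cnj)
  show "0 < Re (vinner (l2 H) f f)" if f: "f \<in> vecs (l2 H)" "f \<noteq> vzero (l2 H)" for f
  proof -
    obtain y where "f y \<noteq> 0" using f(2) by (auto simp: l2_def fun_eq_iff)
    then have "0 < vnorm H (f y)"
      using f(1) vnorm_eq_0[of "f y"] vnorm_nonneg[of "f y"] by (auto simp: l2_mem less_le)
    then have "0 < (vnorm H (f y))\<^sup>2" by simp
    also have "\<dots> \<le> Re (vinner (l2 H) f f)"
      using l2_coord_le[OF f(1), of y] by (simp add: l2_norm_sq[OF f(1)] l2_inner_self[OF f(1)])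
    finally show ?thesis .
  qed
  show "\<exists>x\<in>vecs (l2 H). (\<lambda>n. vdist (l2 H) (u n) x) \<longlonglongrightarrow> 0"
    if "\<And>n::nat. u n \<in> vecs (l2 H)"
      "\<And>e. e > 0 \<Longrightarrow> \<exists>N. \<forall>m\<ge>N. \<forall>n\<ge>N. vdist (l2 H) (u m) (u n) < e" for u
  proof -
    have dist: "vdist (l2 H) f g = vnorm (l2 H) (f - g)" if "g \<in> vecs (l2 H)" for f g
      unfolding vdist_def scale[OF that] vadd by simp
    show ?thesis using l2_complete[of u] that by (simp add: dist cong: bex_cong)
  qed
  fix f :: "'c \<Rightarrow> 'v" assume f: "f \<in> vecs (l2 H)"
  show "vadd (l2 H) f (vscale (l2 H) (- 1) f) = vzero (l2 H)"
    by (simp add: scale[OF f] vadd del: vscale_l2) (simp add: l2_def)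
  show "vadd (l2 H) f (vzero (l2 H)) = f" by (simp add: l2_def)
  show "vscale (l2 H) 1 f = f" using f by (simp add: l2_mem scale_one)
  show "vscale (l2 H) a f \<in> vecs (l2 H)" for a by (rule l2_scale_mem[OF f])
  show "vscale (l2 H) a (vscale (l2 H) b f) = vscale (l2 H) (a * b) f" for a b
    using f by (simp add: l2_mem scale_scale)
  show "vscale (l2 H) (a + b) f = vadd (l2 H) (vscale (l2 H) a f) (vscale (l2 H) b f)" for a b
    using f by (simp add: l2_mem vadd fun_eq_iff add_scale vadd_eq scale_closed)
  fix g :: "'c \<Rightarrow> 'v" assume g: "g \<in> vecs (l2 H)"
  show "vadd (l2 H) f g \<in> vecs (l2 H)" using l2_plus_mem[OF f g] by (simp add: vadd)
  show "vadd (l2 H) f g = vadd (l2 H) g f" by (simp add: vadd add.commute)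
  show "vscale (l2 H) a (vadd (l2 H) f g) = vadd (l2 H) (vscale (l2 H) a f) (vscale (l2 H) a g)" for a
    using f g scale_add[of "f _" "g _"] by (simp add: l2_mem vadd fun_eq_iff vadd_eq scale_closed)
  show "vadd (l2 H) (vadd (l2 H) f g) h = vadd (l2 H) f (vadd (l2 H) g h)" for h
    by (simp add: vadd add.assoc)
  show "vadd (l2 H) f g = f + g" by (rule vadd)
qed

end

section \<open>Operators with explicit bounds\<close>

text \<open>With the constant inside the predicate, bounds pass through sums and compositions
  without any supremum being computed.\<close>

definition op_bound :: "real \<Rightarrow> 'v cspace \<Rightarrow> 'w cspace \<Rightarrow> ('v \<Rightarrow> 'w) \<Rightarrow> bool" where
  "op_bound C E F T \<longleftrightarrow>
     T \<in> vecs E \<rightarrow> vecs F \<and>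
     (\<forall>x\<in>vecs E. \<forall>y\<in>vecs E. T (vadd E x y) = vadd F (T x) (T y)) \<and>
     (\<forall>a. \<forall>x\<in>vecs E. T (vscale E a x) = vscale F a (T x)) \<and>
     (\<forall>x\<in>vecs E. vnorm F (T x) \<le> C * vnorm E x)"

lemma op_boundI:
  assumes "\<And>x. x \<in> vecs E \<Longrightarrow> T x \<in> vecs F"
    and "\<And>x y. x \<in> vecs E \<Longrightarrow> y \<in> vecs E \<Longrightarrow> T (vadd E x y) = vadd F (T x) (T y)"
    and "\<And>a x. x \<in> vecs E \<Longrightarrow> T (vscale E a x) = vscale F a (T x)"
    and "\<And>x. x \<in> vecs E \<Longrightarrow> vnorm F (T x) \<le> C * vnorm E x"
  shows "op_bound C E F T"
  using assms by (auto simp: op_bound_def)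

lemma op_boundD:
  assumes "op_bound C E F T"
  shows "x \<in> vecs E \<Longrightarrow> T x \<in> vecs F"
    and "x \<in> vecs E \<Longrightarrow> y \<in> vecs E \<Longrightarrow> T (vadd E x y) = vadd F (T x) (T y)"
    and "x \<in> vecs E \<Longrightarrow> T (vscale E a x) = vscale F a (T x)"
    and "x \<in> vecs E \<Longrightarrow> vnorm F (T x) \<le> C * vnorm E x"
  using assms by (auto simp: op_bound_def)

lemma bounded_op_if_op_bound: "op_bound C E F T \<Longrightarrow> bounded_op E F T"
  unfolding op_bound_def bounded_op_def by blast

lemma op_norm_le_if_op_bound:
  assumes "complex_hilbert_space E" "op_bound C E F T" "0 \<le> C"
  shows "op_norm E F T \<le> C"
proof -
  interpret complex_hilbert_space E by fact
  show ?thesis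
    unfolding op_norm_def
  proof (rule cSUP_least)
    show "{x \<in> vecs E. vnorm E x \<le> 1} \<noteq> {}"
      using zero_closed vnorm_zero by (metis (mono_tags, lifting) empty_iff mem_Collect_eq zero_le_one)
    fix x assume x: "x \<in> {x \<in> vecs E. vnorm E x \<le> 1}"
    then have "vnorm F (T x) \<le> C * vnorm E x" by (auto intro: op_boundD[OF assms(2)])
    also have "\<dots> \<le> C * 1" using x assms(3) by (intro mult_left_mono) auto
    finally show "vnorm F (T x) \<le> C" by simp
  qed
qed

lemma op_norm_nonneg:
  assumes "complex_hilbert_space E" "complex_hilbert_space F" "bounded_op E F T"
  shows "0 \<le> op_norm E F T"
proof -
  interpret E: complex_hilbert_space E by fact
  interpret F: complex_hilbert_space F by fact
  have "0 \<le> vnorm F (T (vzero E))"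
    using assms(3) E.zero_closed by (intro F.vnorm_nonneg) (auto simp: bounded_op_def)
  also have "\<dots> \<le> op_norm E F T"
    using E.zero_closed by (intro op_norm_le[OF assms(1,3)]) simp_all
  finally show ?thesis .
qed

lemma op_bound_op_norm:
  assumes "complex_hilbert_space E" "complex_hilbert_space F" "bounded_op E F T"
  shows "op_bound (op_norm E F T) E F T"
proof (rule op_boundI)
  interpret E: complex_hilbert_space E by fact
  interpret F: complex_hilbert_space F by fact
  have T: "x \<in> vecs E \<Longrightarrow> T x \<in> vecs F" "x \<in> vecs E \<Longrightarrow> T (vscale E a x) = vscale F a (T x)" for x a
    using assms(3) by (auto simp: bounded_op_def)
  fix x assume x: "x \<in> vecs E"
  show "vnorm F (T x) \<le> op_norm E F T * vnorm E x"
  proof (cases "x = vzero E")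
    case True
    have "T (vzero E) = T (vscale E 0 (vzero E))" by (simp add: E.scale_zero E.zero_closed)
    also have "\<dots> = vzero F" by (simp add: T E.zero_closed F.scale_zero)
    finally show ?thesis using True by simp
  next
    case False
    define r where "r = vnorm E x"
    have r: "r > 0" using E.inner_pos[OF x False] by (simp add: r_def vnorm_def)
    let ?y = "vscale E (of_real (1 / r)) x"
    have "vnorm E ?y \<le> 1" using r x by (simp add: E.vnorm_scale norm_divide flip: r_def)
    then have "vnorm F (T ?y) \<le> op_norm E F T"
      by (intro op_norm_le[OF assms(1,3)] E.scale_closed x)
    then show ?thesis using r x T(1)[OF x]
      by (simp add: T F.vnorm_scale norm_divide pos_divide_le_eq flip: r_def)
  qed
qed (use assms(3) in \<open>auto simp: bounded_op_def\<close>)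

lemma op_bound_comp:
  assumes S: "op_bound C E F S" and T: "op_bound D F H T" and "0 \<le> D"
  shows "op_bound (D * C) E H (\<lambda>x. T (S x))"
proof (rule op_boundI)
  fix x assume x: "x \<in> vecs E"
  note [simp] = op_boundD[OF S] op_boundD[OF T] x
  show "T (S x) \<in> vecs H" by simp
  have "vnorm H (T (S x)) \<le> D * vnorm F (S x)" by (rule op_boundD(4)[OF T]) simp
  also have "\<dots> \<le> D * (C * vnorm E x)" using assms(3) by (intro mult_left_mono op_boundD(4)[OF S]) simp_all
  finally show "vnorm H (T (S x)) \<le> D * C * vnorm E x" by (simp add: mult.assoc)
  show "T (S (vscale E a x)) = vscale H a (T (S x))" for a by simp
  show "T (S (vadd E x y)) = vadd H (T (S x)) (T (S y))" if "y \<in> vecs E" for y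
    using that by simp
qed

lemma op_bound_mono:
  assumes "op_bound C E F T" "C \<le> D" "complex_hilbert_space E"
  shows "op_bound D E F T"
proof -
  have "C * vnorm E x \<le> D * vnorm E x" if "x \<in> vecs E" for x
    using assms(2) complex_hilbert_space.vnorm_nonneg[OF assms(3) that] by (rule mult_right_mono)
  then show ?thesis using assms(1) by (auto simp: op_bound_def intro: order_trans)
qed

lemma op_bound_zero_right:
  assumes "op_bound C E F T" "additive_hilbert_space E" "additive_hilbert_space F"
  shows "T 0 = 0"
proof -
  interpret E: additive_hilbert_space E by fact
  interpret F: additive_hilbert_space F by fact
  have "T (vscale E 0 0) = vscale F 0 (T 0)" by (rule op_boundD(3)[OF assms(1)]) simp
  then show ?thesis using op_boundD(1)[OF assms(1), of 0] F.scale_zero F.vzero_eq by simp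
qed

context
  fixes E :: "'v::ab_group_add cspace" and F :: "'w::ab_group_add cspace"
  assumes E: "additive_hilbert_space E" and F: "additive_hilbert_space F"
begin

interpretation E: additive_hilbert_space E by (rule E)
interpretation F: additive_hilbert_space F by (rule F)

lemma op_bound_zero: "op_bound 0 E F (\<lambda>x. 0)"
  by (rule op_boundI) (simp_all add: F.vadd_eq)

lemma op_bound_add:
  assumes S: "op_bound C E F S" and T: "op_bound D E F T"
  shows "op_bound (C + D) E F (\<lambda>x. S x + T x)"
proof (rule op_boundI)
  fix x assume x: "x \<in> vecs E"
  note [simp] = op_boundD[OF S] op_boundD[OF T] x F.plus_mem F.vadd_eq
  show "S x + T x \<in> vecs F" by simp
  show "S (vscale E a x) + T (vscale E a x) = vscale F a (S x + T x)" for a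
    using F.scale_add[of "S x" "T x" a] by (simp add: F.scale_closed)
  show "S (vadd E x y) + T (vadd E x y) = vadd F (S x + T x) (S y + T y)" if "y \<in> vecs E" for y
    using that by (simp add: ac_simps)
  have "vnorm F (S x + T x) \<le> vnorm F (S x) + vnorm F (T x)" by (simp add: F.vnorm_add_le)
  also have "\<dots> \<le> C * vnorm E x + D * vnorm E x" by (intro add_mono) simp_all
  finally show "vnorm F (S x + T x) \<le> (C + D) * vnorm E x" by (simp add: distrib_right)
qed

lemma op_bound_uminus:
  assumes S: "op_bound C E F S" shows "op_bound C E F (\<lambda>x. - S x)"
proof (rule op_boundI)
  fix x assume x: "x \<in> vecs E"
  note [simp] = op_boundD[OF S] x F.vadd_eq F.minus_mem
  show "- S x \<in> vecs F" "vnorm F (- S x) \<le> C * vnorm E x" by (simp_all add: F.vnorm_minus)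
  show "- S (vscale E a x) = vscale F a (- S x)" for a
    by (simp add: F.scale_scale F.scale_closed flip: F.scale_minus_one)
  show "- S (vadd E x y) = vadd F (- S x) (- S y)" if "y \<in> vecs E" for y
    using that by simp
qed

lemma op_bound_diff:
  assumes "op_bound C E F S" "op_bound D E F T"
  shows "op_bound (C + D) E F (\<lambda>x. S x - T x)"
  using op_bound_add[OF assms(1) op_bound_uminus[OF assms(2)]] by simp

lemma op_bound_sum:
  assumes "finite I" "\<And>i. i \<in> I \<Longrightarrow> op_bound (C i) E F (T i)"
  shows "op_bound (\<Sum>i\<in>I. C i) E F (\<lambda>x. \<Sum>i\<in>I. T i x)"
  using assms by (induction I rule: finite_induct) (simp_all add: op_bound_zero op_bound_add)

end


section \<open>Point vectors and weighted partial permutations\<close>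

definition single :: "'y \<Rightarrow> 'v::zero \<Rightarrow> 'y \<Rightarrow> 'v" where
  "single y h = (\<lambda>z. if z = y then h else 0)"

text \<open>A partial permutation operator with operator coefficients: the coordinate at
  \<open>y\<close> in \<open>S\<close> goes to \<open>\<tau> y\<close> after \<open>A y\<close> is
  applied, and coordinates outside \<open>S\<close> are dropped.\<close>

definition pinj :: "'y set \<Rightarrow> ('y \<Rightarrow> 'z) \<Rightarrow> ('y \<Rightarrow> 'v \<Rightarrow> 'w::zero) \<Rightarrow> ('y \<Rightarrow> 'v) \<Rightarrow> 'z \<Rightarrow> 'w" where
  "pinj S \<tau> A f = (\<lambda>z. if z \<in> \<tau> ` S then A (inv_into S \<tau> z) (f (inv_into S \<tau> z)) else 0)"

context additive_hilbert_space
begin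

lemma single_mem: assumes "h \<in> vecs H" shows "single y h \<in> vecs (l2 H)"
proof -
  have "(\<lambda>z. (vnorm H (single y h z))\<^sup>2) summable_on {y}" by simp
  then have "(\<lambda>z. (vnorm H (single y h z))\<^sup>2) summable_on UNIV"
    by (rule summable_on_cong_neutral[THEN iffD1, rotated -1]) (auto simp: single_def)
  then show ?thesis using assms by (simp add: l2_mem single_def)
qed

lemma vinner_single:
  assumes "f \<in> vecs (l2 H)" "h \<in> vecs H"
  shows "vinner (l2 H) f (single y h) = vinner H (f y) h"
proof -
  have "vinner (l2 H) f (single y h) = (\<Sum>\<^sub>\<infinity>z\<in>{y}. vinner H (f z) (single y h z))"
    unfolding vinner_l2 using assms by (intro infsum_cong_neutral) (auto simp: single_def l2_mem)
  then show ?thesis by (simp add: single_def)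
qed

lemma vnorm_single: "h \<in> vecs H \<Longrightarrow> vnorm (l2 H) (single y h) = vnorm H h"
  unfolding vnorm_def[of "l2 H"] by (simp add: vinner_single single_mem) (simp add: single_def vnorm_def)

end

lemma single_0 [simp]: "single y 0 = 0"
  by (simp add: single_def fun_eq_iff)

lemma pinj_single:
  assumes "inj_on \<tau> S" "\<And>y. y \<in> S \<Longrightarrow> A y 0 = 0"
  shows "pinj S \<tau> A (single y h) = (if y \<in> S then single (\<tau> y) (A y h) else 0)"
  using assms by (auto simp: pinj_def single_def fun_eq_iff)

text \<open>Injectivity of \<open>\<tau>\<close> sends different coordinates to different, hence
  orthogonal, ones. The bound is therefore that of a single coefficient, however many there
  are.\<close>

lemma op_bound_pinj:
  assumes inj: "inj_on \<tau> S" and A: "\<And>y. y \<in> S \<Longrightarrow> op_bound C E F (A y)" and C: "0 \<le> C"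
    and E: "additive_hilbert_space E" and F: "additive_hilbert_space F"
  shows "op_bound C (l2 E) (l2 F) (pinj S \<tau> A)"
proof -
  interpret E: additive_hilbert_space E by fact
  interpret F: additive_hilbert_space F by fact
  interpret lE: additive_hilbert_space "l2 E" by (rule E.additive_hilbert_space_l2)
  interpret lF: additive_hilbert_space "l2 F" by (rule F.additive_hilbert_space_l2)
  have app: "pinj S \<tau> A f (\<tau> y) = A y (f y)" if "y \<in> S" for f y
    using that inj by (simp add: pinj_def)
  have bound: "(vnorm F (A y (f y)))\<^sup>2 \<le> C\<^sup>2 * (vnorm E (f y))\<^sup>2"
    if "f \<in> vecs (l2 E)" "y \<in> S" for f y
  proof -
    have "(vnorm F (A y (f y)))\<^sup>2 \<le> (C * vnorm E (f y))\<^sup>2"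
      using that op_boundD[OF A[OF that(2)], of "f y"] by (intro power_mono F.vnorm_nonneg) (auto simp: l2_mem)
    then show ?thesis by (simp add: power_mult_distrib)
  qed
  have sumE: "(\<lambda>y. C\<^sup>2 * (vnorm E (f y))\<^sup>2) summable_on S" if "f \<in> vecs (l2 E)" for f
    using that summable_on_subset_banach[of "\<lambda>y. (vnorm E (f y))\<^sup>2" UNIV S]
    by (intro summable_on_cmult_right) (simp add: l2_mem)
  have sumS: "(\<lambda>y. (vnorm F (A y (f y)))\<^sup>2) summable_on S" if "f \<in> vecs (l2 E)" for f
    by (rule summable_on_comparison_test[OF sumE[OF that]]) (simp_all add: bound that)
  have sum_image: "(\<lambda>z. (vnorm F (pinj S \<tau> A f z))\<^sup>2) summable_on \<tau> ` S" if "f \<in> vecs (l2 E)" for f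
    unfolding summable_on_reindex[OF inj] using sumS[OF that]
    by (simp add: o_def app cong: summable_on_cong)
  have mem: "pinj S \<tau> A f \<in> vecs (l2 F)" if f: "f \<in> vecs (l2 E)" for f
    unfolding l2_mem
  proof
    have "A y (f y) \<in> vecs F" if "y \<in> S" for y
      using f that op_boundD(1)[OF A] by (simp add: l2_mem)
    then show "\<forall>z. pinj S \<tau> A f z \<in> vecs F" using inj by (auto simp: pinj_def)
    show "(\<lambda>z. (vnorm F (pinj S \<tau> A f z))\<^sup>2) summable_on UNIV"
      by (rule summable_on_cong_neutral[THEN iffD1, OF _ _ _ sum_image[OF f]]) (auto simp: pinj_def)
  qed
  show ?thesis
  proof (rule op_boundI)
    fix f :: "'a \<Rightarrow> 'c" assume f: "f \<in> vecs (l2 E)"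
    then have fy: "f y \<in> vecs E" for y by (simp add: l2_mem)
    show "pinj S \<tau> A f \<in> vecs (l2 F)" by (rule mem[OF f])
    show "pinj S \<tau> A (vscale (l2 E) a f) = vscale (l2 F) a (pinj S \<tau> A f)" for a
      using inj op_boundD(3)[OF A] by (auto simp: pinj_def fun_eq_iff fy)
    show "pinj S \<tau> A (vadd (l2 E) f g) = vadd (l2 F) (pinj S \<tau> A f) (pinj S \<tau> A g)"
      if g: "g \<in> vecs (l2 E)" for g
    proof -
      have gy: "g y \<in> vecs E" for y using g by (simp add: l2_mem)
      have "A y (f y + g y) = A y (f y) + A y (g y)" if "y \<in> S" for y
        using op_boundD(1,2)[OF A[OF that]] fy gy E.vadd_eq F.vadd_eq by metis
      then show ?thesis using inj f g mem[OF f] mem[OF g]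
        by (auto simp: lE.vadd_eq lF.vadd_eq pinj_def fun_eq_iff)
    qed
    show "vnorm (l2 F) (pinj S \<tau> A f) \<le> C * vnorm (l2 E) f"
    proof (rule power2_le_imp_le)
      have "(vnorm (l2 F) (pinj S \<tau> A f))\<^sup>2 = (\<Sum>\<^sub>\<infinity>z\<in>\<tau> ` S. (vnorm F (pinj S \<tau> A f z))\<^sup>2)"
        unfolding F.l2_norm_sq[OF mem[OF f]] by (rule infsum_cong_neutral) (auto simp: pinj_def)
      also have "\<dots> = (\<Sum>\<^sub>\<infinity>y\<in>S. (vnorm F (A y (f y)))\<^sup>2)"
        unfolding infsum_reindex[OF inj] by (simp add: o_def app cong: infsum_cong)
      also have "\<dots> \<le> (\<Sum>\<^sub>\<infinity>y\<in>S. C\<^sup>2 * (vnorm E (f y))\<^sup>2)"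
        by (rule infsum_mono[OF sumS[OF f] sumE[OF f] bound[OF f]])
      also have "\<dots> = C\<^sup>2 * (\<Sum>\<^sub>\<infinity>y\<in>S. (vnorm E (f y))\<^sup>2)"
        by (rule infsum_cmult_right')
      also have "\<dots> \<le> C\<^sup>2 * (\<Sum>\<^sub>\<infinity>y. (vnorm E (f y))\<^sup>2)"
        using f summable_on_subset_banach[of "\<lambda>y. (vnorm E (f y))\<^sup>2" UNIV S]
        by (intro mult_left_mono infsum_mono_neutral) (auto simp: l2_mem)
      finally show "(vnorm (l2 F) (pinj S \<tau> A f))\<^sup>2 \<le> (C * vnorm (l2 E) f)\<^sup>2"
        by (simp add: E.l2_norm_sq[OF f] power_mult_distrib)
    qed (rule mult_nonneg_nonneg[OF C lE.vnorm_nonneg[OF f]])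
  qed
qed

section \<open>Multipliers as coefficients\<close>

text \<open>Products are evaluated from the right: \<open>R i\<close> is the invariant after the
  factors \<open>i + 1, ..., d\<close> have been applied, so the index runs down from
  \<open>d\<close> to 0.\<close>

lemma foldr_suffix_induct:
  assumes base: "R d a b"
    and step: "\<And>i x y. 1 \<le> i \<Longrightarrow> i \<le> d \<Longrightarrow> R i x y \<Longrightarrow> R (i - 1) (f i x) (g i y)"
  shows "R 0 (foldr f [1..<Suc d] a) (foldr g [1..<Suc d] b)"
proof -
  have "R i (foldr f [Suc i..<Suc d] a) (foldr g [Suc i..<Suc d] b)" if "i \<le> d" for i
    using that
  proof (induction rule: inc_induct)
    case base then show ?case using assms(1) by simp
  next
    case (step n)
    then show ?case using assms(2)[of "Suc n"] by (simp add: upt_conv_Cons del: upt_Suc)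
  qed
  from this[of 0] show ?thesis by simp
qed

lemma Md_SUP_nonneg:
  assumes F: "Md_factorization d G H \<xi> \<phi>" and i: "i \<in> {1..d}" and "carrier G \<noteq> {}"
  shows "0 \<le> (SUP t\<in>carrier G. op_norm (H i) (H (i - 1)) (\<xi> i t))"
proof -
  obtain g where g: "g \<in> carrier G" using assms(3) by blast
  have "0 \<le> op_norm (H i) (H (i - 1)) (\<xi> i g)"
    using assms(1) i g by (intro op_norm_nonneg) (auto simp: Md_factorization_def)
  also have "\<dots> \<le> (SUP t\<in>carrier G. op_norm (H i) (H (i - 1)) (\<xi> i t))"
    using assms(1) i g by (intro cSUP_upper) (auto simp: Md_factorization_def)
  finally show ?thesis .
qed

lemma Md_bound_nonneg:
  assumes "Md_factorization d G H \<xi> \<phi>" "carrier G \<noteq> {}"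
  shows "0 \<le> Md_bound d G H \<xi>"
  unfolding Md_bound_def by (intro prod_nonneg Md_SUP_nonneg[OF assms(1) _ assms(2)])

lemma foldr_one_mem:
  assumes "t \<in> {1..d} \<rightarrow> carrier G" "group G"
  shows "foldr (\<lambda>i x. t i \<otimes>\<^bsub>G\<^esub> x) [1..<Suc d] \<one>\<^bsub>G\<^esub> \<in> carrier G"
proof -
  interpret group G by fact
  show ?thesis
    by (rule foldr_suffix_induct[where R = "\<lambda>_ x _. x \<in> carrier G" and b = undefined and g = "\<lambda>_. id"])
      (use assms(1) in auto)
qed

text \<open>This tuple lets a factorization bound the value of the multiplier at a single
  point.\<close>

lemma foldr_ones:
  assumes "g \<in> carrier G" "group G" "1 \<le> d"
  shows "foldr (\<lambda>i x. (if i = 1 then g else \<one>\<^bsub>G\<^esub>) \<otimes>\<^bsub>G\<^esub> x) [1..<Suc d] \<one>\<^bsub>G\<^esub> = g"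
proof -
  interpret group G by fact
  let ?R = "\<lambda>(i::nat) x _. x = (if i = 0 then g else \<one>\<^bsub>G\<^esub>)"
  \<comment> \<open>The second fold is a dummy, because the induction rule compares two
    folds.\<close>
  have "?R 0 (foldr (\<lambda>i x. (if i = 1 then g else \<one>\<^bsub>G\<^esub>) \<otimes>\<^bsub>G\<^esub> x) [1..<Suc d] \<one>\<^bsub>G\<^esub>) (foldr (\<lambda>_. id) [1..<Suc d] ())"
    by (rule foldr_suffix_induct[where R = ?R]) (use assms in auto)
  then show ?thesis by simp
qed

lemma norm_foldr_le:
  assumes B: "\<And>i. i \<in> {1..d} \<Longrightarrow> op_bound (C i) (K i) (K (i - 1)) (B i)"
    and C: "\<And>i. i \<in> {1..d} \<Longrightarrow> 0 \<le> C i" and u: "u \<in> vecs (K d)"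
  shows "foldr B [1..<Suc d] u \<in> vecs (K 0) \<and>
    vnorm (K 0) (foldr B [1..<Suc d] u) \<le> (\<Prod>i=1..d. C i) * vnorm (K d) u"
proof -
  let ?R = "\<lambda>i x _. x \<in> vecs (K i) \<and> vnorm (K i) x \<le> (\<Prod>j=Suc i..d. C j) * vnorm (K d) u"
  have "?R 0 (foldr B [1..<Suc d] u) (foldr (\<lambda>_. id) [1..<Suc d] ())"
  proof (rule foldr_suffix_induct[where R = ?R])
    fix i x and y :: unit
    assume i: "1 \<le> i" "i \<le> d" and x: "?R i x y"
    have Bi: "op_bound (C i) (K i) (K (i - 1)) (B i)" "0 \<le> C i" using B C i by auto
    have "vnorm (K (i - 1)) (B i x) \<le> C i * vnorm (K i) x"
      using x by (intro op_boundD(4)[OF Bi(1)]) simp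
    also have "\<dots> \<le> C i * ((\<Prod>j=Suc i..d. C j) * vnorm (K d) u)"
      using x Bi(2) by (intro mult_left_mono) auto
    also have "\<dots> = (\<Prod>j=Suc (i - 1)..d. C j) * vnorm (K d) u"
      using i by (simp add: prod.atLeast_Suc_atMost)
    finally show "?R (i - 1) (B i x) (id y)" using x op_boundD(1)[OF Bi(1)] by simp
  qed (use u in simp)
  then show ?thesis by simp
qed

lemma Md_factorization_op_bound:
  assumes F: "Md_factorization d G H \<xi> \<phi>" and i: "i \<in> {1..d}" and t: "t \<in> carrier G"
  shows "op_bound (SUP t\<in>carrier G. op_norm (H i) (H (i - 1)) (\<xi> i t)) (H i) (H (i - 1)) (\<xi> i t)"
proof (rule op_bound_mono)
  show "op_bound (op_norm (H i) (H (i - 1)) (\<xi> i t)) (H i) (H (i - 1)) (\<xi> i t)"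
    using F i t by (intro op_bound_op_norm) (auto simp: Md_factorization_def)
  show "op_norm (H i) (H (i - 1)) (\<xi> i t) \<le> (SUP t\<in>carrier G. op_norm (H i) (H (i - 1)) (\<xi> i t))"
    using F i t by (intro cSUP_upper) (auto simp: Md_factorization_def)
qed (use F i in \<open>auto simp: Md_factorization_def\<close>)

lemma vnorm_scalar [simp]: "vnorm scalar_space (Inl z) = norm z"
  by (simp add: vnorm_def scalar_space_def cmod_def power2_eq_square)

lemma Md_factorization_eq:
  "\<lbrakk>Md_factorization d G H \<xi> \<phi>; t \<in> {1..d} \<rightarrow> carrier G\<rbrakk> \<Longrightarrow>
    Inl (\<phi> (foldr (\<lambda>i x. t i \<otimes>\<^bsub>G\<^esub> x) [1..<Suc d] \<one>\<^bsub>G\<^esub>)) = foldr (\<lambda>i. \<xi> i (t i)) [1..<Suc d] (Inl 1)"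
  by (simp add: Md_factorization_def del: upt_Suc)

lemma norm_le_Md_bound:
  assumes F: "Md_factorization d G H \<xi> \<phi>" and G: "group G" and d: "1 \<le> d" and g: "g \<in> carrier G"
  shows "norm (\<phi> g) \<le> Md_bound d G H \<xi>"
proof -
  interpret group G by fact
  let ?t = "\<lambda>i::nat. if i = 1 then g else \<one>\<^bsub>G\<^esub>"
  have H: "H 0 = scalar_space" "H d = scalar_space" using F by (auto simp: Md_factorization_def)
  have t: "?t \<in> {1..d} \<rightarrow> carrier G" using g by auto
  have "vnorm (H 0) (foldr (\<lambda>i. \<xi> i (?t i)) [1..<Suc d] (Inl 1)) \<le> Md_bound d G H \<xi> * vnorm (H d) (Inl 1)"
    unfolding Md_bound_def
  proof (rule norm_foldr_le[THEN conjunct2])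
    show "Inl 1 \<in> vecs (H d)" unfolding H by (simp add: scalar_space_def)
  next
    fix i assume i: "i \<in> {1..d}"
    show "op_bound (SUP t\<in>carrier G. op_norm (H i) (H (i - 1)) (\<xi> i t)) (H i) (H (i - 1)) (\<xi> i (?t i))"
      using g i by (intro Md_factorization_op_bound[OF F]) auto
    show "0 \<le> (SUP t\<in>carrier G. op_norm (H i) (H (i - 1)) (\<xi> i t))"
      using g by (intro Md_SUP_nonneg[OF F i]) auto
  qed
  moreover have "foldr (\<lambda>i. \<xi> i (?t i)) [1..<Suc d] (Inl 1) = Inl (\<phi> g)"
  proof -
    have "Inl (\<phi> (foldr (\<lambda>i x. ?t i \<otimes>\<^bsub>G\<^esub> x) [1..<Suc d] \<one>\<^bsub>G\<^esub>)) = foldr (\<lambda>i. \<xi> i (?t i)) [1..<Suc d] (Inl 1)"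
      by (rule Md_factorization_eq[OF F t])
    then show ?thesis unfolding foldr_ones[OF g G d] by (rule sym)
  qed
  ultimately show ?thesis by (simp add: H)
qed

lemma Md_norm_le:
  fixes G :: "('a, 'b) monoid_scheme" and H :: "nat \<Rightarrow> (complex + ('a list \<Rightarrow> complex)) cspace"
  assumes F: "Md_factorization d G H \<xi> \<phi>" and "carrier G \<noteq> {}"
  shows "Md_norm d G \<phi> \<le> Md_bound d G H \<xi>"
  unfolding Md_norm_def
proof (rule cInf_lower)
  show "bdd_below {Md_bound d G H \<xi> | (H :: nat \<Rightarrow> (complex + ('a list \<Rightarrow> complex)) cspace) \<xi>.
      Md_factorization d G H \<xi> \<phi>}"
    using Md_bound_nonneg[OF _ assms(2)] by (intro bdd_belowI[of _ 0]) auto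
qed (use F in blast)

lemma norm_le_Md_norm:
  assumes "\<phi> \<in> Md d G" "group G" "1 \<le> d" "g \<in> carrier G"
  shows "norm (\<phi> g) \<le> Md_norm d G \<phi>"
  unfolding Md_norm_def
  by (rule cInf_greatest) (use assms norm_le_Md_bound in \<open>auto simp: Md_def\<close>)

lemma Md_norm_nonneg:
  assumes "\<phi> \<in> Md d G" "group G" "1 \<le> d"
  shows "0 \<le> Md_norm d G \<phi>"
proof -
  interpret group G by fact
  show ?thesis using order_trans[OF norm_ge_zero norm_le_Md_norm[OF assms one_closed]] .
qed

text \<open>Removes the normalization of the two end spaces: \<open>u\<close> is absorbed into the
  last operator and the pairing with \<open>v\<close> into the first one, which costs their norms.
  As \<open>d \<ge> 2\<close>, these are different operators.\<close>

lemma Md_coefficientI: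
  fixes K :: "nat \<Rightarrow> 'w cspace" and G :: "('a, 'b) monoid_scheme"
  assumes d: "2 \<le> d" and G: "group G" and ext: "\<phi> \<in> extensional (carrier G)"
    and K: "\<And>i. i \<le> d \<Longrightarrow> complex_hilbert_space (K i)"
    and C: "\<And>i. i \<in> {1..d} \<Longrightarrow> 0 \<le> C i"
    and B: "\<And>i t. i \<in> {1..d} \<Longrightarrow> t \<in> carrier G \<Longrightarrow> op_bound (C i) (K i) (K (i - 1)) (B i t)"
    and u: "u \<in> vecs (K d)" and v: "v \<in> vecs (K 0)"
    and \<phi>: "\<And>t. t \<in> {1..d} \<rightarrow> carrier G \<Longrightarrow>
      \<phi> (foldr (\<lambda>i x. t i \<otimes>\<^bsub>G\<^esub> x) [1..<Suc d] \<one>\<^bsub>G\<^esub>) =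
      vinner (K 0) (foldr (\<lambda>i. B i (t i)) [1..<Suc d] u) v"
  shows "\<phi> \<in> Md d G \<and> Md_norm d G \<phi> \<le> (\<Prod>i=1..d. C i) * vnorm (K d) u * vnorm (K 0) v"
proof -
  interpret group G by fact
  interpret K0: complex_hilbert_space "K 0" by (rule K) simp
  interpret Kd: complex_hilbert_space "K d" by (rule K) simp
  define H :: "nat \<Rightarrow> (complex + 'w) cspace" where
    "H i = (if i = 0 \<or> i = d then scalar_space else transported (K i) (vecs (K i)) Inr)" for i
  \<comment> \<open>\<open>inp\<close> reads a scalar \<open>z\<close> as the vector
    \<open>z u\<close> at the right end, and \<open>out\<close> turns a vector into its inner
    product with \<open>v\<close> at the left end. In between both only remove or insert the tag
    \<open>Inr\<close>.\<close>
  define inp where "inp i x = (if i = d then vscale (K d) (projl x) u else projr x)" for i and x :: "complex + 'w"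
  define out where "out i y = (if i = 1 then Inl (vinner (K 0) y v) else Inr y)" for i :: nat and y :: 'w
  define \<xi> where "\<xi> i t x = out i (B i t (inp i x))" for i t x
  have Hs: "complex_hilbert_space (H i)" if "i \<le> d" for i
    using complex_hilbert_space_transported[OF K[OF that] complex_hilbert_space.closed_subspace_vecs[OF K[OF that]], of "Inr :: 'w \<Rightarrow> complex + 'w"]
    by (simp add: H_def complex_hilbert_space_scalar)
  have tr: "vecs (transported (K i) (vecs (K i)) (Inr :: 'w \<Rightarrow> complex + 'w)) = Inr ` vecs (K i)"
    "x \<in> vecs (K i) \<Longrightarrow> vscale (transported (K i) (vecs (K i)) Inr) a (Inr x :: complex + 'w) = Inr (vscale (K i) a x)"
    "x \<in> vecs (K i) \<Longrightarrow> y \<in> vecs (K i) \<Longrightarrow>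
      vadd (transported (K i) (vecs (K i)) Inr) (Inr x) (Inr y :: complex + 'w) = Inr (vadd (K i) x y)"
    "x \<in> vecs (K i) \<Longrightarrow> vnorm (transported (K i) (vecs (K i)) Inr) (Inr x :: complex + 'w) = vnorm (K i) x" for i x y a
    by (simp_all add: transported_def Let_def vnorm_def)
  have inp: "op_bound (if i = d then vnorm (K d) u else 1) (H i) (K i) (inp i)" if "i \<in> {1..d}" for i
  proof (cases "i = d")
    case True
    show ?thesis
      unfolding True by (rule op_boundI)
        (use d u in \<open>auto simp: H_def inp_def scalar_space_def Kd.scale_closed Kd.add_scale
          Kd.scale_scale Kd.vnorm_scale vnorm_scalar[unfolded scalar_space_def] mult.commute\<close>)
  next
    case False
    then show ?thesis using that
      by (intro op_boundI) (auto simp: H_def inp_def tr)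
  qed
  have out: "op_bound (if i = 1 then vnorm (K 0) v else 1) (K (i - 1)) (H (i - 1)) (out i)" if "i \<in> {1..d}" for i
  proof (cases "i = 1")
    case True
    show ?thesis
      unfolding True by (rule op_boundI)
        (use v K0.cauchy_schwarz in \<open>auto simp: H_def out_def scalar_space_def K0.inner_add K0.inner_scale
          vnorm_scalar[unfolded scalar_space_def] mult.commute\<close>)
  next
    case False
    then show ?thesis using that
      by (intro op_boundI) (auto simp: H_def out_def tr)
  qed
  define D where "D i = (if i = 1 then vnorm (K 0) v else 1) * (C i * (if i = d then vnorm (K d) u else 1))" for i
  have uv: "0 \<le> vnorm (K d) u" "0 \<le> vnorm (K 0) v"
    by (simp_all add: u v K0.vnorm_nonneg Kd.vnorm_nonneg)
  have D: "0 \<le> D i" if "i \<in> {1..d}" for i using C[OF that] uv by (simp add: D_def)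
  have \<xi>: "op_bound (D i) (H i) (H (i - 1)) (\<xi> i t)" if "i \<in> {1..d}" "t \<in> carrier G" for i t
    unfolding \<xi>_def D_def
    by (rule op_bound_comp[OF op_bound_comp[OF inp B C] out]) (use that uv in auto)
  have on: "op_norm (H i) (H (i - 1)) (\<xi> i t) \<le> D i" if "i \<in> {1..d}" "t \<in> carrier G" for i t
    by (rule op_norm_le_if_op_bound[OF Hs \<xi> D]) (use that in auto)
  have fold: "foldr (\<lambda>i. \<xi> i (t i)) [1..<Suc d] (Inl 1) =
      Inl (vinner (K 0) (foldr (\<lambda>i. B i (t i)) [1..<Suc d] u) v)" if t: "t \<in> {1..d} \<rightarrow> carrier G" for t
  proof -
    let ?R = "\<lambda>i x y. y \<in> vecs (K i) \<and>
      x = (if i = 0 then Inl (vinner (K 0) y v) else if i = d then Inl 1 else Inr y) \<and> (i = d \<longrightarrow> y = u)"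
    have "?R 0 (foldr (\<lambda>i. \<xi> i (t i)) [1..<Suc d] (Inl 1)) (foldr (\<lambda>i. B i (t i)) [1..<Suc d] u)"
    proof (rule foldr_suffix_induct[where R = ?R])
      fix i x y assume i: "1 \<le> i" "i \<le> d" and R: "?R i x y"
      then have "inp i x = y" by (auto simp: inp_def Kd.scale_one u)
      moreover have "B i (t i) y \<in> vecs (K (i - 1))"
        using R i t by (intro op_boundD(1)[OF B]) (auto simp: Pi_iff)
      ultimately show "?R (i - 1) (\<xi> i (t i) x) (B i (t i) y)"
        using i d by (auto simp: \<xi>_def out_def)
    qed (use u d in simp)
    then show ?thesis by simp
  qed
  have F: "Md_factorization d G H \<xi> \<phi>"
    unfolding Md_factorization_def
  proof (intro conjI ballI allI impI)
    show "H 0 = scalar_space" "H d = scalar_space" by (simp_all add: H_def)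
    show "complex_hilbert_space (H i)" if "i \<le> d" for i by (rule Hs[OF that])
    fix i assume i: "i \<in> {1..d}"
    show "bdd_above ((\<lambda>t. op_norm (H i) (H (i - 1)) (\<xi> i t)) ` carrier G)"
      using on[OF i] by (intro bdd_aboveI2) auto
    show "bounded_op (H i) (H (i - 1)) (\<xi> i t)" if "t \<in> carrier G" for t
      by (rule bounded_op_if_op_bound[OF \<xi>[OF i that]])
  qed (simp only: fold \<phi>)
  have "Md_bound d G H \<xi> \<le> (\<Prod>i=1..d. D i)"
    unfolding Md_bound_def
    by (intro prod_mono conjI Md_SUP_nonneg[OF F] cSUP_least on) auto
  also have "\<dots> = (\<Prod>i=1..d. C i) * vnorm (K d) u * vnorm (K 0) v"
    using d by (simp add: D_def prod.distrib prod.delta)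
  finally have bound: "Md_bound d G H \<xi> \<le> (\<Prod>i=1..d. C i) * vnorm (K d) u * vnorm (K 0) v" .
  have ne: "carrier G \<noteq> {}" using one_closed by blast
  \<comment> \<open>The spaces live on the type of \<open>K\<close>; this carries the factorization
    to the type fixed in \<open>Md\<close>.\<close>
  obtain H' :: "nat \<Rightarrow> (complex + ('a list \<Rightarrow> complex)) cspace" and \<xi>'
    where F': "Md_factorization d G H' \<xi>' \<phi>" "Md_bound d G H' \<xi>' \<le> Md_bound d G H \<xi>"
    using Md_factorization_universe[OF F ne] by blast
  have "bounded (\<phi> ` carrier G)"
    using norm_le_Md_bound[OF F G] d by (intro boundedI) auto
  then have "\<phi> \<in> Md d G" using ext F' by (auto simp: Md_def)
  then show ?thesis using Md_norm_le[OF F'(1) ne] F'(2) bound by simp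
qed

text \<open>A vector becomes its inner product function \<open>\<langle>x, _\<rangle>\<close>. This
  is additive in \<open>x\<close>, so zero and addition become pointwise and can be read off the
  type. The value 0 off the carrier makes the zero vector the zero function.\<close>

definition function_space :: "'v cspace \<Rightarrow> ('v \<Rightarrow> complex) cspace" where
  "function_space H = transported H (vecs H) (\<lambda>x s. if s \<in> vecs H then vinner H x s else 0)"

lemma function_space:
  fixes H :: "'v cspace"
  assumes "complex_hilbert_space H"
  defines "J \<equiv> \<lambda>x s. if s \<in> vecs H then vinner H x s else 0"
  shows "additive_hilbert_space (function_space H)"
    and "vecs (function_space H) = J ` vecs H"
    and "inj_on J (vecs H)"
    and "x \<in> vecs H \<Longrightarrow> y \<in> vecs H \<Longrightarrow> vadd (function_space H) (J x) (J y) = J (vadd H x y)"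
    and "x \<in> vecs H \<Longrightarrow> vscale (function_space H) a (J x) = J (vscale H a x)"
    and "x \<in> vecs H \<Longrightarrow> y \<in> vecs H \<Longrightarrow> vinner (function_space H) (J x) (J y) = vinner H x y"
proof -
  interpret complex_hilbert_space H by fact
  show inj: "inj_on J (vecs H)"
  proof
    fix x y assume xy: "x \<in> vecs H" "y \<in> vecs H" "J x = J y"
    have "vinner H x s = vinner H y s" if "s \<in> vecs H" for s
      using fun_cong[OF xy(3), of s] that by (simp add: J_def)
    moreover have "x \<in> closed_span H (vecs H)" "y \<in> closed_span H (vecs H)"
      using xy by (auto simp: closed_span_def)
    ultimately show "x = y" using closed_span_separated[of "vecs H" x y] by simp
  qed
  have J_eq: "function_space H = transported H (vecs H) J" by (simp add: function_space_def J_def)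
  show vecs: "vecs (function_space H) = J ` vecs H" by (simp add: J_eq transported_def Let_def)
  show add: "vadd (function_space H) (J x) (J y) = J (vadd H x y)" if "x \<in> vecs H" "y \<in> vecs H" for x y
    using that inj by (simp add: J_eq transported_def Let_def)
  show "vscale (function_space H) a (J x) = J (vscale H a x)" if "x \<in> vecs H" for a x
    using that inj by (simp add: J_eq transported_def Let_def)
  show "vinner (function_space H) (J x) (J y) = vinner H x y" if "x \<in> vecs H" "y \<in> vecs H" for x y
    using that inj by (simp add: J_eq transported_def Let_def)
  have "complex_hilbert_space (function_space H)"
    unfolding J_eq by (rule complex_hilbert_space_transported[OF assms(1) closed_subspace_vecs inj])
  moreover have "vzero (function_space H) = 0"
    by (auto simp: J_eq transported_def Let_def J_def inner_zero fun_eq_iff)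
  moreover have "vadd (function_space H) f g = f + g"
    if "f \<in> vecs (function_space H)" "g \<in> vecs (function_space H)" for f g
    using that add by (auto simp: vecs fun_eq_iff J_def inner_add)
  ultimately show "additive_hilbert_space (function_space H)"
    by (simp add: additive_hilbert_space_def additive_hilbert_space_axioms_def)
qed

text \<open>The converse of \<open>Md_coefficientI\<close>, with \<open>u\<close> and
  \<open>v\<close> the scalar 1. The bound \<open>c\<close> exceeds the norm strictly because the
  infimum need not be attained; the spaces are additive so that sums of operators make
  sense.\<close>

lemma Md_coefficientE:
  fixes G :: "('a, 'b) monoid_scheme"
  assumes \<phi>: "\<phi> \<in> Md d G" and c: "Md_norm d G \<phi> < c" and G: "group G"
  obtains K :: "nat \<Rightarrow> (complex + ('a list \<Rightarrow> complex) \<Rightarrow> complex) cspace" and C B u v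
  where "\<And>i. i \<le> d \<Longrightarrow> additive_hilbert_space (K i)"
    and "\<And>i. i \<in> {1..d} \<Longrightarrow> 0 \<le> C i" and "(\<Prod>i=1..d. C i) < c"
    and "\<And>i t. i \<in> {1..d} \<Longrightarrow> t \<in> carrier G \<Longrightarrow> op_bound (C i) (K i) (K (i - 1)) (B i t)"
    and "u \<in> vecs (K d)" and "v \<in> vecs (K 0)" and "vnorm (K d) u = 1" and "vnorm (K 0) v = 1"
    and "\<And>t. t \<in> {1..d} \<rightarrow> carrier G \<Longrightarrow>
      \<phi> (foldr (\<lambda>i x. t i \<otimes>\<^bsub>G\<^esub> x) [1..<Suc d] \<one>\<^bsub>G\<^esub>) =
      vinner (K 0) (foldr (\<lambda>i. B i (t i)) [1..<Suc d] u) v"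
proof -
  interpret group G by fact
  let ?S = "{Md_bound d G H \<xi> | (H :: nat \<Rightarrow> (complex + ('a list \<Rightarrow> complex)) cspace) \<xi>.
      Md_factorization d G H \<xi> \<phi>}"
  have "\<exists>r\<in>?S. r < c"
  proof (rule ccontr)
    assume "\<not> (\<exists>r\<in>?S. r < c)"
    then have "c \<le> Inf ?S" using \<phi> by (intro cInf_greatest) (auto simp: Md_def not_less)
    then show False using c by (simp add: Md_norm_def)
  qed
  then obtain H :: "nat \<Rightarrow> (complex + ('a list \<Rightarrow> complex)) cspace" and \<xi>
    where F: "Md_factorization d G H \<xi> \<phi>" and bound: "Md_bound d G H \<xi> < c" by blast
  have H: "complex_hilbert_space (H i)" if "i \<le> d" for i
    using F that by (simp add: Md_factorization_def)
  have H0d: "H 0 = scalar_space" "H d = scalar_space" using F by (simp_all add: Md_factorization_def)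
  have ne: "carrier G \<noteq> {}" using one_closed by blast
  define J where "J i x = (\<lambda>s. if s \<in> vecs (H i) then vinner (H i) x s else 0)" for i x
  define K where "K i = function_space (H i)" for i
  define C where "C i = (SUP t\<in>carrier G. op_norm (H i) (H (i - 1)) (\<xi> i t))" for i
  define B where "B i t f = J (i - 1) (\<xi> i t (inv_into (vecs (H i)) (J i) f))" for i t f
  note fs = function_space[OF H, folded J_def K_def]
  have \<xi>: "op_bound (C i) (H i) (H (i - 1)) (\<xi> i t)" if "i \<in> {1..d}" "t \<in> carrier G" for i t
    unfolding C_def by (rule Md_factorization_op_bound[OF F that])
  have BJ: "B i t (J i x) = J (i - 1) (\<xi> i t x)" if "i \<le> d" "x \<in> vecs (H i)" for i t x
    using that inv_into_f_f[OF fs(3)[OF that(1)] that(2)] by (simp add: B_def)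
  have nJ: "vnorm (K i) (J i x) = vnorm (H i) x" if "i \<le> d" "x \<in> vecs (H i)" for i x
    using that by (simp add: vnorm_def fs(6))
  have one: "Inl 1 \<in> vecs (H 0)" "Inl 1 \<in> vecs (H d)" by (simp_all add: H0d scalar_space_def)
  show thesis
  proof (rule that[of K C B "J d (Inl 1)" "J 0 (Inl 1)"])
    show "additive_hilbert_space (K i)" if "i \<le> d" for i using fs(1)[OF that] .
    show "0 \<le> C i" if "i \<in> {1..d}" for i unfolding C_def by (rule Md_SUP_nonneg[OF F that ne])
    show "(\<Prod>i=1..d. C i) < c" using bound by (simp add: Md_bound_def C_def)
    show "J d (Inl 1) \<in> vecs (K d)" "J 0 (Inl 1) \<in> vecs (K 0)" using one by (auto simp: fs(2))
    show "vnorm (K d) (J d (Inl 1)) = 1" "vnorm (K 0) (J 0 (Inl 1)) = 1"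
      using one by (simp_all add: nJ) (simp_all add: H0d)
    show "op_bound (C i) (K i) (K (i - 1)) (B i t)" if it: "i \<in> {1..d}" "t \<in> carrier G" for i t
    proof -
      have i: "i \<le> d" "i - 1 \<le> d" using it by auto
      note X = op_boundD[OF \<xi>[OF it]]
      interpret Hi: complex_hilbert_space "H i" by (rule H[OF i(1)])
      show ?thesis
        by (rule op_boundI) (auto simp: fs(2)[OF i(1)] fs(2)[OF i(2)] fs(4,5)[OF i(1)] fs(4,5)[OF i(2)]
            BJ[OF i(1)] nJ[OF i(1)] nJ[OF i(2)] X i(2)[simplified]
            fs(2,4,5)[OF i(2), simplified] nJ[OF i(2), simplified] X[simplified] Hi.add_closed Hi.scale_closed)
    qed
    fix t assume t: "t \<in> {1..d} \<rightarrow> carrier G"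
    let ?R = "\<lambda>i x y. x \<in> vecs (H i) \<and> y = J i x"
    have R: "?R 0 (foldr (\<lambda>i. \<xi> i (t i)) [1..<Suc d] (Inl 1)) (foldr (\<lambda>i. B i (t i)) [1..<Suc d] (J d (Inl 1)))"
    proof (rule foldr_suffix_induct[where R = ?R])
      fix i x y assume "1 \<le> i" "i \<le> d" "?R i x y"
      then show "?R (i - 1) (\<xi> i (t i) x) (B i (t i) y)"
        using t op_boundD(1)[OF \<xi>, of i "t i" x] by (auto simp: BJ Pi_iff)
    qed (use one in simp)
    have "Inl (\<phi> (foldr (\<lambda>i x. t i \<otimes>\<^bsub>G\<^esub> x) [1..<Suc d] \<one>\<^bsub>G\<^esub>)) = foldr (\<lambda>i. \<xi> i (t i)) [1..<Suc d] (Inl 1)"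
      using F t by (simp add: Md_factorization_def del: upt_Suc)
    then show "\<phi> (foldr (\<lambda>i x. t i \<otimes>\<^bsub>G\<^esub> x) [1..<Suc d] \<one>\<^bsub>G\<^esub>) =
        vinner (K 0) (foldr (\<lambda>i. B i (t i)) [1..<Suc d] (J d (Inl 1))) (J 0 (Inl 1))"
      using R fs(6)[of 0 "foldr (\<lambda>i. \<xi> i (t i)) [1..<Suc d] (Inl 1)" "Inl 1"] one
      by (simp add: H0d del: upt_Suc) (metis (no_types, lifting) H0d(1) cspace.select_convs(5) complex_cnj_one mult.right_neutral scalar_space_def sum.sel(1))
  qed
qed

context additive_hilbert_space
begin

lemma sum_mem: "(\<And>i. i \<in> I \<Longrightarrow> x i \<in> vecs H) \<Longrightarrow> sum x I \<in> vecs H"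
  by (induction I rule: infinite_finite_induct) (simp_all add: plus_mem)

lemma vnorm_sum_le:
  "(\<And>i. i \<in> I \<Longrightarrow> x i \<in> vecs H) \<Longrightarrow> vnorm H (sum x I) \<le> (\<Sum>i\<in>I. vnorm H (x i))"
proof (induction I rule: infinite_finite_induct)
  case (insert i I)
  have "vnorm H (x i + sum x I) \<le> vnorm H (x i) + vnorm H (sum x I)"
    using insert by (intro vnorm_add_le sum_mem) auto
  then show ?case using insert by force
qed simp_all

end


section \<open>Multipliers from cocycles over forests\<close>

text \<open>A map \<open>p\<close> on \<open>Y\<close> describes a forest: \<open>p y\<close> is the parent of \<open>y\<close>, and \<open>y\<close> is a root if
  \<open>p y \<notin> Y\<close>. The action of \<open>t\<close> and the cocycle respect parents outside the set \<open>Q t\<close>, which has no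
  branching, just as a tree automorphism respects the ancestry away from the geodesic between
  the root and its preimage.\<close>

locale forest_cocycle =
  fixes G :: "('a, 'b) monoid_scheme" and K :: "('k, 'e) monoid_scheme" and Y :: "'y set"
    and act :: "'a \<Rightarrow> 'y \<Rightarrow> 'y" and c :: "'a \<Rightarrow> 'y \<Rightarrow> 'k" and p :: "'y \<Rightarrow> 'y"
    and Q P :: "'a \<Rightarrow> 'y set" and m :: nat
  assumes G: "group G" and K: "group K"
    and act_closed: "\<lbrakk>t \<in> carrier G; y \<in> Y\<rbrakk> \<Longrightarrow> act t y \<in> Y"
    and act_one: "y \<in> Y \<Longrightarrow> act \<one>\<^bsub>G\<^esub> y = y"
    and act_mult: "\<lbrakk>s \<in> carrier G; t \<in> carrier G; y \<in> Y\<rbrakk> \<Longrightarrow> act (s \<otimes>\<^bsub>G\<^esub> t) y = act s (act t y)"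
    and c_closed: "\<lbrakk>t \<in> carrier G; y \<in> Y\<rbrakk> \<Longrightarrow> c t y \<in> carrier K"
    and c_mult: "\<lbrakk>s \<in> carrier G; t \<in> carrier G; y \<in> Y\<rbrakk> \<Longrightarrow> c (s \<otimes>\<^bsub>G\<^esub> t) y = c s (act t y) \<otimes>\<^bsub>K\<^esub> c t y"
    and p_out: "y \<notin> Y \<Longrightarrow> p y \<notin> Y"
    and p_nil: "(p ^^ Suc m) y \<notin> Y"
    and off_Q: "\<lbrakk>t \<in> carrier G; y \<in> Y; y \<notin> Q t\<rbrakk> \<Longrightarrow>
      if p y \<in> Y then p (act t y) = act t (p y) \<and> c t (p y) = c t y else p (act t y) \<notin> Y"
    and Q_sub: "t \<in> carrier G \<Longrightarrow> Q t \<subseteq> Y" and P_sub: "t \<in> carrier G \<Longrightarrow> P t \<subseteq> Y"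
    and Q_p: "\<lbrakk>t \<in> carrier G; y \<in> Q t; p y \<in> Y\<rbrakk> \<Longrightarrow> p y \<in> Q t"
    and P_p: "\<lbrakk>t \<in> carrier G; y \<in> P t; p y \<in> Y\<rbrakk> \<Longrightarrow> p y \<in> P t"
    and Q_inj: "t \<in> carrier G \<Longrightarrow> inj_on p {y \<in> Q t. p y \<in> Y}"
    and P_inj: "t \<in> carrier G \<Longrightarrow> inj_on p {y \<in> P t. p y \<in> Y}"
    and act_Q: "\<lbrakk>t \<in> carrier G; y \<in> Q t\<rbrakk> \<Longrightarrow> act t y \<in> P t"
begin

interpretation G: group G by (rule G)
interpretation K: group K by (rule K)

lemma c_one: "y \<in> Y \<Longrightarrow> c \<one>\<^bsub>G\<^esub> y = \<one>\<^bsub>K\<^esub>"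
  using c_mult[of "\<one>\<^bsub>G\<^esub>" "\<one>\<^bsub>G\<^esub>" y] c_closed[of "\<one>\<^bsub>G\<^esub>" y] by (simp add: act_one)

lemma act_inj: assumes "t \<in> carrier G" shows "inj_on (act t) Y"
proof (rule inj_on_inverseI)
  fix y assume "y \<in> Y"
  then show "act (inv\<^bsub>G\<^esub> t) (act t y) = y"
    using assms by (simp add: act_one flip: act_mult)
qed

lemma iterate_out: "(p ^^ i) y \<in> Y \<Longrightarrow> j \<le> i \<Longrightarrow> (p ^^ j) y \<in> Y"
proof (induction i)
  case (Suc i)
  then show ?case using p_out by (cases "j = Suc i") auto
qed simp

lemma iterate_P:
  assumes t: "t \<in> carrier G" and y: "y \<in> P t" and Y: "(p ^^ i) y \<in> Y"
  shows "(p ^^ i) y \<in> P t"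
  using Y
proof (induction i)
  case (Suc i)
  then show ?case using iterate_out[of "Suc i" y i] P_p[OF t] by simp
qed (use y in simp)

lemma iterate_inj:
  assumes t: "t \<in> carrier G"
  shows "inj_on (p ^^ i) {y \<in> P t. (p ^^ i) y \<in> Y}"
proof (induction i)
  case (Suc i)
  show ?case
  proof
    fix x y assume xy: "x \<in> {y \<in> P t. (p ^^ Suc i) y \<in> Y}" "y \<in> {y \<in> P t. (p ^^ Suc i) y \<in> Y}"
      and eq: "(p ^^ Suc i) x = (p ^^ Suc i) y"
    have X: "(p ^^ i) x \<in> Y" "(p ^^ i) y \<in> Y" using xy iterate_out[of "Suc i" _ i] by auto
    then have "(p ^^ i) x \<in> P t" "(p ^^ i) y \<in> P t" using xy iterate_P[OF t] by auto
    then have "(p ^^ i) x = (p ^^ i) y" using inj_onD[OF P_inj[OF t]] eq xy by auto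
    then show "x = y" using inj_onD[OF Suc] X xy by auto
  qed
qed (simp add: inj_on_def)

text \<open>A cycle through \<open>y\<close> would return to \<open>y\<close> after
  \<open>Suc m * Suc k\<close> steps, beyond the height allowed by \<open>p_nil\<close>.\<close>

lemma no_cycle: assumes "y \<in> Y" shows "(p ^^ Suc k) y \<noteq> y"
proof
  assume eq: "(p ^^ Suc k) y = y"
  have "(f ^^ j) y = y" if "f y = y" for f and j
    using that by (induction j) simp_all
  from this[where f = "p ^^ Suc k", OF eq, of "Suc m"] have "(p ^^ (Suc m * Suc k)) y = y" by (simp only: funpow_mult mult.commute)
  then have "(p ^^ Suc m) y \<in> Y" using assms iterate_out[of "Suc m * Suc k" y "Suc m"] by simp
  then show False using p_nil by blast
qed

definition at_node :: "'y \<Rightarrow> 'v::ab_group_add \<Rightarrow> 'y \<Rightarrow> 'v" where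
  "at_node y h = (if y \<in> Y then single y h else 0)"

text \<open>The Neumann series of the inverse of \<open>1 - T\<close> at a point vector. It stops
  after \<open>m + 1\<close> terms because \<open>p_nil\<close> makes \<open>T\<close>
  nilpotent.\<close>

definition chain :: "'y \<Rightarrow> 'v::ab_group_add \<Rightarrow> 'y \<Rightarrow> 'v" where
  "chain y h = (\<Sum>i\<le>m. at_node ((p ^^ i) y) h)"

lemma chain_out: "y \<notin> Y \<Longrightarrow> chain y h = 0"
  unfolding chain_def at_node_def using iterate_out[of _ y 0] by (intro sum.neutral) auto

lemma chain_rec: assumes "y \<in> Y" shows "chain y h = single y h + chain (p y) h"
proof -
  have "chain y h = (\<Sum>i\<le>Suc m. at_node ((p ^^ i) y) h)"
    using p_nil[of y] by (simp add: chain_def at_node_def)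
  also have "\<dots> = at_node y h + (\<Sum>i\<le>m. at_node ((p ^^ Suc i) y) h)"
    by (subst sum.atMost_Suc_shift) simp
  finally show ?thesis using assms by (simp add: chain_def at_node_def funpow_swap1)
qed

lemma chain_induct:
  assumes "\<And>y. y \<notin> Y \<Longrightarrow> R y" "\<And>y. y \<in> Y \<Longrightarrow> R (p y) \<Longrightarrow> R y"
  shows "R y"
proof -
  have "\<forall>y. (p ^^ n) y \<notin> Y \<longrightarrow> R y" for n
  proof (induction n)
    case (Suc n)
    then show ?case using assms by (metis funpow_Suc_right comp_apply)
  qed (simp add: assms)
  then show ?thesis using p_nil by blast
qed

text \<open>By \<open>no_cycle\<close> an ancestor is met only once, so its coordinate is
  \<open>h\<close> and not a multiple of \<open>h\<close>. This gives the indicator in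
  \<open>transfer\<close>.\<close>

lemma chain_apply:
  assumes "y1 \<in> Y"
  shows "chain y h y1 = (if \<exists>n. (p ^^ n) y = y1 then h else 0)"
proof (induction y rule: chain_induct)
  case (1 y)
  then show ?case using assms iterate_out[of _ y 0] by (auto simp: chain_out)
next
  case (2 y)
  have step: "(\<exists>n. (p ^^ n) y = y1) \<longleftrightarrow> y = y1 \<or> (\<exists>n. (p ^^ n) (p y) = y1)"
    by (metis funpow_0 funpow_Suc_right comp_apply not0_implies_Suc)
  show ?case
  proof (cases "y = y1")
    case True
    then have "\<not> (\<exists>n. (p ^^ n) (p y) = y1)"
      using no_cycle[OF assms] by (metis funpow_Suc_right comp_apply)
    moreover have "\<exists>n. (p ^^ n) y = y1" using True by (intro exI[of _ 0]) simp
    ultimately show ?thesis using True 2 by (simp add: chain_rec single_def)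
  next
    case False
    then show ?thesis using 2 step by (simp add: chain_rec single_def)
  qed
qed

text \<open>A polynomial bound in \<open>m\<close> suffices later, so the triangle inequality is
  used, although orthogonality would give a square root.\<close>

lemma chain_mem:
  assumes "additive_hilbert_space E" "h \<in> vecs E"
  shows "chain y h \<in> vecs (l2 E)" "vnorm (l2 E) (chain y h) \<le> real (Suc m) * vnorm E h"
proof -
  interpret E: additive_hilbert_space E by fact
  interpret lE: additive_hilbert_space "l2 E" by (rule E.additive_hilbert_space_l2)
  have at: "at_node z h \<in> vecs (l2 E)" "vnorm (l2 E) (at_node z h) \<le> vnorm E h" for z
    using assms(2) by (simp_all add: at_node_def E.single_mem E.vnorm_single E.vnorm_nonneg)
  show "chain y h \<in> vecs (l2 E)" unfolding chain_def by (intro lE.sum_mem at)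
  have "vnorm (l2 E) (chain y h) \<le> (\<Sum>i\<le>m. vnorm (l2 E) (at_node ((p ^^ i) y) h))"
    unfolding chain_def by (intro lE.vnorm_sum_le at)
  also have "\<dots> \<le> (\<Sum>i\<le>m. vnorm E h)" by (intro sum_mono at)
  finally show "vnorm (l2 E) (chain y h) \<le> real (Suc m) * vnorm E h" by simp
qed

text \<open>With \<open>\<Lambda>\<close> the permutation operator of the cocycle and \<open>T\<close> the passage to parents, \<open>lift A t\<close> is
  the conjugate \<open>(1 - T)\<^sup>-\<^sup>1 \<Lambda> (1 - T) = \<Lambda> + \<Sum>\<^sub>i T\<^sup>i (T \<Lambda> - \<Lambda> T)\<close>. Here \<open>T\<close> is in general unbounded, but
  the commutator \<open>T \<Lambda> - \<Lambda> T\<close> lives on \<open>Q t\<close>, where \<open>T\<close> and its powers are partial isometries.\<close>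

definition lift :: "('k \<Rightarrow> 'v::ab_group_add \<Rightarrow> 'w::ab_group_add) \<Rightarrow> 'a \<Rightarrow> ('y \<Rightarrow> 'v) \<Rightarrow> 'y \<Rightarrow> 'w" where
  "lift A t f = pinj Y (act t) (\<lambda>y. A (c t y)) f + (\<Sum>i\<le>m.
     pinj {y \<in> Q t. (p ^^ i) (p (act t y)) \<in> Y} (\<lambda>y. (p ^^ i) (p (act t y))) (\<lambda>y. A (c t y)) f -
     pinj {y \<in> Q t. p y \<in> Y \<and> (p ^^ i) (act t (p y)) \<in> Y} (\<lambda>y. (p ^^ i) (act t (p y)))
       (\<lambda>y. A (c t (p y))) f)"

text \<open>\<open>act t\<close> carries \<open>Q t\<close> into \<open>P t\<close>, which has no
  branching, so iterated parents stay distinct there as long as they are nodes. Hence the terms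
  \<open>T\<^sup>i T \<Lambda>\<close> on \<open>Q t\<close> are weighted partial
  permutations.\<close>

lemma up_inj:
  assumes t: "t \<in> carrier G"
  shows "inj_on (\<lambda>y. (p ^^ i) (p (act t y))) {y \<in> Q t. (p ^^ i) (p (act t y)) \<in> Y}"
proof
  fix x y assume xy: "x \<in> {y \<in> Q t. (p ^^ i) (p (act t y)) \<in> Y}" "y \<in> {y \<in> Q t. (p ^^ i) (p (act t y)) \<in> Y}"
    and eq: "(p ^^ i) (p (act t x)) = (p ^^ i) (p (act t y))"
  have "act t x = act t y"
    using inj_onD[OF iterate_inj[OF t, of "Suc i"], of "act t x" "act t y"] xy eq act_Q[OF t]
    by (simp add: funpow_swap1)
  then show "x = y" using inj_onD[OF act_inj[OF t]] xy Q_sub[OF t] by auto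
qed

text \<open>The companion for \<open>T\<^sup>i \<Lambda> T\<close>: the first parent is taken inside
  \<open>Q t\<close>, and the remaining ones inside \<open>P t\<close>.\<close>

lemma down_inj:
  assumes t: "t \<in> carrier G"
  shows "inj_on (\<lambda>y. (p ^^ i) (act t (p y))) {y \<in> Q t. p y \<in> Y \<and> (p ^^ i) (act t (p y)) \<in> Y}"
proof
  fix x y assume xy: "x \<in> {y \<in> Q t. p y \<in> Y \<and> (p ^^ i) (act t (p y)) \<in> Y}"
      "y \<in> {y \<in> Q t. p y \<in> Y \<and> (p ^^ i) (act t (p y)) \<in> Y}"
    and eq: "(p ^^ i) (act t (p x)) = (p ^^ i) (act t (p y))"
  have "act t (p x) = act t (p y)"
    using inj_onD[OF iterate_inj[OF t, of i], of "act t (p x)" "act t (p y)"] xy eq act_Q[OF t] Q_p[OF t]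
    by simp
  then have "p x = p y" using inj_onD[OF act_inj[OF t]] xy by auto
  then show "x = y" using inj_onD[OF Q_inj[OF t]] xy by auto
qed

context
  fixes E :: "'v::ab_group_add cspace" and F :: "'w::ab_group_add cspace"
    and A :: "'k \<Rightarrow> 'v \<Rightarrow> 'w" and C :: real
  assumes E: "additive_hilbert_space E" and F: "additive_hilbert_space F"
    and A: "\<And>k. k \<in> carrier K \<Longrightarrow> op_bound C E F (A k)" and C: "0 \<le> C"
begin

interpretation E: additive_hilbert_space E by (rule E)
interpretation F: additive_hilbert_space F by (rule F)
interpretation lE: additive_hilbert_space "l2 E" by (rule E.additive_hilbert_space_l2)
interpretation lF: additive_hilbert_space "l2 F" by (rule F.additive_hilbert_space_l2)

text \<open>The factor \<open>2 * m + 3\<close> counts the operators in \<open>lift\<close>: one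
  permutation, and two terms of the commutator for each of the \<open>m + 1\<close> powers of
  \<open>T\<close>.\<close>

lemma op_bound_lift:
  assumes t: "t \<in> carrier G"
  shows "op_bound (real (2 * m + 3) * C) (l2 E) (l2 F) (lift A t)"
proof -
  have Q: "y \<in> Q t \<Longrightarrow> y \<in> Y" for y using Q_sub[OF t] by blast
  have "op_bound (C + (\<Sum>i\<le>m. C + C)) (l2 E) (l2 F) (lift A t)"
    unfolding lift_def
    by (intro op_bound_add op_bound_sum op_bound_diff op_bound_pinj
        lE.additive_hilbert_space_axioms lF.additive_hilbert_space_axioms E F C A
        up_inj[OF t] down_inj[OF t] act_inj[OF t] c_closed t finite_atMost) (auto intro: Q)
  then show ?thesis by (simp add: algebra_simps)
qed

text \<open>The conjugation formula at point vectors. On \<open>Q t\<close> the two sums are the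
  missing parts of the two chains. Off \<open>Q t\<close> they are absent, but there
  \<open>off_Q\<close> makes the chains agree above \<open>act t y\<close>, so their difference is
  the point vector itself.\<close>

lemma lift_single:
  assumes t: "t \<in> carrier G" and y: "y \<in> Y"
  shows "lift A t (single y h) = chain (act t y) (A (c t y) h) -
    (if p y \<in> Y then chain (act t (p y)) (A (c t (p y)) h) else 0)"
proof -
  have A0: "A k 0 = 0" if "k \<in> carrier K" for k by (rule op_bound_zero_right[OF A[OF that] E F])
  have Q: "y \<in> Q t \<Longrightarrow> y \<in> Y" for y using Q_sub[OF t] by blast
  have up: "pinj {y \<in> Q t. (p ^^ i) (p (act t y)) \<in> Y} (\<lambda>y. (p ^^ i) (p (act t y))) (\<lambda>y. A (c t y)) (single y h) =
      (if y \<in> Q t then at_node ((p ^^ i) (p (act t y))) (A (c t y) h) else 0)" for i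
    by (subst pinj_single[OF up_inj[OF t]]) (auto simp: A0 c_closed t Q at_node_def)
  have down: "pinj {y \<in> Q t. p y \<in> Y \<and> (p ^^ i) (act t (p y)) \<in> Y} (\<lambda>y. (p ^^ i) (act t (p y)))
       (\<lambda>y. A (c t (p y))) (single y h) =
      (if y \<in> Q t \<and> p y \<in> Y then at_node ((p ^^ i) (act t (p y))) (A (c t (p y)) h) else 0)" for i
    by (subst pinj_single[OF down_inj[OF t]]) (auto simp: A0 c_closed t Q at_node_def)
  have L: "lift A t (single y h) = single (act t y) (A (c t y) h) + (\<Sum>i\<le>m.
     (if y \<in> Q t then at_node ((p ^^ i) (p (act t y))) (A (c t y) h) else 0) -
     (if y \<in> Q t \<and> p y \<in> Y then at_node ((p ^^ i) (act t (p y))) (A (c t (p y)) h) else 0))"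
    unfolding lift_def up down using y by (simp add: pinj_single act_inj t A0 c_closed)
  show ?thesis
  proof (cases "y \<in> Q t")
    case True
    then show ?thesis unfolding L using y t
      by (simp add: chain_rec[of "act t y"] act_closed sum_subtractf flip: chain_def)
  next
    case False
    then show ?thesis unfolding L using y t off_Q[OF t y False]
      by (auto simp: chain_rec[of "act t y"] act_closed chain_out split: if_splits)
  qed
qed

text \<open>A chain is the sum of the point vectors at \<open>y\<close> and its ancestors, so the
  differences in \<open>lift_single\<close> telescope: on chains the lift acts as the plain
  permutation operator does on point vectors.\<close>

lemma lift_chain:
  assumes t: "t \<in> carrier G" and h: "h \<in> vecs E"
  shows "y \<in> Y \<Longrightarrow> lift A t (chain y h) = chain (act t y) (A (c t y) h)"
proof (induction y rule: chain_induct)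
  case (2 y)
  have "lift A t (single y h + chain (p y) h) = lift A t (single y h) + lift A t (chain (p y) h)"
    using op_boundD(1,2)[OF op_bound_lift[OF t]] E.single_mem[OF h] chain_mem(1)[OF E h]
      lE.vadd_eq lF.vadd_eq by metis
  moreover have "lift A t 0 = 0"
    by (rule op_bound_zero_right[OF op_bound_lift[OF t]]) unfold_locales
  moreover have "lift A t (chain (p y) h) = (if p y \<in> Y then chain (act t (p y)) (A (c t (p y)) h) else 0)"
    using 2 calculation(2) by (simp add: chain_out)
  ultimately have "lift A t (single y h + chain (p y) h) = chain (act t y) (A (c t y) h)"
    using lift_single[OF t 2(1), of h] by simp
  then show ?case by (simp only: chain_rec[OF 2(1), symmetric])
qed simp

end

text \<open>The coefficient of the lifted operators between the chain at \<open>y0\<close> and the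
  point vector at \<open>y1\<close>.\<close>

definition transfer :: "'y \<Rightarrow> 'y \<Rightarrow> ('k \<Rightarrow> complex) \<Rightarrow> 'a \<Rightarrow> complex" where
  "transfer y0 y1 \<phi> = (\<lambda>g\<in>carrier G. if \<exists>n. (p ^^ n) (act g y0) = y1 then \<phi> (c g y0) else 0)"

lemma transfer_le:
  assumes \<phi>: "\<phi> \<in> Md d K" and N: "Md_norm d K \<phi> < N" and d: "2 \<le> d" and y0: "y0 \<in> Y" and y1: "y1 \<in> Y"
  shows "transfer y0 y1 \<phi> \<in> Md d G \<and> Md_norm d G (transfer y0 y1 \<phi>) \<le> real (2 * m + 3) ^ Suc d * N"
proof (rule Md_coefficientE[OF \<phi> N K])
  fix S :: "nat \<Rightarrow> (complex + ('k list \<Rightarrow> complex) \<Rightarrow> complex) cspace" and C B u v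
  assume S: "\<And>i. i \<le> d \<Longrightarrow> additive_hilbert_space (S i)"
    and C: "\<And>i. i \<in> {1..d} \<Longrightarrow> 0 \<le> C i" and CN: "(\<Prod>i=1..d. C i) < N"
    and B: "\<And>i t. i \<in> {1..d} \<Longrightarrow> t \<in> carrier K \<Longrightarrow> op_bound (C i) (S i) (S (i - 1)) (B i t)"
    and u: "u \<in> vecs (S d)" and v: "v \<in> vecs (S 0)" and uv: "vnorm (S d) u = 1" "vnorm (S 0) v = 1"
    and factor: "\<And>k. k \<in> {1..d} \<rightarrow> carrier K \<Longrightarrow>
      \<phi> (foldr (\<lambda>i x. k i \<otimes>\<^bsub>K\<^esub> x) [1..<Suc d] \<one>\<^bsub>K\<^esub>) =
      vinner (S 0) (foldr (\<lambda>i. B i (k i)) [1..<Suc d] u) v"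
  interpret S0: additive_hilbert_space "S 0" by (rule S) simp
  have l2: "additive_hilbert_space (l2 (S i) :: ('y \<Rightarrow> _) cspace)" if "i \<le> d" for i
    by (rule additive_hilbert_space.additive_hilbert_space_l2[OF S[OF that]])
  have "transfer y0 y1 \<phi> \<in> Md d G \<and> Md_norm d G (transfer y0 y1 \<phi>) \<le>
    (\<Prod>i=1..d. real (2 * m + 3) * C i) * vnorm (l2 (S d)) (chain y0 u) * vnorm (l2 (S 0)) (single y1 v)"
  proof (rule Md_coefficientI[OF d G, where B = "\<lambda>i. lift (B i)"])
    show "transfer y0 y1 \<phi> \<in> extensional (carrier G)" by (simp add: transfer_def)
    show "complex_hilbert_space (l2 (S i) :: ('y \<Rightarrow> _) cspace)" if "i \<le> d" for i
      using l2[OF that] by (simp add: additive_hilbert_space_def)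
    show "0 \<le> real (2 * m + 3) * C i" if "i \<in> {1..d}" for i using C[OF that] by simp
    show "op_bound (real (2 * m + 3) * C i) (l2 (S i)) (l2 (S (i - 1))) (lift (B i) t)"
      if "i \<in> {1..d}" "t \<in> carrier G" for i t
      by (rule op_bound_lift[OF S S B C]) (use that in auto)
    show "chain y0 u \<in> vecs (l2 (S d))" by (rule chain_mem[OF S u]) simp
    show "single y1 v \<in> vecs (l2 (S 0))" by (rule S0.single_mem[OF v])
    fix t assume t: "t \<in> {1..d} \<rightarrow> carrier G"
    \<comment> \<open>\<open>g i\<close> is the product of the factors after position
      \<open>i\<close>, and \<open>k i\<close> is the increment of the cocycle when
      \<open>t i\<close> acts next. The cocycle identity multiplies the increments to
      \<open>c (g 0) y0\<close>, the point at which \<open>\<phi>\<close> is evaluated.\<close>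
    define g where "g i = foldr (\<lambda>i x. t i \<otimes>\<^bsub>G\<^esub> x) [Suc i..<Suc d] \<one>\<^bsub>G\<^esub>" for i
    define k where "k i = c (t i) (act (g i) y0)" for i
    define w where "w i = foldr (\<lambda>i. B i (k i)) [Suc i..<Suc d] u" for i
    have "g i \<in> carrier G \<and> foldr (\<lambda>i x. k i \<otimes>\<^bsub>K\<^esub> x) [Suc i..<Suc d] \<one>\<^bsub>K\<^esub> = c (g i) y0 \<and> w i \<in> vecs (S i) \<and>
        foldr (\<lambda>i. lift (B i) (t i)) [Suc i..<Suc d] (chain y0 u) = chain (act (g i) y0) (w i) \<and>
        (\<forall>j\<in>{Suc i..d}. k j \<in> carrier K)" if "i \<le> d" for i
      using that
    proof (induction rule: inc_induct)
      case base
      then show ?case using y0 u by (simp add: g_def w_def c_one act_one)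
    next
      case (step n)
      have tn: "t (Suc n) \<in> carrier G" using t step(2) by (auto simp: Pi_iff)
      have gn: "g (Suc n) \<in> carrier G" "g n = t (Suc n) \<otimes>\<^bsub>G\<^esub> g (Suc n)"
        using step by (auto simp: g_def upt_conv_Cons simp del: upt_Suc)
      have kn: "k (Suc n) \<in> carrier K"
        unfolding k_def by (intro c_closed tn act_closed gn y0)
      have wn: "w n = B (Suc n) (k (Suc n)) (w (Suc n))" "w (Suc n) \<in> vecs (S (Suc n))"
        using step by (auto simp: w_def upt_conv_Cons simp del: upt_Suc)
      have w_mem: "w n \<in> vecs (S n)"
        using op_boundD(1)[OF B[of "Suc n" "k (Suc n)"]] kn wn step(2) by simp
      have "lift (B (Suc n)) (t (Suc n)) (chain (act (g (Suc n)) y0) (w (Suc n))) =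
          chain (act (t (Suc n)) (act (g (Suc n)) y0)) (w n)"
        unfolding wn(1) k_def using step(2)
        by (intro lift_chain[OF S S B C]) (auto simp: tn gn y0 act_closed wn(2))
      moreover have "{Suc n..d} = insert (Suc n) {Suc (Suc n)..d}" using step(2) by auto
      ultimately show ?case
        using step w_mem kn tn gn y0
        by (simp add: upt_conv_Cons[of "Suc n"] c_mult act_mult k_def del: upt_Suc)
    qed
    from this[of 0] have g0: "g 0 \<in> carrier G"
        "foldr (\<lambda>i x. k i \<otimes>\<^bsub>K\<^esub> x) [1..<Suc d] \<one>\<^bsub>K\<^esub> = c (g 0) y0" "w 0 \<in> vecs (S 0)"
        "foldr (\<lambda>i. lift (B i) (t i)) [1..<Suc d] (chain y0 u) = chain (act (g 0) y0) (w 0)"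
        and k: "k \<in> {1..d} \<rightarrow> carrier K"
      by (auto simp del: upt_Suc)
    have "\<phi> (c (g 0) y0) = vinner (S 0) (w 0) v"
      using factor[OF k] g0(2) by (simp add: w_def del: upt_Suc)
    then show "transfer y0 y1 \<phi> (foldr (\<lambda>i x. t i \<otimes>\<^bsub>G\<^esub> x) [1..<Suc d] \<one>\<^bsub>G\<^esub>) =
        vinner (l2 (S 0)) (foldr (\<lambda>i. lift (B i) (t i)) [1..<Suc d] (chain y0 u)) (single y1 v)"
      unfolding g0(4) using g0(1,3) S0.vinner_single[OF chain_mem(1)[OF S g0(3)] v] v y1
      by (auto simp: transfer_def chain_apply g_def simp del: upt_Suc)
  qed
  \<comment> \<open>The lifts give \<open>d\<close> factors \<open>2 * m + 3\<close>; a further one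
    absorbs the norm of the initial chain, which is at most \<open>m + 1\<close>.\<close>
  moreover have "(\<Prod>i=1..d. real (2 * m + 3) * C i) * vnorm (l2 (S d)) (chain y0 u) * vnorm (l2 (S 0)) (single y1 v)
      \<le> (real (2 * m + 3) ^ d * N) * real (2 * m + 3)"
  proof -
    have "vnorm (l2 (S d)) (chain y0 u) \<le> real (2 * m + 3)"
      using chain_mem(2)[OF S u, of y0] uv by simp
    moreover have "(\<Prod>i=1..d. real (2 * m + 3) * C i) \<le> real (2 * m + 3) ^ d * N"
      using CN by (simp add: prod.distrib mult_left_mono del: of_nat_add of_nat_mult)
    moreover have "0 \<le> vnorm (l2 (S d)) (chain y0 u)"
      using additive_hilbert_space.axioms(1)[OF l2] chain_mem(1)[OF S u]
      by (intro complex_hilbert_space.vnorm_nonneg) auto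
    moreover have "0 \<le> real (2 * m + 3) ^ d * N"
      using CN prod_nonneg[of "{1..d}" C] C by (intro mult_nonneg_nonneg) (auto simp: less_imp_le intro: order_trans)
    ultimately show ?thesis
      using S0.vnorm_single[OF v, of y1] uv by (simp add: mult_mono del: of_nat_add of_nat_mult)
  qed
  ultimately show "transfer y0 y1 \<phi> \<in> Md d G \<and>
      Md_norm d G (transfer y0 y1 \<phi>) \<le> real (2 * m + 3) ^ Suc d * N" by (simp add: mult_ac)
qed

lemma transfer:
  assumes \<phi>: "\<phi> \<in> Md d K" and d: "2 \<le> d" and y0: "y0 \<in> Y" and y1: "y1 \<in> Y"
  shows "transfer y0 y1 \<phi> \<in> Md d G"
    and "Md_norm d G (transfer y0 y1 \<phi>) \<le> real (2 * m + 3) ^ Suc d * Md_norm d K \<phi>"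
proof -
  note le = transfer_le[OF \<phi> _ d y0 y1]
  show "transfer y0 y1 \<phi> \<in> Md d G" using le[OF less_add_one] by simp
  have "Md_norm d G (transfer y0 y1 \<phi>) / real (2 * m + 3) ^ Suc d \<le> N" if "Md_norm d K \<phi> < N" for N
    using le[OF that] by (simp add: pos_divide_le_eq mult_ac del: power_Suc)
  then have "Md_norm d G (transfer y0 y1 \<phi>) / real (2 * m + 3) ^ Suc d \<le> Md_norm d K \<phi>"
    by (rule dense_ge)
  then show "Md_norm d G (transfer y0 y1 \<phi>) \<le> real (2 * m + 3) ^ Suc d * Md_norm d K \<phi>"
    by (simp add: pos_divide_le_eq mult_ac del: power_Suc)
qed

end

section \<open>Normal functionals\<close>

definition delta :: "('a, 'b) monoid_scheme \<Rightarrow> 'a \<Rightarrow> 'a \<Rightarrow> complex" where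
  "delta G t = (\<lambda>s\<in>carrier G. if s = t then 1 else 0)"

text \<open>The elements of the predual, viewed as functionals: limits, uniformly on the unit ball, of
  combinations of evaluations.\<close>

definition normal_functional :: "nat \<Rightarrow> ('a, 'b) monoid_scheme \<Rightarrow> (('a \<Rightarrow> complex) \<Rightarrow> complex) \<Rightarrow> bool" where
  "normal_functional d G L \<longleftrightarrow> (\<forall>e>0. \<exists>F g. finite F \<and> F \<subseteq> carrier G \<and>
     (\<forall>\<phi>\<in>Md d G. norm (L \<phi> - (\<Sum>t\<in>F. \<phi> t * g t)) \<le> e * Md_norm d G \<phi>))"

text \<open>The scalars on their own type, where, unlike in \<open>scalar_space\<close>, addition is
  that of the type.\<close>

definition complex_space :: "complex cspace" where
  "complex_space = \<lparr>vecs = UNIV, vzero = 0, vadd = (+), vscale = (*), vinner = (\<lambda>x y. x * cnj y)\<rparr>"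

lemma complex_space_simps [simp]:
  "vecs complex_space = UNIV" "vzero complex_space = 0" "vadd complex_space x y = x + y"
  "vscale complex_space x y = x * y" "vinner complex_space x y = x * cnj y"
  "vnorm complex_space x = norm x"
  by (simp_all add: complex_space_def vnorm_def cmod_def power2_eq_square)

lemma additive_hilbert_space_complex: "additive_hilbert_space complex_space"
proof
  fix u :: "nat \<Rightarrow> complex"
  have dist: "vdist complex_space x y = dist x y" for x y by (simp add: vdist_def dist_norm)
  assume "\<And>e. e > 0 \<Longrightarrow> \<exists>N. \<forall>m\<ge>N. \<forall>n\<ge>N. vdist complex_space (u m) (u n) < e"
  then have "Cauchy u" by (simp add: dist Cauchy_def)
  then obtain z where "u \<longlonglongrightarrow> z" using Cauchy_convergent_iff convergent_def by blast
  then show "\<exists>x\<in>vecs complex_space. (\<lambda>n. vdist complex_space (u n) x) \<longlonglongrightarrow> 0"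
    by (auto simp: dist tendsto_dist_iff[symmetric])
qed (auto simp: algebra_simps complex_eq_iff sum_squares_gt_zero_iff)

text \<open>A subspace of a finite-dimensional space is the common kernel of the functionals
  vanishing on it. This is all of Hahn-Banach that the weak-star closure requires, since a basic
  neighbourhood restricts finitely many pairings. The proof eliminates one coordinate at a
  time.\<close>

lemma finite_dim_separation:
  fixes W :: "('x \<Rightarrow> complex) set" and v :: "'x \<Rightarrow> complex"
  assumes "finite I" and "W \<noteq> {}"
    and "\<And>w w' a. w \<in> W \<Longrightarrow> w' \<in> W \<Longrightarrow> (\<lambda>i. w i + a * w' i) \<in> W"
    and "\<And>c. (\<And>w. w \<in> W \<Longrightarrow> (\<Sum>i\<in>I. c i * w i) = 0) \<Longrightarrow> (\<Sum>i\<in>I. c i * v i) = 0"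
  shows "\<exists>w\<in>W. \<forall>i\<in>I. w i = v i"
  using assms
proof (induction I arbitrary: W v rule: finite_induct)
  case empty then show ?case by auto
next
  case (insert j I)
  note lin = insert.prems(2) and sep = insert.prems(3)
  show ?case
  proof (cases "\<forall>w\<in>W. w j = 0")
    case True
    have "(\<Sum>i\<in>insert j I. (if i = j then 1 else 0) * v i) = 0"
    proof (rule sep)
      fix w assume "w \<in> W"
      then have "(if i = j then 1 else 0) * w i = 0" for i using True by simp
      then show "(\<Sum>i\<in>insert j I. (if i = j then 1 else 0) * w i) = 0" by (intro sum.neutral ballI)
    qed
    then have vj: "v j = 0" using insert.hyps by (simp add: if_distrib[of "\<lambda>x. x * _"] sum.delta' cong: if_cong)
    have "\<exists>w\<in>W. \<forall>i\<in>I. w i = v i"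
    proof (rule insert.IH[OF insert.prems(1) lin])
      fix c assume c: "\<And>w. w \<in> W \<Longrightarrow> (\<Sum>i\<in>I. c i * w i) = 0"
      have upd: "(\<Sum>i\<in>insert j I. (c(j := 0)) i * w i) = (\<Sum>i\<in>I. c i * w i)" for w
        using insert.hyps by (auto intro!: sum.cong)
      show "(\<Sum>i\<in>I. c i * v i) = 0" using sep[of "c(j := 0)"] c unfolding upd by blast
    qed
    then show ?thesis using True vj by auto
  next
    case False
    then obtain w0 where w0: "w0 \<in> W" "w0 j \<noteq> 0" by blast
    \<comment> \<open>\<open>w0\<close> is the pivot; the multiple subtracted clears the coordinate
      \<open>j\<close> of \<open>v\<close>.\<close>
    define v' where "v' i = v i - v j / w0 j * w0 i" for i
    have "\<exists>w\<in>{w\<in>W. w j = 0}. \<forall>i\<in>I. w i = v' i"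
    proof (rule insert.IH)
      have "(\<lambda>i. w0 i + (- 1) * w0 i) \<in> W" by (rule lin[OF w0(1) w0(1)])
      then show "{w \<in> W. w j = 0} \<noteq> {}" by auto
      show "(\<lambda>i. w i + a * w' i) \<in> {w \<in> W. w j = 0}"
        if "w \<in> {w \<in> W. w j = 0}" "w' \<in> {w \<in> W. w j = 0}" for w w' a
        using that lin by simp
      fix c assume c: "\<And>w. w \<in> {w \<in> W. w j = 0} \<Longrightarrow> (\<Sum>i\<in>I. c i * w i) = 0"
      \<comment> \<open>The coefficient \<open>- s\<close> at \<open>j\<close> makes the extended
        functional vanish at \<open>w0\<close>, so a functional on the vectors with zero coordinate
        \<open>j\<close> extends to one that kills all of \<open>W\<close>.\<close>
      define s where "s = (\<Sum>i\<in>I. c i * w0 i) / w0 j"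
      have upd: "(\<Sum>i\<in>insert j I. (c(j := - s)) i * w i) = (\<Sum>i\<in>I. c i * w i) - s * w j" for w
      proof -
        have "(\<Sum>i\<in>I. (c(j := - s)) i * w i) = (\<Sum>i\<in>I. c i * w i)"
          using insert.hyps by (auto intro!: sum.cong)
        then show ?thesis using insert.hyps by simp
      qed
      have shift: "(\<Sum>i\<in>I. c i * (w i + a * w0 i)) = (\<Sum>i\<in>I. c i * w i) + a * (s * w0 j)" for w a
      proof -
        have "s * w0 j = (\<Sum>i\<in>I. c i * w0 i)" using w0(2) by (simp add: s_def)
        then show ?thesis by (simp add: distrib_left sum.distrib sum_distrib_left mult_ac)
      qed
      have "(\<Sum>i\<in>insert j I. (c(j := - s)) i * w i) = 0" if "w \<in> W" for w
      proof -
        have "(\<lambda>i. w i + (- (w j / w0 j)) * w0 i) \<in> {w \<in> W. w j = 0}"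
          using lin[OF that w0(1), of "- (w j / w0 j)"] w0(2) by simp
        from c[OF this] show ?thesis using w0(2) unfolding upd shift by simp
      qed
      then have "(\<Sum>i\<in>I. c i * v i) - s * v j = 0" using sep[of "c(j := - s)"] unfolding upd by blast
      then show "(\<Sum>i\<in>I. c i * v' i) = 0"
        using shift[of v "- (v j / w0 j)"] w0(2) by (simp add: v'_def mult.commute)
    qed
    then obtain w where w: "w \<in> W" "w j = 0" "\<forall>i\<in>I. w i = v' i" by blast
    have "(\<lambda>i. w i + v j / w0 j * w0 i) \<in> W" by (rule lin[OF w(1) w0(1)])
    then show ?thesis
      using w w0(2) by (intro bexI[of _ "\<lambda>i. w i + v j / w0 j * w0 i"]) (auto simp: v'_def)
  qed
qed

section \<open>Elementary multipliers of one group\<close>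

locale multipliers =
  fixes d :: nat and G :: "('a, 'b) monoid_scheme"
  assumes d: "2 \<le> d" and G: "group G"
begin

interpretation G: group G by (rule G)

interpretation C: additive_hilbert_space complex_space by (rule additive_hilbert_space_complex)

text \<open>A coefficient of the left regular representation between the point vector at the unit
  and the conjugate of \<open>f\<close>. The conjugate appears because the inner product is linear
  in its first argument.\<close>

lemma finsupp_Md: assumes f: "f \<in> finsupp_fun G" shows "f \<in> Md d G"
proof -
  interpret l2: additive_hilbert_space "l2 complex_space :: ('a \<Rightarrow> complex) cspace"
    by (rule C.additive_hilbert_space_l2)
  define v where "v s = (if s \<in> carrier G then cnj (f s) else 0)" for s
  have fin: "finite {t \<in> carrier G. f t \<noteq> 0}" and ext: "f \<in> extensional (carrier G)"
    using f by (auto simp: finsupp_fun_def)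
  have "v = (\<Sum>s\<in>{t \<in> carrier G. f t \<noteq> 0}. single s (cnj (f s)))"
  proof
    fix s
    have "(\<Sum>s\<in>I. single s (cnj (f s))) x = (\<Sum>s\<in>I. single s (cnj (f s)) x)" if "finite I" for I x
      using that by induction simp_all
    then show "v s = (\<Sum>s\<in>{t \<in> carrier G. f t \<noteq> 0}. single s (cnj (f s))) s"
      using fin by (simp add: v_def single_def)
  qed
  moreover have "(\<Sum>s\<in>I. single s (cnj (f s))) \<in> vecs (l2 complex_space)" for I
    by (intro l2.sum_mem C.single_mem) simp
  ultimately have v: "v \<in> vecs (l2 complex_space)" by (simp only:)
  have one: "single \<one>\<^bsub>G\<^esub> 1 \<in> vecs (l2 complex_space)" by (rule C.single_mem) simp
  let ?B = "\<lambda>(i::nat) t. pinj (carrier G) ((\<otimes>\<^bsub>G\<^esub>) t) (\<lambda>_ z. z :: complex)"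
  have inj: "inj_on ((\<otimes>\<^bsub>G\<^esub>) t) (carrier G)" if "t \<in> carrier G" for t
    using that by (simp add: inj_on_def)
  have "f \<in> Md d G \<and> Md_norm d G f \<le>
    (\<Prod>i=1..d. 1) * vnorm (l2 complex_space) (single \<one>\<^bsub>G\<^esub> 1) * vnorm (l2 complex_space) v"
  proof (rule Md_coefficientI[OF d G ext, where B = ?B])
    show "complex_hilbert_space (l2 complex_space :: ('a \<Rightarrow> complex) cspace)" by unfold_locales
    show "op_bound 1 (l2 complex_space) (l2 complex_space) (?B i t)" if "t \<in> carrier G" for i t
      by (intro op_bound_pinj inj that additive_hilbert_space_complex op_boundI) simp_all
    fix t assume t: "t \<in> {1..d} \<rightarrow> carrier G"
    let ?R = "\<lambda>_ x y. x \<in> carrier G \<and> y = single x (1 :: complex)"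
    have "?R 0 (foldr (\<lambda>i x. t i \<otimes>\<^bsub>G\<^esub> x) [1..<Suc d] \<one>\<^bsub>G\<^esub>) (foldr (\<lambda>i. ?B i (t i)) [1..<Suc d] (single \<one>\<^bsub>G\<^esub> 1))"
    proof (rule foldr_suffix_induct[where R = ?R])
      fix i x y assume "1 \<le> i" "i \<le> d" "?R i x y"
      moreover from this have "t i \<in> carrier G" using t by auto
      ultimately show "?R (i - 1) (t i \<otimes>\<^bsub>G\<^esub> x) (?B i (t i) y)"
        by (simp add: pinj_single inj)
    qed simp
    then show "f (foldr (\<lambda>i x. t i \<otimes>\<^bsub>G\<^esub> x) [1..<Suc d] \<one>\<^bsub>G\<^esub>) =
        vinner (l2 complex_space) (foldr (\<lambda>i. ?B i (t i)) [1..<Suc d] (single \<one>\<^bsub>G\<^esub> 1)) v"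
      using C.vinner_single[OF v, of 1] l2.inner_commute[OF v C.single_mem[of 1]]
      by (simp add: v_def del: upt_Suc)
  qed (use one v in simp_all)
  then show ?thesis by blast
qed

lemma delta_Md: "t \<in> carrier G \<Longrightarrow> delta G t \<in> Md d G"
  by (rule finsupp_Md) (auto simp: finsupp_fun_def delta_def intro: finite_subset[of _ "{t}"])

lemma one_Md: "(\<lambda>t\<in>carrier G. 1) \<in> Md d G" "Md_norm d G (\<lambda>t\<in>carrier G. 1) \<le> 1"
proof -
  have "(\<lambda>t\<in>carrier G. 1) \<in> Md d G \<and> Md_norm d G (\<lambda>t\<in>carrier G. 1) \<le>
      (\<Prod>i=1..d. 1) * vnorm complex_space 1 * vnorm complex_space 1"
  proof (rule Md_coefficientI[OF d G, where B = "\<lambda>_ _ z. z"])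
    show "complex_hilbert_space complex_space" by unfold_locales
    show "(\<lambda>t\<in>carrier G. 1) \<in> extensional (carrier G)" by (rule restrict_extensional)
    fix t assume "t \<in> {1..d} \<rightarrow> carrier G"
    moreover have "foldr (\<lambda>_ z. z) xs z = z" for xs :: "nat list" and z :: complex
      by (induction xs) auto
    ultimately show "(\<lambda>t\<in>carrier G. 1) (foldr (\<lambda>i x. t i \<otimes>\<^bsub>G\<^esub> x) [1..<Suc d] \<one>\<^bsub>G\<^esub>) =
        vinner complex_space (foldr (\<lambda>_ z. z) [1..<Suc d] 1) 1"
      using foldr_one_mem[OF _ G] by (simp del: upt_Suc)
  qed (simp_all add: op_bound_def)
  then show "(\<lambda>t\<in>carrier G. 1) \<in> Md d G" "Md_norm d G (\<lambda>t\<in>carrier G. 1) \<le> 1" by simp_all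
qed

lemma norm_le: "\<phi> \<in> Md d G \<Longrightarrow> t \<in> carrier G \<Longrightarrow> norm (\<phi> t) \<le> Md_norm d G \<phi>"
  using norm_le_Md_norm[OF _ G] d by simp

lemma norm_nonneg: "\<phi> \<in> Md d G \<Longrightarrow> 0 \<le> Md_norm d G \<phi>"
  using Md_norm_nonneg[OF _ G] d by simp

lemma scale_Md:
  assumes \<phi>: "\<phi> \<in> Md d G"
  shows "(\<lambda>t\<in>carrier G. a * \<phi> t) \<in> Md d G"
    and "Md_norm d G (\<lambda>t\<in>carrier G. a * \<phi> t) \<le> norm a * Md_norm d G \<phi>"
proof -
  let ?\<psi> = "\<lambda>t\<in>carrier G. a * \<phi> t"
  have le: "?\<psi> \<in> Md d G \<and> Md_norm d G ?\<psi> \<le> norm a * N" if N: "Md_norm d G \<phi> < N" for N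
  proof (rule Md_coefficientE[OF \<phi> N G])
    fix K :: "nat \<Rightarrow> (complex + ('a list \<Rightarrow> complex) \<Rightarrow> complex) cspace" and C B u v
    assume K: "\<And>i. i \<le> d \<Longrightarrow> additive_hilbert_space (K i)"
      and C: "\<And>i. i \<in> {1..d} \<Longrightarrow> 0 \<le> C i" "(\<Prod>i=1..d. C i) < N"
      and B: "\<And>i t. i \<in> {1..d} \<Longrightarrow> t \<in> carrier G \<Longrightarrow> op_bound (C i) (K i) (K (i - 1)) (B i t)"
      and u: "u \<in> vecs (K d)" and v: "v \<in> vecs (K 0)" and uv: "vnorm (K d) u = 1" "vnorm (K 0) v = 1"
      and factor: "\<And>t. t \<in> {1..d} \<rightarrow> carrier G \<Longrightarrow>
        \<phi> (foldr (\<lambda>i x. t i \<otimes>\<^bsub>G\<^esub> x) [1..<Suc d] \<one>\<^bsub>G\<^esub>) =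
        vinner (K 0) (foldr (\<lambda>i. B i (t i)) [1..<Suc d] u) v"
    interpret K0: additive_hilbert_space "K 0" by (rule K) simp
    have "?\<psi> \<in> Md d G \<and> Md_norm d G ?\<psi> \<le>
        (\<Prod>i=1..d. C i) * vnorm (K d) u * vnorm (K 0) (vscale (K 0) (cnj a) v)"
    proof (rule Md_coefficientI[OF d G, where B = B])
      show "complex_hilbert_space (K i)" if "i \<le> d" for i
        using K[OF that] by (simp add: additive_hilbert_space_def)
      show "?\<psi> \<in> extensional (carrier G)" by (rule restrict_extensional)
      fix t assume t: "t \<in> {1..d} \<rightarrow> carrier G"
      have "foldr (\<lambda>i. B i (t i)) [1..<Suc d] u \<in> vecs (K 0)"
        using t by (intro norm_foldr_le[THEN conjunct1, of d C] B C u) auto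
      then show "?\<psi> (foldr (\<lambda>i x. t i \<otimes>\<^bsub>G\<^esub> x) [1..<Suc d] \<one>\<^bsub>G\<^esub>) =
          vinner (K 0) (foldr (\<lambda>i. B i (t i)) [1..<Suc d] u) (vscale (K 0) (cnj a) v)"
        using factor[OF t] foldr_one_mem[OF t G] v by (simp add: K0.inner_scale_right del: upt_Suc)
    qed (use B C u v in \<open>simp_all add: K0.scale_closed\<close>)
    moreover have "(\<Prod>i=1..d. C i) * norm a \<le> N * norm a" using C(2) by (intro mult_right_mono) auto
    ultimately show ?thesis using uv v by (simp add: K0.vnorm_scale mult.commute)
  qed
  show "?\<psi> \<in> Md d G" using le[OF less_add_one] by simp
  show "Md_norm d G ?\<psi> \<le> norm a * Md_norm d G \<phi>"
  proof (cases "a = 0")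
    case True then show ?thesis using le[OF less_add_one] by simp
  next
    case False
    then have "Md_norm d G ?\<psi> / norm a \<le> N" if "Md_norm d G \<phi> < N" for N
      using le[OF that] by (simp add: pos_divide_le_eq mult.commute)
    then have "Md_norm d G ?\<psi> / norm a \<le> Md_norm d G \<phi>" by (rule dense_ge)
    then show ?thesis using False by (simp add: pos_divide_le_eq mult.commute)
  qed
qed

lemma zero_Md: "(\<lambda>t\<in>carrier G. 0) \<in> Md d G" "Md_norm d G (\<lambda>t\<in>carrier G. 0) \<le> 0"
  using scale_Md[OF one_Md(1), of 0] by (simp_all cong: restrict_cong)


section \<open>The pairing with the predual\<close>

lemma duality_summable:
  assumes "\<phi> \<in> Md d G" "g \<in> l1 G"
  shows "(\<lambda>t. norm (\<phi> t * g t)) summable_on carrier G"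
proof (rule summable_on_comparison_test)
  show "(\<lambda>t. Md_norm d G \<phi> * norm (g t)) summable_on carrier G"
    using assms(2) by (intro summable_on_cmult_right) (simp add: l1_def)
qed (use assms norm_le in \<open>auto simp: norm_mult intro: mult_right_mono\<close>)

lemma duality_approx:
  assumes g: "g \<in> l1 G" and e: "e > 0"
  obtains F where "finite F" "F \<subseteq> carrier G"
    "\<And>\<phi>. \<phi> \<in> Md d G \<Longrightarrow> norm (duality G \<phi> g - (\<Sum>t\<in>F. \<phi> t * g t)) \<le> e * Md_norm d G \<phi>"
proof -
  have sg: "(\<lambda>t. norm (g t)) summable_on carrier G" using g by (simp add: l1_def)
  obtain F where F: "finite F" "F \<subseteq> carrier G"
    and dist: "dist (\<Sum>t\<in>F. norm (g t)) (\<Sum>\<^sub>\<infinity>t\<in>carrier G. norm (g t)) \<le> e"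
    using infsum_finite_approximation[OF sg e] by blast
  have split: "infsum f (carrier G) = sum f F + infsum f (carrier G - F)"
    if "f summable_on carrier G" for f :: "'a \<Rightarrow> 'z::banach"
    using infsum_Un_disjoint[of f F "carrier G - F"] F that summable_on_subset_banach[OF that, of "carrier G - F"]
    by (simp add: Un_absorb1)
  have tail: "(\<Sum>\<^sub>\<infinity>t\<in>carrier G - F. norm (g t)) \<le> e"
    using dist split[OF sg] by (simp add: dist_real_def)
  show thesis
  proof (rule that[OF F])
    fix \<phi> assume \<phi>: "\<phi> \<in> Md d G"
    have s: "(\<lambda>t. norm (\<phi> t * g t)) summable_on (carrier G - F)"
      by (rule summable_on_subset_banach[OF duality_summable[OF \<phi> g]]) simp
    have "duality G \<phi> g - (\<Sum>t\<in>F. \<phi> t * g t) = (\<Sum>\<^sub>\<infinity>t\<in>carrier G - F. \<phi> t * g t)"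
      unfolding duality_def using split[OF abs_summable_summable[OF duality_summable[OF \<phi> g]]] by simp
    also have "norm \<dots> \<le> (\<Sum>\<^sub>\<infinity>t\<in>carrier G - F. norm (\<phi> t * g t))"
      by (rule norm_infsum_bound[OF s])
    also have "\<dots> \<le> (\<Sum>\<^sub>\<infinity>t\<in>carrier G - F. Md_norm d G \<phi> * norm (g t))"
      using norm_le[OF \<phi>] by (intro infsum_mono[OF s] summable_on_cmult_right summable_on_subset_banach[OF sg])
        (auto simp: norm_mult intro: mult_right_mono)
    also have "\<dots> = Md_norm d G \<phi> * (\<Sum>\<^sub>\<infinity>t\<in>carrier G - F. norm (g t))"
      by (rule infsum_cmult_right')
    also have "\<dots> \<le> Md_norm d G \<phi> * e" by (rule mult_left_mono[OF tail norm_nonneg[OF \<phi>]])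
    finally show "norm (duality G \<phi> g - (\<Sum>t\<in>F. \<phi> t * g t)) \<le> e * Md_norm d G \<phi>"
      by (simp add: mult.commute)
  qed
qed

lemma norm_duality_le_l1:
  assumes "\<phi> \<in> Md d G" "g \<in> l1 G"
  shows "norm (duality G \<phi> g) \<le> Md_norm d G \<phi> * (\<Sum>\<^sub>\<infinity>t\<in>carrier G. norm (g t))"
proof -
  have "norm (duality G \<phi> g) \<le> (\<Sum>\<^sub>\<infinity>t\<in>carrier G. norm (\<phi> t * g t))"
    unfolding duality_def by (rule norm_infsum_bound[OF duality_summable[OF assms]])
  also have "\<dots> \<le> (\<Sum>\<^sub>\<infinity>t\<in>carrier G. Md_norm d G \<phi> * norm (g t))"
    using norm_le[OF assms(1)] assms(2)
    by (intro infsum_mono[OF duality_summable[OF assms]] summable_on_cmult_right)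
      (auto simp: norm_mult l1_def intro: mult_right_mono)
  finally show ?thesis by (simp add: infsum_cmult_right')
qed

lemma Xd_norm_upper:
  assumes "\<phi> \<in> Md d G" "Md_norm d G \<phi> \<le> 1" "g \<in> l1 G"
  shows "norm (duality G \<phi> g) \<le> Xd_norm d G g"
  unfolding Xd_norm_def
proof (rule cSUP_upper)
  show "bdd_above ((\<lambda>\<phi>. norm (duality G \<phi> g)) ` {\<phi> \<in> Md d G. Md_norm d G \<phi> \<le> 1})"
  proof (rule bdd_aboveI2)
    fix \<phi> assume \<phi>: "\<phi> \<in> {\<phi> \<in> Md d G. Md_norm d G \<phi> \<le> 1}"
    have "norm (duality G \<phi> g) \<le> Md_norm d G \<phi> * (\<Sum>\<^sub>\<infinity>t\<in>carrier G. norm (g t))"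
      using \<phi> by (intro norm_duality_le_l1 assms) auto
    also have "\<dots> \<le> 1 * (\<Sum>\<^sub>\<infinity>t\<in>carrier G. norm (g t))"
      using \<phi> by (intro mult_right_mono infsum_nonneg) auto
    finally show "norm (duality G \<phi> g) \<le> 1 * (\<Sum>\<^sub>\<infinity>t\<in>carrier G. norm (g t))" .
  qed
qed (use assms in simp)

lemma norm_duality_le:
  assumes \<phi>: "\<phi> \<in> Md d G" and g: "g \<in> l1 G"
  shows "norm (duality G \<phi> g) \<le> Md_norm d G \<phi> * Xd_norm d G g"
proof (cases "Md_norm d G \<phi> = 0")
  \<comment> \<open>A multiplier of norm 0 cannot be rescaled to norm 1; here the \<open>l1\<close>
    estimate already gives 0.\<close>
  case True
  then show ?thesis using norm_duality_le_l1[OF assms] by simp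
next
  case False
  define r where "r = Md_norm d G \<phi>"
  have r: "r > 0" using False norm_nonneg[OF \<phi>] by (simp add: r_def)
  let ?\<psi> = "\<lambda>t\<in>carrier G. of_real (1 / r) * \<phi> t"
  have "Md_norm d G ?\<psi> \<le> 1"
    using scale_Md(2)[OF \<phi>, of "of_real (1 / r)"] r by (simp add: norm_divide flip: r_def)
  then have "norm (duality G ?\<psi> g) \<le> Xd_norm d G g"
    by (intro Xd_norm_upper scale_Md \<phi> g)
  moreover have "duality G ?\<psi> g = of_real (1 / r) * duality G \<phi> g"
  proof -
    have "duality G ?\<psi> g = (\<Sum>\<^sub>\<infinity>t\<in>carrier G. of_real (1 / r) * (\<phi> t * g t))"
      unfolding duality_def by (rule infsum_cong) simp
    then show ?thesis by (simp only: infsum_cmult_right' duality_def)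
  qed
  ultimately show ?thesis using r by (simp add: norm_divide pos_divide_le_eq mult.commute flip: r_def)
qed

lemma duality_diff:
  assumes \<phi>: "\<phi> \<in> Md d G" and g: "g \<in> l1 G" and h: "h \<in> l1 G"
  shows "(\<lambda>t\<in>carrier G. g t - h t) \<in> l1 G"
    and "duality G \<phi> (\<lambda>t\<in>carrier G. g t - h t) = duality G \<phi> g - duality G \<phi> h"
proof -
  have "(\<lambda>t. norm (g t - h t)) summable_on carrier G"
  proof (rule summable_on_comparison_test)
    show "(\<lambda>t. norm (g t) + norm (h t)) summable_on carrier G"
      using g h by (intro summable_on_add) (auto simp: l1_def)
  qed (auto simp: norm_triangle_ineq4)
  then show "(\<lambda>t\<in>carrier G. g t - h t) \<in> l1 G"
    by (simp add: l1_def cong: summable_on_cong)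
  have "duality G \<phi> (\<lambda>t\<in>carrier G. g t - h t) = (\<Sum>\<^sub>\<infinity>t\<in>carrier G. \<phi> t * g t + - (\<phi> t * h t))"
    unfolding duality_def by (rule infsum_cong) (simp add: right_diff_distrib)
  also have "\<dots> = (\<Sum>\<^sub>\<infinity>t\<in>carrier G. \<phi> t * g t) + (\<Sum>\<^sub>\<infinity>t\<in>carrier G. - (\<phi> t * h t))"
    using abs_summable_summable[OF duality_summable[OF \<phi> g]] abs_summable_summable[OF duality_summable[OF \<phi> h]]
    by (intro infsum_add) (auto simp: summable_on_uminus)
  also have "\<dots> = duality G \<phi> g - duality G \<phi> h" by (simp add: duality_def infsum_uminus)
  finally show "duality G \<phi> (\<lambda>t\<in>carrier G. g t - h t) = duality G \<phi> g - duality G \<phi> h" .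
qed

lemma norm_duality_diff_le:
  assumes "\<phi> \<in> Md d G" "g \<in> l1 G" "h \<in> l1 G"
  shows "norm (duality G \<phi> g - duality G \<phi> h) \<le> Md_norm d G \<phi> * Xd_dist d G g h"
  using norm_duality_le[OF assms(1) duality_diff(1)[OF assms]] duality_diff(2)[OF assms]
  by (simp add: Xd_dist_def)

lemma Xd_dist_le:
  assumes "g \<in> l1 G" "h \<in> l1 G"
    and "\<And>\<phi>. \<phi> \<in> Md d G \<Longrightarrow> norm (duality G \<phi> g - duality G \<phi> h) \<le> e * Md_norm d G \<phi>" and "0 \<le> e"
  shows "Xd_dist d G g h \<le> e"
  unfolding Xd_dist_def Xd_norm_def
proof (rule cSUP_least)
  have "(\<lambda>t\<in>carrier G. 0) \<in> {\<phi> \<in> Md d G. Md_norm d G \<phi> \<le> 1}" using zero_Md by simp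
  then show "{\<phi> \<in> Md d G. Md_norm d G \<phi> \<le> 1} \<noteq> {}" by blast
  fix \<phi> assume \<phi>: "\<phi> \<in> {\<phi> \<in> Md d G. Md_norm d G \<phi> \<le> 1}"
  then have "norm (duality G \<phi> g - duality G \<phi> h) \<le> e * Md_norm d G \<phi>" using assms(3) by blast
  also have "\<dots> \<le> e * 1" using \<phi> assms(4) by (intro mult_left_mono) auto
  finally show "norm (duality G \<phi> (\<lambda>t\<in>carrier G. g t - h t)) \<le> e"
    using \<phi> duality_diff(2)[OF _ assms(1,2)] by simp
qed

lemma Xd_dist_nonneg:
  assumes "g \<in> l1 G" "h \<in> l1 G" shows "0 \<le> Xd_dist d G g h"
  using Xd_norm_upper[OF zero_Md(1) order_trans[OF zero_Md(2) zero_le_one] duality_diff(1)[OF one_Md(1) assms]]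
  unfolding Xd_dist_def by (rule order_trans[OF norm_ge_zero])

lemma Xd_cauchyD:
  "u \<in> Xd_cauchy d G \<Longrightarrow> e > 0 \<Longrightarrow> \<exists>N. \<forall>m\<ge>N. \<forall>n\<ge>N. Xd_dist d G (u m) (u n) < e"
  by (simp add: Xd_cauchy_def)

lemma Xd_dist_self: "g \<in> l1 G \<Longrightarrow> Xd_dist d G g g = 0"
  using Xd_dist_le[of g g 0] Xd_dist_nonneg[of g g] by simp

lemma Xd_representative:
  assumes "x \<in> Xd d G"
  shows "\<exists>u\<in>Xd_cauchy d G. u \<in> x \<and> x = {v \<in> Xd_cauchy d G. (\<lambda>n. Xd_dist d G (u n) (v n)) \<longlonglongrightarrow> 0}"
proof -
  obtain u where u: "u \<in> Xd_cauchy d G"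
    and x: "x = {v \<in> Xd_cauchy d G. (\<lambda>n. Xd_dist d G (u n) (v n)) \<longlonglongrightarrow> 0}"
    using assms unfolding Xd_def by (auto elim!: quotientE)
  have "u n \<in> l1 G" for n using u by (auto simp: Xd_cauchy_def)
  then show ?thesis using u x by (intro bexI[of _ u]) (simp_all add: Xd_dist_self)
qed

text \<open>Justifies the definite description in \<open>Xd_pairing\<close>: the limit exists along
  one representative, and equivalent sequences have the same limit.\<close>

lemma pairing_tendsto:
  assumes x: "x \<in> Xd d G" and u: "u \<in> x" and \<phi>: "\<phi> \<in> Md d G"
  shows "(\<lambda>n. duality G \<phi> (u n)) \<longlonglongrightarrow> Xd_pairing G \<phi> x"
proof -
  obtain w where w: "w \<in> Xd_cauchy d G" "w \<in> x"
    and xw: "x = {v \<in> Xd_cauchy d G. (\<lambda>n. Xd_dist d G (w n) (v n)) \<longlonglongrightarrow> 0}"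
    using Xd_representative[OF x] by blast
  have wl: "w n \<in> l1 G" for n using w by (auto simp: Xd_cauchy_def)
  have "Cauchy (\<lambda>n. duality G \<phi> (w n))"
    unfolding Cauchy_def
  proof (intro allI impI)
    fix e :: real assume e: "e > 0"
    \<comment> \<open>Adding 1 permits division by \<open>r\<close> even when the norm is 0.\<close>
    define r where "r = Md_norm d G \<phi> + 1"
    have r: "r > 0" using norm_nonneg[OF \<phi>] by (simp add: r_def)
    obtain N where N: "\<And>m n. m \<ge> N \<Longrightarrow> n \<ge> N \<Longrightarrow> Xd_dist d G (w m) (w n) < e / r"
      using Xd_cauchyD[OF w(1) divide_pos_pos[OF e r]] by blast
    have "dist (duality G \<phi> (w m)) (duality G \<phi> (w n)) < e" if "m \<ge> N" "n \<ge> N" for m n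
    proof -
      have "dist (duality G \<phi> (w m)) (duality G \<phi> (w n)) \<le> Md_norm d G \<phi> * Xd_dist d G (w m) (w n)"
        unfolding dist_norm by (rule norm_duality_diff_le[OF \<phi> wl wl])
      also have "\<dots> \<le> r * Xd_dist d G (w m) (w n)"
        using Xd_dist_nonneg[OF wl wl] by (intro mult_right_mono) (simp_all add: r_def)
      also have "\<dots> < e" using N[OF that] r by (simp add: pos_less_divide_eq mult.commute)
      finally show ?thesis .
    qed
    then show "\<exists>M. \<forall>m\<ge>M. \<forall>n\<ge>M. dist (duality G \<phi> (w m)) (duality G \<phi> (w n)) < e" by blast
  qed
  then obtain z where z: "(\<lambda>n. duality G \<phi> (w n)) \<longlonglongrightarrow> z"
    using Cauchy_convergent_iff convergent_def by blast
  have lim: "(\<lambda>n. duality G \<phi> (v n)) \<longlonglongrightarrow> z" if v: "v \<in> x" for v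
  proof -
    have vl: "v n \<in> l1 G" for n using v by (auto simp: xw Xd_cauchy_def)
    have "(\<lambda>n. Md_norm d G \<phi> * Xd_dist d G (w n) (v n)) \<longlonglongrightarrow> 0"
      using v tendsto_mult_left[of "\<lambda>n. Xd_dist d G (w n) (v n)" 0 _ "Md_norm d G \<phi>"] by (simp add: xw)
    then have "(\<lambda>n. duality G \<phi> (w n) - duality G \<phi> (v n)) \<longlonglongrightarrow> 0"
      by (rule Lim_null_comparison[rotated]) (simp add: norm_duality_diff_le \<phi> wl vl)
    from tendsto_diff[OF z this] show ?thesis by simp
  qed
  have "\<And>z'. \<forall>u\<in>x. (\<lambda>n. duality G \<phi> (u n)) \<longlonglongrightarrow> z' \<Longrightarrow> z' = z"
    using w(2) z LIMSEQ_unique by blast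
  then have "Xd_pairing G \<phi> x = z"
    unfolding Xd_pairing_def using lim by (intro the_equality) blast+
  then show ?thesis using lim[OF u] by simp
qed

text \<open>Half of the error is spent on replacing the class by a term of a representing Cauchy
  sequence, half on truncating that term to a finite set.\<close>

lemma normal_pairing:
  assumes x: "x \<in> Xd d G" shows "normal_functional d G (\<lambda>\<phi>. Xd_pairing G \<phi> x)"
  unfolding normal_functional_def
proof (intro allI impI)
  fix e :: real assume e: "e > 0"
  obtain u where u: "u \<in> Xd_cauchy d G" and ux: "u \<in> x"
    using Xd_representative[OF x] by blast
  have ul: "u n \<in> l1 G" for n using u by (auto simp: Xd_cauchy_def)
  obtain N where N: "\<And>n. n \<ge> N \<Longrightarrow> Xd_dist d G (u N) (u n) < e / 2"
    using Xd_cauchyD[OF u half_gt_zero[OF e]] by blast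
  obtain F where F: "finite F" "F \<subseteq> carrier G"
    "\<And>\<phi>. \<phi> \<in> Md d G \<Longrightarrow> norm (duality G \<phi> (u N) - (\<Sum>t\<in>F. \<phi> t * u N t)) \<le> e / 2 * Md_norm d G \<phi>"
    using duality_approx[OF ul, of "e / 2" N] e by auto
  have "norm (Xd_pairing G \<phi> x - (\<Sum>t\<in>F. \<phi> t * u N t)) \<le> e * Md_norm d G \<phi>" if \<phi>: "\<phi> \<in> Md d G" for \<phi>
  proof -
    have "norm (Xd_pairing G \<phi> x - duality G \<phi> (u N)) \<le> e / 2 * Md_norm d G \<phi>"
    proof (rule LIMSEQ_le_const2)
      show "(\<lambda>n. norm (duality G \<phi> (u n) - duality G \<phi> (u N))) \<longlonglongrightarrow>
          norm (Xd_pairing G \<phi> x - duality G \<phi> (u N))"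
        by (intro tendsto_intros pairing_tendsto[OF x ux \<phi>])
      have "norm (duality G \<phi> (u n) - duality G \<phi> (u N)) \<le> e / 2 * Md_norm d G \<phi>" if "n \<ge> N" for n
      proof -
        have "norm (duality G \<phi> (u N) - duality G \<phi> (u n)) \<le> Md_norm d G \<phi> * Xd_dist d G (u N) (u n)"
          by (rule norm_duality_diff_le[OF \<phi> ul ul])
        also have "\<dots> \<le> Md_norm d G \<phi> * (e / 2)"
          using N[OF that] norm_nonneg[OF \<phi>] by (intro mult_left_mono) auto
        finally show ?thesis by (simp add: norm_minus_commute mult.commute)
      qed
      then show "\<exists>N'. \<forall>n\<ge>N'. norm (duality G \<phi> (u n) - duality G \<phi> (u N)) \<le> e / 2 * Md_norm d G \<phi>" by blast
    qed
    from norm_diff_triangle_le[OF this F(3)[OF \<phi>]] show ?thesis by (simp add: field_simps)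
  qed
  then show "\<exists>F g. finite F \<and> F \<subseteq> carrier G \<and>
      (\<forall>\<phi>\<in>Md d G. norm (Xd_pairing G \<phi> x - (\<Sum>t\<in>F. \<phi> t * g t)) \<le> e * Md_norm d G \<phi>)"
    using F(1,2) by blast
qed

text \<open>Approximants with errors \<open>1 / (n + 1)\<close>, read as finitely supported elements
  of \<open>l1\<close>, form a Cauchy sequence whose class represents \<open>L\<close>. With
  \<open>normal_pairing\<close>, the completion can from now on be replaced by normal
  functionals.\<close>

lemma normal_functional_is_pairing:
  assumes "normal_functional d G L"
  shows "\<exists>x\<in>Xd d G. \<forall>\<phi>\<in>Md d G. Xd_pairing G \<phi> x = L \<phi>"
proof -
  have "\<exists>F g. finite F \<and> F \<subseteq> carrier G \<and>
      (\<forall>\<phi>\<in>Md d G. norm (L \<phi> - (\<Sum>t\<in>F. \<phi> t * g t)) \<le> inverse (real (Suc n)) * Md_norm d G \<phi>)" for n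
    using assms unfolding normal_functional_def by simp
  then obtain F g where F: "\<And>n. finite (F n)" "\<And>n. F n \<subseteq> carrier G"
    and L: "\<And>n \<phi>. \<phi> \<in> Md d G \<Longrightarrow>
      norm (L \<phi> - (\<Sum>t\<in>F n. \<phi> t * g n t)) \<le> inverse (real (Suc n)) * Md_norm d G \<phi>"
    by metis
  define u where "u n = (\<lambda>t\<in>carrier G. if t \<in> F n then g n t else 0)" for n
  have ul: "u n \<in> l1 G" for n
  proof -
    have "(\<lambda>t. norm (u n t)) summable_on F n" using F(1) by simp
    then have "(\<lambda>t. norm (u n t)) summable_on carrier G"
      by (rule summable_on_cong_neutral[THEN iffD1, rotated -1]) (use F(2) in \<open>auto simp: u_def\<close>)
    then show ?thesis by (simp add: l1_def u_def)
  qed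
  have "duality G \<phi> (u n) = (\<Sum>t\<in>F n. \<phi> t * g n t)" for \<phi> n
  proof -
    have "duality G \<phi> (u n) = (\<Sum>\<^sub>\<infinity>t\<in>F n. \<phi> t * g n t)"
      unfolding duality_def by (rule infsum_cong_neutral) (use F(2) in \<open>auto simp: u_def\<close>)
    then show ?thesis using F(1) by simp
  qed
  with L have Lu: "norm (L \<phi> - duality G \<phi> (u n)) \<le> inverse (real (Suc n)) * Md_norm d G \<phi>"
    if "\<phi> \<in> Md d G" for \<phi> n using that by simp
  have dist: "Xd_dist d G (u m) (u n) \<le> inverse (real (Suc m)) + inverse (real (Suc n))" for m n
  proof (rule Xd_dist_le[OF ul ul])
    fix \<phi> assume \<phi>: "\<phi> \<in> Md d G"
    have "norm (duality G \<phi> (u m) - duality G \<phi> (u n)) \<le>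
        inverse (real (Suc m)) * Md_norm d G \<phi> + inverse (real (Suc n)) * Md_norm d G \<phi>"
      using Lu[OF \<phi>, of m] Lu[OF \<phi>, of n]
      by (intro norm_diff_triangle_le[of _ "L \<phi>"]) (simp_all add: norm_minus_commute)
    then show "norm (duality G \<phi> (u m) - duality G \<phi> (u n)) \<le>
        (inverse (real (Suc m)) + inverse (real (Suc n))) * Md_norm d G \<phi>" by (simp add: distrib_right)
  qed simp
  have u: "u \<in> Xd_cauchy d G"
    unfolding Xd_cauchy_def
  proof (intro CollectI conjI allI impI)
    show "range u \<subseteq> l1 G" using ul by blast
    fix e :: real assume "e > 0"
    then obtain N where N: "inverse (real (Suc N)) < e / 2" using reals_Archimedean[of "e / 2"] by auto
    have "Xd_dist d G (u m) (u n) < e" if "m \<ge> N" "n \<ge> N" for m n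
    proof -
      have "inverse (real (Suc m)) \<le> inverse (real (Suc N))" "inverse (real (Suc n)) \<le> inverse (real (Suc N))"
        using that by (simp_all add: le_imp_inverse_le)
      then show ?thesis using dist[of m n] N by linarith
    qed
    then show "\<exists>N. \<forall>m\<ge>N. \<forall>n\<ge>N. Xd_dist d G (u m) (u n) < e" by blast
  qed
  define x where "x = {v \<in> Xd_cauchy d G. (\<lambda>n. Xd_dist d G (u n) (v n)) \<longlonglongrightarrow> 0}"
  have x: "x \<in> Xd d G"
    unfolding Xd_def x_def using u by (auto intro!: quotientI[THEN back_subst[of "\<lambda>z. z \<in> _"]])
  have ux: "u \<in> x" using u by (simp add: x_def Xd_dist_self ul)
  show ?thesis
  proof (intro bexI[OF _ x] ballI)
    fix \<phi> assume \<phi>: "\<phi> \<in> Md d G"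
    have "(\<lambda>n. inverse (real (Suc n)) * Md_norm d G \<phi>) \<longlonglongrightarrow> 0"
      using tendsto_mult_right[OF LIMSEQ_inverse_real_of_nat, of "Md_norm d G \<phi>"] by simp
    then have "(\<lambda>n. L \<phi> - duality G \<phi> (u n)) \<longlonglongrightarrow> 0"
      by (rule Lim_null_comparison[rotated]) (intro always_eventually allI Lu \<phi>)
    from tendsto_diff[OF tendsto_const[of "L \<phi>"] this] have "(\<lambda>n. duality G \<phi> (u n)) \<longlonglongrightarrow> L \<phi>" by simp
    then show "Xd_pairing G \<phi> x = L \<phi>" using pairing_tendsto[OF x ux \<phi>] LIMSEQ_unique by blast
  qed
qed

section \<open>Linear combinations and normal functionals\<close>

text \<open>Linearity is not part of \<open>normal_functional\<close>; it is inherited from the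
  approximating sums of evaluations. That the combination is a multiplier is assumed and is supplied
  at each use.\<close>

lemma normal_linear:
  assumes L: "normal_functional d G L" and I: "finite I" and \<phi>: "\<And>i. i \<in> I \<Longrightarrow> \<phi> i \<in> Md d G"
    and \<psi>: "\<psi> \<in> Md d G" and eq: "\<And>t. t \<in> carrier G \<Longrightarrow> \<psi> t = (\<Sum>i\<in>I. a i * \<phi> i t)"
  shows "L \<psi> = (\<Sum>i\<in>I. a i * L (\<phi> i))"
proof -
  \<comment> \<open>\<open>R - 1\<close> collects all the norms that multiply the error
    \<open>e / R\<close>; the added 1 makes \<open>R\<close> positive.\<close>
  define R where "R = Md_norm d G \<psi> + (\<Sum>i\<in>I. norm (a i) * Md_norm d G (\<phi> i)) + 1"
  have R: "R > 0"
    unfolding R_def using norm_nonneg[OF \<psi>] norm_nonneg[OF \<phi>]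
    by (intro add_nonneg_pos add_nonneg_nonneg sum_nonneg mult_nonneg_nonneg) auto
  have "norm (L \<psi> - (\<Sum>i\<in>I. a i * L (\<phi> i))) \<le> 0 + e" if "e > 0" for e
  proof -
    have "e / R > 0" using that R by simp
    then obtain F g where F: "finite F" "F \<subseteq> carrier G"
      and g: "\<And>\<phi>. \<phi> \<in> Md d G \<Longrightarrow> norm (L \<phi> - (\<Sum>t\<in>F. \<phi> t * g t)) \<le> e / R * Md_norm d G \<phi>"
      using L unfolding normal_functional_def by metis
    have swap: "(\<Sum>t\<in>F. \<psi> t * g t) = (\<Sum>i\<in>I. a i * (\<Sum>t\<in>F. \<phi> i t * g t))"
    proof -
      have "(\<Sum>t\<in>F. \<psi> t * g t) = (\<Sum>t\<in>F. \<Sum>i\<in>I. a i * (\<phi> i t * g t))"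
        using F(2) by (intro sum.cong) (auto simp: eq sum_distrib_right mult.assoc)
      also have "\<dots> = (\<Sum>i\<in>I. \<Sum>t\<in>F. a i * (\<phi> i t * g t))" by (rule sum.swap)
      finally show ?thesis by (simp add: sum_distrib_left)
    qed
    have "norm (L \<psi> - (\<Sum>i\<in>I. a i * L (\<phi> i))) =
        norm ((L \<psi> - (\<Sum>t\<in>F. \<psi> t * g t)) - (\<Sum>i\<in>I. a i * (L (\<phi> i) - (\<Sum>t\<in>F. \<phi> i t * g t))))"
      by (simp add: swap right_diff_distrib sum_subtractf)
    also have "\<dots> \<le> norm (L \<psi> - (\<Sum>t\<in>F. \<psi> t * g t)) +
        (\<Sum>i\<in>I. norm (a i * (L (\<phi> i) - (\<Sum>t\<in>F. \<phi> i t * g t))))"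
      by (intro order_trans[OF norm_triangle_ineq4] add_left_mono norm_sum)
    also have "\<dots> \<le> e / R * Md_norm d G \<psi> + (\<Sum>i\<in>I. norm (a i) * (e / R * Md_norm d G (\<phi> i)))"
      unfolding norm_mult by (intro add_mono sum_mono mult_left_mono g \<psi> \<phi> norm_ge_zero)
    also have "\<dots> = e / R * (R - 1)"
    proof -
      have "R - 1 = Md_norm d G \<psi> + (\<Sum>i\<in>I. norm (a i) * Md_norm d G (\<phi> i))" by (simp add: R_def)
      then show ?thesis by (simp add: distrib_left sum_distrib_left mult_ac)
    qed
    also have "\<dots> \<le> e" using that R by (simp add: field_simps)
    finally show ?thesis by simp
  qed
  then have "norm (L \<psi> - (\<Sum>i\<in>I. a i * L (\<phi> i))) \<le> 0" by (rule field_le_epsilon)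
  then show ?thesis by simp
qed

lemma normal_add:
  assumes L: "normal_functional d G L" and "\<phi> \<in> Md d G" "\<psi> \<in> Md d G" "\<eta> \<in> Md d G"
    and "\<And>t. t \<in> carrier G \<Longrightarrow> \<eta> t = \<phi> t + a * \<psi> t"
  shows "L \<eta> = L \<phi> + a * L \<psi>"
  using normal_linear[OF L, of UNIV "\<lambda>b. if b then \<phi> else \<psi>" \<eta> "\<lambda>b. if b then 1 else a"] assms(2-)
  by (simp add: UNIV_bool add.commute)

lemma normal_finsupp:
  assumes L: "normal_functional d G L" and f: "f \<in> finsupp_fun G"
  shows "L f = (\<Sum>t\<in>{t \<in> carrier G. f t \<noteq> 0}. f t * L (delta G t))"
proof (rule normal_linear[OF L _ _ finsupp_Md[OF f]])
  show fin: "finite {t \<in> carrier G. f t \<noteq> 0}" using f by (simp add: finsupp_fun_def)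
  fix t assume t: "t \<in> carrier G"
  have "(\<Sum>s\<in>{t \<in> carrier G. f t \<noteq> 0}. f s * delta G s t) =
      (\<Sum>s\<in>{t \<in> carrier G. f t \<noteq> 0}. if s = t then f s else 0)"
    using t by (intro sum.cong) (auto simp: delta_def)
  then show "f t = (\<Sum>s\<in>{t \<in> carrier G. f t \<noteq> 0}. f s * delta G s t)"
    using fin t by (simp add: sum.delta)
qed (simp add: delta_Md)

lemma normal_sum:
  assumes I: "finite I" and L: "\<And>i. i \<in> I \<Longrightarrow> normal_functional d G (L i)"
  shows "normal_functional d G (\<lambda>\<phi>. \<Sum>i\<in>I. c i * L i \<phi>)"
  unfolding normal_functional_def
proof (intro allI impI)
  fix e :: real assume e: "e > 0"
  define R where "R = (\<Sum>i\<in>I. norm (c i)) + 1"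
  have R: "R > 0" unfolding R_def by (intro add_nonneg_pos sum_nonneg) auto
  have "e / R > 0" using e R by simp
  then have "\<forall>i\<in>I. \<exists>F g. finite F \<and> F \<subseteq> carrier G \<and>
      (\<forall>\<phi>\<in>Md d G. norm (L i \<phi> - (\<Sum>t\<in>F. \<phi> t * g t)) \<le> e / R * Md_norm d G \<phi>)"
    using L unfolding normal_functional_def by blast
  then obtain F g where F: "\<And>i. i \<in> I \<Longrightarrow> finite (F i)" "\<And>i. i \<in> I \<Longrightarrow> F i \<subseteq> carrier G"
    and g: "\<And>i \<phi>. i \<in> I \<Longrightarrow> \<phi> \<in> Md d G \<Longrightarrow>
      norm (L i \<phi> - (\<Sum>t\<in>F i. \<phi> t * g i t)) \<le> e / R * Md_norm d G \<phi>" by metis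
  \<comment> \<open>The weights \<open>g i\<close> are extended by zero to the union of the supports
    and combined there.\<close>
  define h where "h t = (\<Sum>i\<in>I. c i * (if t \<in> F i then g i t else 0))" for t
  have U: "finite (\<Union>i\<in>I. F i)" "(\<Union>i\<in>I. F i) \<subseteq> carrier G" using I F by auto
  have sum: "(\<Sum>t\<in>(\<Union>i\<in>I. F i). \<phi> t * h t) = (\<Sum>i\<in>I. c i * (\<Sum>t\<in>F i. \<phi> t * g i t))" for \<phi> :: "'a \<Rightarrow> complex"
  proof -
    have "(\<Sum>t\<in>(\<Union>i\<in>I. F i). \<phi> t * h t) =
        (\<Sum>i\<in>I. \<Sum>t\<in>(\<Union>i\<in>I. F i). c i * (if t \<in> F i then \<phi> t * g i t else 0))"
      unfolding h_def sum_distrib_left by (subst sum.swap) (auto intro!: sum.cong)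
    also have "\<dots> = (\<Sum>i\<in>I. c i * (\<Sum>t\<in>(\<Union>i\<in>I. F i). if t \<in> F i then \<phi> t * g i t else 0))"
      by (simp add: sum_distrib_left)
    also have "\<dots> = (\<Sum>i\<in>I. c i * (\<Sum>t\<in>F i. \<phi> t * g i t))"
    proof (rule sum.cong[OF refl], rule arg_cong2[OF refl, where f = "(*)"])
      fix i assume "i \<in> I"
      then show "(\<Sum>t\<in>(\<Union>i\<in>I. F i). if t \<in> F i then \<phi> t * g i t else 0) = (\<Sum>t\<in>F i. \<phi> t * g i t)"
        using U(1) by (intro sum.mono_neutral_cong_right) auto
    qed
    finally show ?thesis .
  qed
  have "norm ((\<Sum>i\<in>I. c i * L i \<phi>) - (\<Sum>t\<in>(\<Union>i\<in>I. F i). \<phi> t * h t)) \<le> e * Md_norm d G \<phi>"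
    if \<phi>: "\<phi> \<in> Md d G" for \<phi>
  proof -
    have "(\<Sum>i\<in>I. c i * L i \<phi>) - (\<Sum>t\<in>(\<Union>i\<in>I. F i). \<phi> t * h t) =
        (\<Sum>i\<in>I. c i * (L i \<phi> - (\<Sum>t\<in>F i. \<phi> t * g i t)))"
      by (simp add: sum sum_subtractf right_diff_distrib)
    also have "norm \<dots> \<le> (\<Sum>i\<in>I. norm (c i) * (e / R * Md_norm d G \<phi>))"
      by (rule sum_norm_le) (simp only: norm_mult, intro mult_left_mono g \<phi> norm_ge_zero)
    also have "\<dots> = e / R * (R - 1) * Md_norm d G \<phi>"
    proof -
      have "R - 1 = (\<Sum>i\<in>I. norm (c i))" by (simp add: R_def)
      then show ?thesis by (simp add: sum_distrib_left sum_distrib_right mult_ac)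
    qed
    also have "\<dots> \<le> e * Md_norm d G \<phi>"
      using e R norm_nonneg[OF \<phi>] by (intro mult_right_mono) (simp_all add: field_simps)
    finally show ?thesis .
  qed
  then show "\<exists>F g. finite F \<and> F \<subseteq> carrier G \<and>
      (\<forall>\<phi>\<in>Md d G. norm ((\<Sum>i\<in>I. c i * L i \<phi>) - (\<Sum>t\<in>F. \<phi> t * g t)) \<le> e * Md_norm d G \<phi>)"
    using U by blast
qed

end

section \<open>Pullbacks, and the approximation property in terms of functionals\<close>

context multipliers
begin

text \<open>Boundedness carries over the error estimate, and \<open>eval\<close> ensures that a
  combination of evaluations on \<open>G\<close> pulls back to one on \<open>K\<close>.\<close>

lemma normal_pullback:
  fixes \<Phi> :: "('k \<Rightarrow> complex) \<Rightarrow> 'a \<Rightarrow> complex" and K :: "('k, 'e) monoid_scheme"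
  assumes L: "normal_functional d G L" and C: "0 \<le> C"
    and \<Phi>: "\<And>\<phi>. \<phi> \<in> Md d K \<Longrightarrow> \<Phi> \<phi> \<in> Md d G" "\<And>\<phi>. \<phi> \<in> Md d K \<Longrightarrow> Md_norm d G (\<Phi> \<phi>) \<le> C * Md_norm d K \<phi>"
    and eval: "\<And>t. t \<in> carrier G \<Longrightarrow> \<exists>a. \<exists>k\<in>carrier K. \<forall>\<phi>\<in>Md d K. \<Phi> \<phi> t = \<phi> k * a"
    and K: "multipliers d K"
  shows "normal_functional d K (\<lambda>\<phi>. L (\<Phi> \<phi>))"
  unfolding normal_functional_def
proof (intro allI impI)
  interpret K: multipliers d K by fact
  fix e :: real assume e: "e > 0"
  have "\<forall>t. \<exists>a k. t \<in> carrier G \<longrightarrow> k \<in> carrier K \<and> (\<forall>\<phi>\<in>Md d K. \<Phi> \<phi> t = \<phi> k * a)"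
    using eval by blast
  then obtain a k where ak: "\<And>t. t \<in> carrier G \<Longrightarrow> k t \<in> carrier K"
      "\<And>t \<phi>. t \<in> carrier G \<Longrightarrow> \<phi> \<in> Md d K \<Longrightarrow> \<Phi> \<phi> t = \<phi> (k t) * a t" by metis
  \<comment> \<open>The denominator \<open>C + 1\<close> also covers \<open>C = 0\<close>.\<close>
  have "e / (C + 1) > 0" using e C by simp
  then obtain F g where F: "finite F" "F \<subseteq> carrier G"
    and g: "\<And>\<phi>. \<phi> \<in> Md d G \<Longrightarrow> norm (L \<phi> - (\<Sum>t\<in>F. \<phi> t * g t)) \<le> e / (C + 1) * Md_norm d G \<phi>"
    using L unfolding normal_functional_def by metis
  have "norm (L (\<Phi> \<phi>) - (\<Sum>s\<in>k ` F. \<phi> s * (\<Sum>t\<in>{t \<in> F. k t = s}. a t * g t))) \<le> e * Md_norm d K \<phi>"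
    if \<phi>: "\<phi> \<in> Md d K" for \<phi>
  proof -
    have "(\<Sum>t\<in>F. \<Phi> \<phi> t * g t) = (\<Sum>t\<in>F. \<phi> (k t) * a t * g t)"
      using F(2) ak(2)[OF _ \<phi>] by (intro sum.cong) auto
    \<comment> \<open>Several points of \<open>F\<close> may be evaluated at the same point of
      \<open>K\<close>, so the weights are added over the fibres of \<open>k\<close>.\<close>
    also have "\<dots> = (\<Sum>s\<in>k ` F. \<Sum>t\<in>{t \<in> F. k t = s}. \<phi> (k t) * a t * g t)"
      by (rule sum.image_gen[OF F(1)])
    also have "\<dots> = (\<Sum>s\<in>k ` F. \<phi> s * (\<Sum>t\<in>{t \<in> F. k t = s}. a t * g t))"
      by (intro sum.cong refl) (simp add: sum_distrib_left mult.assoc)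
    finally have "norm (L (\<Phi> \<phi>) - (\<Sum>s\<in>k ` F. \<phi> s * (\<Sum>t\<in>{t \<in> F. k t = s}. a t * g t)))
        \<le> e / (C + 1) * Md_norm d G (\<Phi> \<phi>)"
      using g[OF \<Phi>(1)[OF \<phi>]] by simp
    also have "\<dots> \<le> e / (C + 1) * (C * Md_norm d K \<phi>)"
      using e C by (intro mult_left_mono \<Phi>(2)[OF \<phi>]) simp
    also have "\<dots> = e * Md_norm d K \<phi> * (C / (C + 1))" by simp
    also have "\<dots> \<le> e * Md_norm d K \<phi> * 1"
      using e C K.norm_nonneg[OF \<phi>] by (intro mult_left_mono) simp_all
    finally show ?thesis by simp
  qed
  then show "\<exists>F g. finite F \<and> F \<subseteq> carrier K \<and>
      (\<forall>\<phi>\<in>Md d K. norm (L (\<Phi> \<phi>) - (\<Sum>t\<in>F. \<phi> t * g t)) \<le> e * Md_norm d K \<phi>)"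
    using F ak(1) by (intro exI[of _ "k ` F"] exI[of _ "\<lambda>s. \<Sum>t\<in>{t \<in> F. k t = s}. a t * g t"]) auto
qed

lemma Md_AP_iff:
  "Md_AP d G \<longleftrightarrow> (\<forall>L. normal_functional d G L \<longrightarrow> (\<forall>t\<in>carrier G. L (delta G t) = 0) \<longrightarrow> L (\<lambda>t\<in>carrier G. 1) = 0)"
    (is "_ \<longleftrightarrow> ?R")
proof
  let ?one = "\<lambda>t\<in>carrier G. 1 :: complex"
  let ?h = "\<lambda>\<phi>. \<lambda>x\<in>Xd d G. Xd_pairing G \<phi> x"
  let ?P = "product_topology (\<lambda>_. euclidean :: complex topology) (Xd d G)"
  assume AP: "Md_AP d G"
  show ?R
  proof (intro allI impI)
    fix L assume L: "normal_functional d G L" and zero: "\<forall>t\<in>carrier G. L (delta G t) = 0"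
    obtain x where x: "x \<in> Xd d G" and xL: "\<forall>\<phi>\<in>Md d G. Xd_pairing G \<phi> x = L \<phi>"
      using normal_functional_is_pairing[OF L] by (rule bexE)
    \<comment> \<open>The ball around \<open>L ?one\<close> has 0 on its boundary, hence outside it,
      while \<open>L\<close> is 0 at every finitely supported function.\<close>
    define U where "U = {h \<in> topspace ?P. h x \<in> ball (L ?one) (norm (L ?one))}"
    have "openin ?P U"
      unfolding U_def using x
      by (intro openin_continuous_map_preimage[of _ euclidean]) (auto intro: continuous_map_product_projection)
    then have op: "openin (Md_weak_star d G) (?h -` U \<inter> Md d G)"
      unfolding Md_weak_star_def openin_pullback_topology by blast
    show "L ?one = 0"
    proof (rule ccontr)
      assume "L ?one \<noteq> 0"
      then have "?one \<in> ?h -` U \<inter> Md d G" using x one_Md by (simp add: U_def xL[rule_format])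
      then have "\<exists>f. f \<in> finsupp_fun G \<and> f \<in> ?h -` U \<inter> Md d G"
        using AP[unfolded Md_AP_def in_closure_of, THEN conjunct2, rule_format, OF conjI, OF _ op] by simp
      then obtain f where f: "f \<in> finsupp_fun G" "f \<in> ?h -` U" by (elim exE conjE IntE)
      have "L f = 0" using normal_finsupp[OF L f(1)] zero by simp
      moreover have "L f \<in> ball (L ?one) (norm (L ?one))"
        using f x by (simp add: U_def xL[rule_format, OF finsupp_Md])
      ultimately show False by (simp add: dist_norm)
    qed
  qed
next
  let ?one = "\<lambda>t\<in>carrier G. 1 :: complex"
  let ?h = "\<lambda>\<phi>. \<lambda>x\<in>Xd d G. Xd_pairing G \<phi> x"
  let ?P = "product_topology (\<lambda>_. euclidean :: complex topology) (Xd d G)"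
  assume R: ?R
  show "Md_AP d G"
    unfolding Md_AP_def in_closure_of
  proof (intro conjI allI impI)
    show "?one \<in> topspace (Md_weak_star d G)"
      using one_Md by (simp add: Md_weak_star_def topspace_pullback_topology)
    fix T assume T: "?one \<in> T \<and> openin (Md_weak_star d G) T"
    then obtain V where V: "openin ?P V" "T = ?h -` V \<inter> Md d G"
      unfolding Md_weak_star_def openin_pullback_topology by blast
    then have one: "?h ?one \<in> V" using T by simp
    have "\<exists>U. finite {x \<in> Xd d G. U x \<noteq> topspace euclidean} \<and> (\<forall>x\<in>Xd d G. openin euclidean (U x)) \<and>
        ?h ?one \<in> Pi\<^sub>E (Xd d G) U \<and> Pi\<^sub>E (Xd d G) U \<subseteq> V"
      using V(1) unfolding openin_product_topology_alt by (rule bspec[OF _ one])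
    then obtain U where U: "finite {x \<in> Xd d G. U x \<noteq> (UNIV :: complex set)}"
        "?h ?one \<in> Pi\<^sub>E (Xd d G) U" "Pi\<^sub>E (Xd d G) U \<subseteq> V"
      unfolding topspace_euclidean by blast
    \<comment> \<open>Only these finitely many coordinates of the basic neighbourhood are
      restricted; \<open>?w\<close> sets all others to 0.\<close>
    let ?I = "{x \<in> Xd d G. U x \<noteq> UNIV}"
    let ?w = "\<lambda>f x. if x \<in> ?I then Xd_pairing G f x else 0"
    let ?W = "?w ` finsupp_fun G"
    have normal: "normal_functional d G (\<lambda>\<phi>. Xd_pairing G \<phi> x)" if "x \<in> ?I" for x
      using that by (intro normal_pairing) simp
    have "\<exists>w\<in>?W. \<forall>x\<in>?I. w x = Xd_pairing G ?one x"
    proof (rule finite_dim_separation[OF U(1)])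
      show "?W \<noteq> {}" by (auto simp: finsupp_fun_def intro: exI[of _ "\<lambda>t\<in>carrier G. 0"])
      fix w w' a assume "w \<in> ?W" "w' \<in> ?W"
      then obtain f f' where f: "f \<in> finsupp_fun G" "f' \<in> finsupp_fun G"
        and w: "w = ?w f" "w' = ?w f'" by blast
      let ?f = "\<lambda>t\<in>carrier G. f t + a * f' t"
      have "{t \<in> carrier G. ?f t \<noteq> 0} \<subseteq> {t \<in> carrier G. f t \<noteq> 0} \<union> {t \<in> carrier G. f' t \<noteq> 0}" by auto
      then have "finite {t \<in> carrier G. ?f t \<noteq> 0}"
        by (rule finite_subset) (use f in \<open>simp add: finsupp_fun_def\<close>)
      then have ff: "?f \<in> finsupp_fun G" unfolding finsupp_fun_def by simp
      have "Xd_pairing G ?f x = Xd_pairing G f x + a * Xd_pairing G f' x" if "x \<in> ?I" for x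
        by (rule normal_add[OF normal[OF that]]) (simp_all add: finsupp_Md f ff)
      then have "(\<lambda>x. w x + a * w' x) = ?w ?f" by (auto simp: w)
      then show "(\<lambda>x. w x + a * w' x) \<in> ?W" using ff by blast
    next
      fix c assume c: "\<And>w. w \<in> ?W \<Longrightarrow> (\<Sum>x\<in>?I. c x * w x) = 0"
      have "(\<Sum>x\<in>?I. c x * Xd_pairing G (delta G t) x) = 0" if "t \<in> carrier G" for t
      proof -
        have "delta G t \<in> finsupp_fun G"
          by (auto simp: finsupp_fun_def delta_def intro: finite_subset[of _ "{t}"])
        then have "(\<Sum>x\<in>?I. c x * ?w (delta G t) x) = 0" by (intro c imageI)
        moreover have "(\<Sum>x\<in>?I. c x * ?w (delta G t) x) = (\<Sum>x\<in>?I. c x * Xd_pairing G (delta G t) x)"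
          by (rule sum.cong) simp_all
        ultimately show ?thesis by simp
      qed
      \<comment> \<open>A functional annihilating \<open>?W\<close> is a combination of pairings, so
        it is normal and kills all point masses. The assumption then says that it kills the constant
        1 as well.\<close>
      then show "(\<Sum>x\<in>?I. c x * Xd_pairing G ?one x) = 0"
        using R[rule_format, OF normal_sum[OF U(1) normal, where c = c]] by simp
    qed
    then obtain f where f: "f \<in> finsupp_fun G" "\<And>x. x \<in> ?I \<Longrightarrow> Xd_pairing G f x = Xd_pairing G ?one x"
      by auto
    have "?h f \<in> Pi\<^sub>E (Xd d G) U"
    proof (rule PiE_I)
      fix x assume x: "x \<in> Xd d G"
      show "?h f x \<in> U x"
        using f(2)[of x] U(2) x by (cases "U x = UNIV") (auto simp: PiE_iff)
    qed simp
    then show "\<exists>y. y \<in> finsupp_fun G \<and> y \<in> T"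
      using f(1) finsupp_Md U(3) V(2) by blast
  qed
qed

end

lemma (in forest_cocycle) normal_transfer:
  assumes L: "normal_functional d G L" and d: "2 \<le> d" and y0: "y0 \<in> Y" and y1: "y1 \<in> Y"
  shows "normal_functional d K (\<lambda>\<phi>. L (transfer y0 y1 \<phi>))"
proof -
  interpret multipliers d G using d G by (rule multipliers.intro)
  show ?thesis
  proof (rule normal_pullback[OF L _ transfer[OF _ d y0 y1]])
    show "multipliers d K" using d K by (rule multipliers.intro)
    show "\<exists>a. \<exists>k\<in>carrier K. \<forall>\<phi>\<in>Md d K. transfer y0 y1 \<phi> t = \<phi> k * a" if "t \<in> carrier G" for t
      using that c_closed[OF that y0]
      by (intro exI[of _ "if \<exists>n. (p ^^ n) (act t y0) = y1 then 1 else 0"] bexI[of _ "c t y0"])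
        (auto simp: transfer_def)
  qed simp
qed


section \<open>Group extensions\<close>

text \<open>\<open>c\<close> is a cocycle over the translation action of \<open>E\<close> on
  \<open>Q\<close>, such as a section of the quotient map provides. Instead of exactness, the
  hypothesis \<open>inj\<close> says that the coset and the value of the cocycle determine the
  element.\<close>

lemma Md_AP_extension:
  fixes E :: "('e, 'm) monoid_scheme" and Q :: "('q, 'n) monoid_scheme" and K :: "('k, 'r) monoid_scheme"
  assumes d: "2 \<le> d" and E: "group E" and Q: "group Q" and K: "group K" and \<pi>: "\<pi> \<in> hom E Q"
    and c_closed: "\<And>g q. g \<in> carrier E \<Longrightarrow> q \<in> carrier Q \<Longrightarrow> c g q \<in> carrier K"
    and c_mult: "\<And>g h q. g \<in> carrier E \<Longrightarrow> h \<in> carrier E \<Longrightarrow> q \<in> carrier Q \<Longrightarrow>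
      c (g \<otimes>\<^bsub>E\<^esub> h) q = c g (\<pi> h \<otimes>\<^bsub>Q\<^esub> q) \<otimes>\<^bsub>K\<^esub> c h q"
    and inj: "inj_on (\<lambda>g. (\<pi> g, c g \<one>\<^bsub>Q\<^esub>)) (carrier E)"
    and AP: "Md_AP d Q" "Md_AP d K"
  shows "Md_AP d E"
proof -
  interpret E: multipliers d E using d E by (rule multipliers.intro)
  interpret Q: multipliers d Q using d Q by (rule multipliers.intro)
  interpret K: multipliers d K using d K by (rule multipliers.intro)
  interpret EG: group E by fact
  interpret QG: group Q by fact
  interpret KG: group K by fact
  have \<pi>c: "\<pi> g \<in> carrier Q" if "g \<in> carrier E" for g using \<pi> that by (auto simp: hom_def)
  have \<pi>1: "\<pi> \<one>\<^bsub>E\<^esub> = \<one>\<^bsub>Q\<^esub>" by (rule hom_one[OF \<pi> E Q])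
  have \<pi>m: "\<pi> (g \<otimes>\<^bsub>E\<^esub> h) = \<pi> g \<otimes>\<^bsub>Q\<^esub> \<pi> h" if "g \<in> carrier E" "h \<in> carrier E" for g h
    using \<pi> that by (auto simp: hom_def)
  \<comment> \<open>Raising the counter leaves the node set at once, so every node is a root and the
    forest has no edges.\<close>
  let ?p = "\<lambda>(q, n). (q, Suc n)"
  have iter: "(?p ^^ n) (q, i) = (q, n + i)" for n i and q :: 'q by (induction n) auto
  interpret T: forest_cocycle E K "carrier Q \<times> {0}" "\<lambda>g (q, n). (\<pi> g \<otimes>\<^bsub>Q\<^esub> q, n)" "\<lambda>g y. c g (fst y)"
    ?p "\<lambda>_. {}" "\<lambda>_. {}" 0
    by (rule forest_cocycle.intro) (auto simp: E K c_closed c_mult \<pi>c \<pi>1 \<pi>m QG.m_assoc)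
  \<comment> \<open>A single node fixed by the action, with the homomorphism \<open>\<pi>\<close> as
    its cocycle: the transfer is inflation from the quotient.\<close>
  interpret S: forest_cocycle E Q "{0}" "\<lambda>g y. y" "\<lambda>g y. \<pi> g" Suc "\<lambda>_. {}" "\<lambda>_. {}" 0
    by (rule forest_cocycle.intro) (auto simp: E Q \<pi>c \<pi>m)
  have T: "T.transfer (\<one>\<^bsub>Q\<^esub>, 0) (q, 0) \<phi> = (\<lambda>g\<in>carrier E. if \<pi> g = q then \<phi> (c g \<one>\<^bsub>Q\<^esub>) else 0)" for q \<phi>
    unfolding T.transfer_def by (auto simp: iter \<pi>c restrict_def fun_eq_iff)
  have funpow_Suc: "(Suc ^^ n) i = n + i" for n i by (induction n) auto
  have S: "S.transfer 0 0 \<phi> = (\<lambda>g\<in>carrier E. \<phi> (\<pi> g))" for \<phi>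
    unfolding S.transfer_def by (auto simp: funpow_Suc restrict_def fun_eq_iff)
  show ?thesis
    unfolding E.Md_AP_iff
  proof (intro allI impI)
    fix L assume L: "normal_functional d E L" and zero: "\<forall>t\<in>carrier E. L (delta E t) = 0"
    have fs: "L f = 0" if "f \<in> finsupp_fun E" for f
      using E.normal_finsupp[OF L that] zero by simp
    have coset: "L (\<lambda>g\<in>carrier E. if \<pi> g = q then 1 else 0) = 0" if q: "q \<in> carrier Q" for q
    proof -
      have nT: "normal_functional d K (\<lambda>\<phi>. L (T.transfer (\<one>\<^bsub>Q\<^esub>, 0) (q, 0) \<phi>))"
        by (rule T.normal_transfer[OF L d]) (use q in auto)
      have "L (T.transfer (\<one>\<^bsub>Q\<^esub>, 0) (q, 0) (delta K k)) = 0" if k: "k \<in> carrier K" for k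
      proof (rule fs)
        let ?f = "T.transfer (\<one>\<^bsub>Q\<^esub>, 0) (q, 0) (delta K k)"
        have sub: "{g \<in> carrier E. ?f g \<noteq> 0} \<subseteq> {g \<in> carrier E. (\<pi> g, c g \<one>\<^bsub>Q\<^esub>) = (q, k)}"
          by (auto simp: T delta_def c_closed)
        have "finite {g \<in> carrier E. (\<pi> g, c g \<one>\<^bsub>Q\<^esub>) = (q, k)}"
          by (rule inj_on_finite[where f = "\<lambda>g. (\<pi> g, c g \<one>\<^bsub>Q\<^esub>)" and B = "{(q, k)}"])
            (auto intro: inj_on_subset[OF inj])
        with sub have "finite {g \<in> carrier E. ?f g \<noteq> 0}" by (rule finite_subset)
        then show "?f \<in> finsupp_fun E" unfolding finsupp_fun_def by (simp add: T.transfer_def)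
      qed
      then have "L (T.transfer (\<one>\<^bsub>Q\<^esub>, 0) (q, 0) (\<lambda>k\<in>carrier K. 1)) = 0"
        using AP(2) nT unfolding K.Md_AP_iff by blast
      moreover have "T.transfer (\<one>\<^bsub>Q\<^esub>, 0) (q, 0) (\<lambda>k\<in>carrier K. 1) = (\<lambda>g\<in>carrier E. if \<pi> g = q then 1 else 0)"
        unfolding T by (auto simp: c_closed)
      ultimately show ?thesis by simp
    qed
    have nS: "normal_functional d Q (\<lambda>\<phi>. L (S.transfer 0 0 \<phi>))"
      by (rule S.normal_transfer[OF L d]) auto
    have "L (S.transfer 0 0 (delta Q q)) = 0" if q: "q \<in> carrier Q" for q
    proof -
      have "S.transfer 0 0 (delta Q q) = (\<lambda>g\<in>carrier E. if \<pi> g = q then 1 else 0)"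
        unfolding S by (auto simp: delta_def \<pi>c)
      then show ?thesis using coset[OF q] by simp
    qed
    then have "L (S.transfer 0 0 (\<lambda>q\<in>carrier Q. 1)) = 0"
      using AP(1) nS unfolding Q.Md_AP_iff by blast
    moreover have "S.transfer 0 0 (\<lambda>q\<in>carrier Q. 1) = (\<lambda>g\<in>carrier E. 1)"
      unfolding S by (auto simp: \<pi>c)
    ultimately show "L (\<lambda>g\<in>carrier E. 1) = 0" by simp
  qed
qed

lemma Md_AP_direct_product:
  assumes "2 \<le> d" "group G1" "group G2" "Md_AP d G1" "Md_AP d G2"
  shows "Md_AP d (G1 \<times>\<times> G2)"
proof (rule Md_AP_extension[OF assms(1) DirProd_group[OF assms(2,3)] assms(2,3)])
  show "fst \<in> hom (G1 \<times>\<times> G2) G1" by (auto simp: hom_def)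
  \<comment> \<open>The pair takes the second projection as the cocycle, constant in the quotient
    variable.\<close>
  show "inj_on (\<lambda>g. (fst g, snd g)) (carrier (G1 \<times>\<times> G2))" by (simp add: inj_on_def)
qed (use assms in \<open>auto simp: DirProd_def\<close>)

lemma Md_AP_semidirect_product:
  fixes G1 :: "('a, 'm) monoid_scheme" and G2 :: "('b, 'n) monoid_scheme"
  assumes d: "2 \<le> d" and G: "group G1" and N: "group G2" and AP: "Md_AP d G1" "Md_AP d G2"
    and \<alpha>: "\<alpha> \<in> hom G1 (AutoGroup G2)"
  shows "Md_AP d (semidirect_product G1 \<alpha> G2)"
proof (rule Md_AP_extension[OF d group_semidirect_product[OF G N \<alpha>] G N])
  let ?E = "semidirect_product G1 \<alpha> G2"
  \<comment> \<open>With the inclusion of \<open>G1\<close> as the section and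
    \<open>g = x s\<close>, this is \<open>(s q)^-1 g q = (s q)^-1 x (s q)\<close>.\<close>
  let ?c = "\<lambda>g q. \<alpha> (inv\<^bsub>G1\<^esub> (fst g \<otimes>\<^bsub>G1\<^esub> q)) (snd g)"
  interpret G: group G1 by fact
  interpret N: group G2 by fact
  have aut: "\<alpha> s \<in> auto G2" if "s \<in> carrier G1" for s
    using \<alpha> that by (auto simp: hom_def AutoGroup_def)
  have cl: "\<alpha> s x \<in> carrier G2" if "s \<in> carrier G1" "x \<in> carrier G2" for s x
    using aut[OF that(1)] that(2) by (auto simp: auto_def hom_def)
  have mu: "\<alpha> s (x \<otimes>\<^bsub>G2\<^esub> y) = \<alpha> s x \<otimes>\<^bsub>G2\<^esub> \<alpha> s y"
    if "s \<in> carrier G1" "x \<in> carrier G2" "y \<in> carrier G2" for s x y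
    using aut[OF that(1)] that(2,3) by (auto simp: auto_def hom_def)
  have comp: "\<alpha> (s \<otimes>\<^bsub>G1\<^esub> t) x = \<alpha> s (\<alpha> t x)"
    if "s \<in> carrier G1" "t \<in> carrier G1" "x \<in> carrier G2" for s t x
    using hom_mult[OF \<alpha> that(1,2)] aut[OF that(1)] aut[OF that(2)] that(3)
    by (auto simp: AutoGroup_def BijGroup_def auto_def compose_def)
  have inj: "inj_on (\<alpha> s) (carrier G2)" if "s \<in> carrier G1" for s
    using aut[OF that] by (auto simp: auto_def Bij_def bij_betw_def)
  show "fst \<in> hom ?E G1" by (auto simp: hom_def semidirect_product_def)
  show "?c g q \<in> carrier G2" if "g \<in> carrier ?E" "q \<in> carrier G1" for g q
    using that by (auto simp: semidirect_product_def cl)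
  show "?c (g \<otimes>\<^bsub>?E\<^esub> h) q = ?c g (fst h \<otimes>\<^bsub>G1\<^esub> q) \<otimes>\<^bsub>G2\<^esub> ?c h q"
    if mem: "g \<in> carrier ?E" "h \<in> carrier ?E" and q: "q \<in> carrier G1" for g h q
  proof -
    obtain s x t y where gh: "g = (s, x)" "h = (t, y)" "s \<in> carrier G1" "t \<in> carrier G1" "x \<in> carrier G2" "y \<in> carrier G2"
      using mem by (cases g; cases h) (auto simp: semidirect_product_def)
    have "inv\<^bsub>G1\<^esub> (s \<otimes>\<^bsub>G1\<^esub> t \<otimes>\<^bsub>G1\<^esub> q) \<otimes>\<^bsub>G1\<^esub> s = inv\<^bsub>G1\<^esub> (t \<otimes>\<^bsub>G1\<^esub> q)"
      using gh q by (simp add: G.inv_mult_group G.m_assoc)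
    then show ?thesis
      using gh q comp[of "inv\<^bsub>G1\<^esub> (s \<otimes>\<^bsub>G1\<^esub> t \<otimes>\<^bsub>G1\<^esub> q)" s y]
      by (simp add: semidirect_product_def mu cl G.m_assoc)
  qed
  show "inj_on (\<lambda>g. (fst g, ?c g \<one>\<^bsub>G1\<^esub>)) (carrier ?E)"
    using inj by (auto simp: inj_on_def semidirect_product_def)
qed (use AP in auto)

section \<open>Words in free products\<close>

text \<open>The letter \<open>Inl\<close> or \<open>Inr\<close> is encoded by the truth value \<^const>\<open>isl\<close>. Words not ending in type
  \<open>j\<close> represent the cosets of the factor of type \<open>j\<close>, and \<open>strip j\<close> picks the representative.\<close>

definition strip :: "bool \<Rightarrow> ('a + 'b) list \<Rightarrow> ('a + 'b) list" where
  "strip j u = (if u \<noteq> [] \<and> isl (last u) = j then butlast u else u)"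

text \<open>The type of the root above the coset of \<open>u\<close> of type \<open>j\<close>. The
  parent of a one-letter word is the root of the type of that letter.\<close>

definition root_type :: "('a + 'b) list \<Rightarrow> bool \<Rightarrow> bool" where
  "root_type u j = (if u = [] then j else isl (hd u))"

locale free_factors =
  fixes A :: "('a, 'm) monoid_scheme" and B :: "('b, 'n) monoid_scheme"
  assumes A: "group A" and B: "group B"
begin

abbreviation F where "F \<equiv> free_product A B"
abbreviation R where "R \<equiv> reduced_words A B"
abbreviation letters where "letters \<equiv> (carrier A - {\<one>\<^bsub>A\<^esub>}) <+> (carrier B - {\<one>\<^bsub>B\<^esub>})"

definition reps :: "bool \<Rightarrow> ('a + 'b) list set" where
  "reps j = {w \<in> R. w = [] \<or> isl (last w) \<noteq> j}"

definition factor :: "bool \<Rightarrow> ('a + 'b) list set" where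
  "factor j = insert [] {[l] | l. l \<in> letters \<and> isl l = j}"

interpretation GA: group A by (rule A)
interpretation GB: group B by (rule B)

lemma group_F: "group F" by (rule group_free_product[OF A B])

interpretation F: group F by (rule group_F)

lemma carrier_F: "carrier F = R" and one_F: "\<one>\<^bsub>F\<^esub> = []"
  and mult_F: "u \<otimes>\<^bsub>F\<^esub> v = foldr (prepend_letter A B) u v"
  by (simp_all add: free_product_def)

lemmas F_closed = F.m_closed[unfolded carrier_F] and F_assoc = F.m_assoc[unfolded carrier_F]
  and F_inv_closed = F.inv_closed[unfolded carrier_F]

lemma Nil_R [simp]: "[] \<in> R" by (simp add: reduced_words_def)

lemma Cons_R: "a # w \<in> R \<longleftrightarrow> a \<in> letters \<and> w \<in> R \<and> (w \<noteq> [] \<longrightarrow> isl a \<noteq> isl (hd w))"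
  by (cases w) (auto simp: reduced_words_def)

lemma append_R: "u @ v \<in> R \<longleftrightarrow> u \<in> R \<and> v \<in> R \<and> (u \<noteq> [] \<and> v \<noteq> [] \<longrightarrow> isl (last u) \<noteq> isl (hd v))"
  by (auto simp: reduced_words_def successively_append_iff)

lemma prepend_Cons: "a # w \<in> R \<Longrightarrow> prepend_letter A B a w = a # w"
  by (cases a; cases w; cases "hd w") (auto simp: Cons_R)

lemma mult_append: "u @ v \<in> R \<Longrightarrow> u \<otimes>\<^bsub>F\<^esub> v = u @ v"
  by (induction u) (simp_all add: mult_F Cons_R prepend_Cons)

lemma mult_Nil [simp]: "u \<in> R \<Longrightarrow> u \<otimes>\<^bsub>F\<^esub> [] = u" "[] \<otimes>\<^bsub>F\<^esub> u = u"
  using mult_append[of u "[]"] by (simp_all add: mult_F)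

lemma strip_reps: "u \<in> R \<Longrightarrow> strip j u \<in> reps j"
proof (cases u rule: rev_cases)
  case (snoc v l)
  then show "u \<in> R \<Longrightarrow> ?thesis" by (auto simp: strip_def reps_def append_R)
qed (simp add: strip_def reps_def)

lemma reps_R: "w \<in> reps j \<Longrightarrow> w \<in> R" by (simp add: reps_def)

lemma strip_R: "u \<in> R \<Longrightarrow> strip j u \<in> R" using strip_reps reps_R by blast

lemma strip_reps_id: "w \<in> reps j \<Longrightarrow> strip j w = w" by (auto simp: strip_def reps_def)

lemma factor_R: "k \<in> factor j \<Longrightarrow> k \<in> R" by (auto simp: factor_def Cons_R)

lemma reps_append: "w \<in> reps j \<Longrightarrow> k \<in> factor j \<Longrightarrow> w @ k \<in> R"
  by (auto simp: reps_def factor_def append_R Cons_R)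

lemma strip_append: "w \<in> reps j \<Longrightarrow> k \<in> factor j \<Longrightarrow> strip j (w @ k) = w"
  by (auto simp: reps_def factor_def strip_def)

lemma factor_closed: "k \<in> factor j \<Longrightarrow> k' \<in> factor j \<Longrightarrow> k \<otimes>\<^bsub>F\<^esub> k' \<in> factor j"
  by (auto simp: factor_def mult_F split: if_splits)

lemma strip_decomp: "u \<in> R \<Longrightarrow> \<exists>k\<in>factor j. u = strip j u @ k"
proof (cases u rule: rev_cases)
  case (snoc v l)
  then show "u \<in> R \<Longrightarrow> ?thesis" by (auto simp: strip_def factor_def append_R Cons_R)
qed (simp add: strip_def factor_def)

lemma mult_factor: "u \<in> R \<Longrightarrow> k \<in> factor j \<Longrightarrow> \<exists>k'\<in>factor j. u \<otimes>\<^bsub>F\<^esub> k = strip j u @ k'"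
proof -
  assume u: "u \<in> R" and k: "k \<in> factor j"
  obtain k0 where k0: "k0 \<in> factor j" "u = strip j u @ k0" using strip_decomp[OF u] by blast
  note s = strip_reps[OF u, of j]
  have "u \<otimes>\<^bsub>F\<^esub> k = strip j u \<otimes>\<^bsub>F\<^esub> k0 \<otimes>\<^bsub>F\<^esub> k"
    using k0(2) mult_append[OF reps_append[OF s k0(1)]] by simp
  also have "\<dots> = strip j u \<otimes>\<^bsub>F\<^esub> (k0 \<otimes>\<^bsub>F\<^esub> k)"
    using s k k0(1) by (simp add: F_assoc reps_R factor_R)
  also have "\<dots> = strip j u @ (k0 \<otimes>\<^bsub>F\<^esub> k)"
    by (rule mult_append[OF reps_append[OF s factor_closed[OF k0(1) k]]])
  finally show ?thesis using factor_closed[OF k0(1) k] by blast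
qed

lemma strip_mult: "u \<in> R \<Longrightarrow> k \<in> factor j \<Longrightarrow> strip j (u \<otimes>\<^bsub>F\<^esub> k) = strip j u"
  using mult_factor[of u k j] strip_append[OF strip_reps] by force

lemma strip_decomp_mult: assumes "u \<in> R" obtains k where "k \<in> factor j" "u = strip j u \<otimes>\<^bsub>F\<^esub> k"
  using strip_decomp[OF assms, of j] mult_append reps_append[OF strip_reps[OF assms]] by metis

text \<open>Makes left multiplication well defined on coset representatives.\<close>

lemma strip_mult_strip:
  assumes "s \<in> R" "u \<in> R" shows "strip j (s \<otimes>\<^bsub>F\<^esub> strip j u) = strip j (s \<otimes>\<^bsub>F\<^esub> u)"
proof -
  obtain k where k: "k \<in> factor j" "u = strip j u \<otimes>\<^bsub>F\<^esub> k" using strip_decomp_mult[OF assms(2)] .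
  then have "s \<otimes>\<^bsub>F\<^esub> u = s \<otimes>\<^bsub>F\<^esub> strip j u \<otimes>\<^bsub>F\<^esub> k"
    using assms strip_R factor_R F_assoc by metis
  then show ?thesis using strip_mult[OF F_closed[OF assms(1) strip_R[OF assms(2)]] k(1)] by simp
qed

text \<open>An explicit list for the inverse, so that prefixes of an inverse can be compared letter
  by letter.\<close>

definition word_inv :: "('a + 'b) list \<Rightarrow> ('a + 'b) list" where
  "word_inv u = rev (map (map_sum (m_inv A) (m_inv B)) u)"

lemma inv_F: assumes "u \<in> R" shows "word_inv u \<in> R" "inv\<^bsub>F\<^esub> u = word_inv u"
proof -
  have "word_inv u \<in> R \<and> word_inv u \<otimes>\<^bsub>F\<^esub> u = []" using assms
  proof (induction u)
    case (Cons a u)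
    let ?a = "map_sum (m_inv A) (m_inv B) a"
    have a: "?a \<in> letters" "isl ?a = isl a" using Cons.prems by (auto simp: Cons_R isl_map_sum)
    have "isl (last (word_inv u)) = isl (hd u)" if "u \<noteq> []"
      using that by (simp add: word_inv_def last_rev hd_map isl_map_sum)
    moreover have "word_inv u = [] \<longleftrightarrow> u = []" by (simp add: word_inv_def)
    moreover have u: "u \<in> R" "word_inv u \<in> R" using Cons by (auto simp: Cons_R)
    ultimately have "word_inv u @ [?a] \<in> R" using a Cons.prems by (auto simp: append_R Cons_R)
    moreover have "word_inv (a # u) = word_inv u @ [?a]" by (simp add: word_inv_def)
    moreover have "prepend_letter A B ?a (a # u) = u" using Cons.prems by (cases a) (auto simp: Cons_R)
    ultimately show ?case using Cons u by (simp add: mult_F)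
  qed (simp add: word_inv_def)
  then show *: "word_inv u \<in> R" and "inv\<^bsub>F\<^esub> u = word_inv u"
    using F.inv_equality[of "word_inv u" u] assms by (auto simp: carrier_F one_F)
qed

lemma word_inv_append: "word_inv (u @ v) = word_inv v @ word_inv u"
  by (simp add: word_inv_def)

lemma word_inv_word_inv: "u \<in> R \<Longrightarrow> word_inv (word_inv u) = u"
  using inv_F F.inv_inv[unfolded carrier_F] by metis

lemma mult_word_inv: "u \<in> R \<Longrightarrow> u \<otimes>\<^bsub>F\<^esub> word_inv u = []"
  using F.r_inv[unfolded carrier_F one_F] inv_F by metis

text \<open>Either \<open>t\<close> cancels the whole word, which is then a prefix of the inverse of
  \<open>t\<close>, or a letter of the type of \<open>l\<close> survives at the end, possibly after
  merging. In the second case removing the last letter commutes with \<open>t\<close> up to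
  \<open>strip\<close>, which is the compatibility with parents.\<close>

lemma mult_snoc_cases:
  assumes t: "t \<in> R" and w: "w @ [l] \<in> R"
  shows "(\<exists>v. word_inv t = (w @ [l]) @ v) \<or>
    (\<exists>l'. isl l' = isl l \<and> t \<otimes>\<^bsub>F\<^esub> (w @ [l]) = strip (isl l) (t \<otimes>\<^bsub>F\<^esub> w) @ [l'])"
proof -
  let ?a = "t \<otimes>\<^bsub>F\<^esub> w"
  have wR: "w \<in> R" and l: "l \<in> letters" using w by (auto simp: append_R Cons_R)
  then have lf: "[l] \<in> factor (isl l)" by (auto simp: factor_def)
  have aR: "?a \<in> R" using t wR by (rule F_closed)
  have "t \<otimes>\<^bsub>F\<^esub> (w @ [l]) = ?a \<otimes>\<^bsub>F\<^esub> [l]"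
    using mult_append[OF w] F_assoc[OF t wR factor_R[OF lf]] by simp
  then obtain k where k: "k \<in> factor (isl l)" "t \<otimes>\<^bsub>F\<^esub> (w @ [l]) = strip (isl l) ?a @ k"
    and ka: "?a \<otimes>\<^bsub>F\<^esub> [l] = strip (isl l) ?a @ k"
    using mult_factor[OF aR lf] by auto
  show ?thesis
  proof (cases "k = []")
    case False
    then show ?thesis using k by (auto simp: factor_def)
  next
    \<comment> \<open>The last letter disappears, so \<open>t w\<close> ends in the inverse of
      \<open>l\<close>. Hence \<open>t\<close> is the product of \<open>?s\<close>, that inverse and
      the inverse of \<open>w\<close>, already in reduced form.\<close>
    case True
    let ?s = "strip (isl l) ?a"
    let ?l = "word_inv [l]"
    have lR: "[l] \<in> R" using lf by (rule factor_R)
    have liR: "?l \<in> R" using inv_F[OF lR] by simp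
    have lif: "?l \<in> factor (isl l)" using liR by (auto simp: word_inv_def factor_def Cons_R isl_map_sum)
    have "?a = ?a \<otimes>\<^bsub>F\<^esub> ([l] \<otimes>\<^bsub>F\<^esub> ?l)" using mult_word_inv[OF lR] aR by simp
    also have "\<dots> = ?s \<otimes>\<^bsub>F\<^esub> ?l"
      using F_assoc[OF aR lR liR] ka True by simp
    also have "\<dots> = ?s @ ?l" by (rule mult_append[OF reps_append[OF strip_reps[OF aR] lif]])
    finally have a: "?a = ?s @ ?l" .
    have wl: "word_inv (w @ [l]) = ?l @ word_inv w" by (rule word_inv_append)
    have wlR: "?l @ word_inv w \<in> R" using inv_F(1)[OF w] by (simp add: wl)
    have "?s @ ?l @ word_inv w \<in> R"
      using a aR wlR append_R[of ?s "?l @ word_inv w"] append_R[of ?s ?l] by (auto simp: word_inv_def)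
    then have "(?s @ ?l) \<otimes>\<^bsub>F\<^esub> word_inv w = (?s @ ?l) @ word_inv w" by (intro mult_append) simp
    moreover have "(?s @ ?l) \<otimes>\<^bsub>F\<^esub> word_inv w = t"
      using F_assoc[OF t wR inv_F(1)[OF wR]] mult_word_inv[OF wR] t by (simp flip: a)
    ultimately have "t = ?s @ (?l @ word_inv w)" by simp
    then have "word_inv t = word_inv (?l @ word_inv w) @ word_inv ?s"
      by (metis word_inv_append)
    also have "word_inv (?l @ word_inv w) = w @ [l]" using word_inv_word_inv[OF w] by (simp add: wl)
    finally show ?thesis by blast
  qed
qed

lemma prefix_cancel:
  assumes t: "t \<in> R" and v: "word_inv t = w @ v"
  shows "t = word_inv v @ word_inv w" "t \<otimes>\<^bsub>F\<^esub> w = word_inv v" "word_inv v \<in> R" "w \<in> R"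
proof -
  have wv: "w @ v \<in> R" using inv_F(1)[OF t] v by simp
  then have R: "w \<in> R" "v \<in> R" by (auto simp: append_R)
  show eq: "t = word_inv v @ word_inv w" using word_inv_word_inv[OF t] v by (simp add: word_inv_append)
  show vR: "word_inv v \<in> R" "w \<in> R" using inv_F R by auto
  have "t = word_inv v \<otimes>\<^bsub>F\<^esub> word_inv w" using mult_append[of "word_inv v" "word_inv w"] eq t by simp
  then have "t \<otimes>\<^bsub>F\<^esub> w = word_inv v \<otimes>\<^bsub>F\<^esub> (word_inv w \<otimes>\<^bsub>F\<^esub> w)"
    using F_assoc[OF vR(1) inv_F(1)[OF R(1)] R(1)] by simp
  also have "word_inv w \<otimes>\<^bsub>F\<^esub> w = []" using F.l_inv[unfolded carrier_F one_F] inv_F R by metis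
  finally show "t \<otimes>\<^bsub>F\<^esub> w = word_inv v" using vR by simp
qed


section \<open>The coset forest of a free product\<close>

text \<open>The node \<open>(w, j, k)\<close> is the coset of \<open>w\<close> modulo the factor of type \<open>j\<close>, a vertex of the
  Bass--Serre tree, rooted at the edge between the two factors. The counter \<open>k \<le> m\<close> records the
  height above the node at which a chain of ancestors starts.\<close>

definition nodes :: "nat \<Rightarrow> (('a + 'b) list \<times> bool \<times> nat) set" where
  "nodes m = {(w, j, k). w \<in> reps j \<and> k \<le> m}"

text \<open>\<open>([], j, Suc m)\<close> is a dummy outside the nodes. As each step raises the
  counter, chains stop after \<open>m + 1\<close> nodes however long the word is.\<close>

definition parent :: "nat \<Rightarrow> ('a + 'b) list \<times> bool \<times> nat \<Rightarrow> ('a + 'b) list \<times> bool \<times> nat" where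
  "parent m = (\<lambda>(w, j, k). if w \<in> reps j \<and> w \<noteq> [] \<and> k < m then (butlast w, isl (last w), Suc k) else ([], j, Suc m))"

definition node_act :: "('a + 'b) list \<Rightarrow> ('a + 'b) list \<times> bool \<times> nat \<Rightarrow> ('a + 'b) list \<times> bool \<times> nat" where
  "node_act t = (\<lambda>(w, j, k). (strip j (t \<otimes>\<^bsub>F\<^esub> w), j, k))"

text \<open>The geodesic from the root edge towards \<open>t\<close>, at all heights. It does not
  branch because \<open>t\<close> has one prefix of each length.\<close>

definition initial_nodes :: "nat \<Rightarrow> ('a + 'b) list \<Rightarrow> (('a + 'b) list \<times> bool \<times> nat) set" where
  "initial_nodes m t = {(w, j, k) \<in> nodes m. \<exists>v. t = w @ v}"

text \<open>The cocycle of the induced representation for the section \<open>strip\<close>, kept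
  only at starting nodes. It has to be constant along parents off the geodesic, and a parent always
  has a positive counter.\<close>

definition coset_cocycle :: "bool \<Rightarrow> (('a + 'b) list \<Rightarrow> 'k) \<Rightarrow> ('k, 'r) monoid_scheme \<Rightarrow>
    ('a + 'b) list \<Rightarrow> ('a + 'b) list \<times> bool \<times> nat \<Rightarrow> 'k" where
  "coset_cocycle j0 \<epsilon> K t = (\<lambda>(w, j, k). if j = j0 \<and> k = 0
     then \<epsilon> (inv\<^bsub>F\<^esub> (strip j (t \<otimes>\<^bsub>F\<^esub> w)) \<otimes>\<^bsub>F\<^esub> (t \<otimes>\<^bsub>F\<^esub> w)) else \<one>\<^bsub>K\<^esub>)"

lemma node_act_closed: "t \<in> R \<Longrightarrow> y \<in> nodes m \<Longrightarrow> node_act t y \<in> nodes m"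
  by (auto simp: nodes_def node_act_def intro: strip_reps F_closed reps_R)

lemma node_act_one: "y \<in> nodes m \<Longrightarrow> node_act [] y = y"
  by (auto simp: nodes_def node_act_def strip_reps_id)

lemma node_act_mult:
  assumes "s \<in> R" "t \<in> R" "y \<in> nodes m"
  shows "node_act (s \<otimes>\<^bsub>F\<^esub> t) y = node_act s (node_act t y)"
  using assms by (auto simp: nodes_def node_act_def F_assoc strip_mult_strip reps_R F_closed)

lemma parent_in_nodes: "parent m (w, j, k) \<in> nodes m \<longleftrightarrow> w \<in> reps j \<and> w \<noteq> [] \<and> k < m"
proof (cases w rule: rev_cases)
  case (snoc v l)
  have "v \<in> reps (isl l)" if "v @ [l] \<in> reps j"
    using that by (auto simp: reps_def append_R)
  then show ?thesis by (auto simp: snoc parent_def nodes_def)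
qed (auto simp: parent_def nodes_def)

lemma parent_out: "y \<notin> nodes m \<Longrightarrow> parent m y \<notin> nodes m"
  by (cases y) (auto simp: parent_in_nodes, auto simp: nodes_def)

lemma parent_snoc: "w @ [l] \<in> reps j \<Longrightarrow> k < m \<Longrightarrow> parent m (w @ [l], j, k) = (w, isl l, Suc k)"
  by (simp add: parent_def)

lemma parent_initial:
  assumes "y \<in> initial_nodes m t" "parent m y \<in> nodes m"
  shows "parent m y \<in> initial_nodes m t"
proof -
  obtain w j k v where y: "y = (w, j, k)" "t = w @ v" using assms(1) by (auto simp: initial_nodes_def)
  then obtain w' l where w: "w = w' @ [l]" "w \<in> reps j" "k < m"
    using assms(2) by (cases w rule: rev_cases) (auto simp: parent_in_nodes)
  then show ?thesis using assms(2) y by (auto simp: initial_nodes_def parent_snoc)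
qed

text \<open>Prefixes of \<open>t\<close> of the same length agree, and a nonempty representative
  determines its coset type as the opposite of the type of its last letter.\<close>

lemma parent_inj: "inj_on (parent m) {y \<in> initial_nodes m t. parent m y \<in> nodes m}"
proof
  fix x y assume "x \<in> {y \<in> initial_nodes m t. parent m y \<in> nodes m}" "y \<in> {y \<in> initial_nodes m t. parent m y \<in> nodes m}"
    and eq: "parent m x = parent m y"
  moreover obtain w j k w' j' k' where xy: "x = (w, j, k)" "y = (w', j', k')"
    by (cases x; cases y)
  ultimately have x: "x = (w, j, k)" "\<exists>v. t = w @ v" "w \<in> reps j" "w \<noteq> []" "k < m"
    and y: "y = (w', j', k')" "\<exists>v. t = w' @ v" "w' \<in> reps j'" "w' \<noteq> []" "k' < m"
    by (auto simp: initial_nodes_def parent_in_nodes)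
  have b: "butlast w = butlast w'" "isl (last w) = isl (last w')" "k = k'"
    using eq x y by (auto simp: parent_def)
  have "length w = length w'" using arg_cong[OF b(1), of length] x(4) y(4)
    by (cases w rule: rev_cases; cases w' rule: rev_cases) auto
  then have "w = w'" using x(2) y(2) by auto
  moreover have "j = j'" using x(3,4) y(3,4) b(2) by (auto simp: reps_def)
  ultimately show "x = y" using x y b by simp
qed

lemma parent_iterate_counter:
  "(parent m ^^ n) y \<in> nodes m \<Longrightarrow> n \<le> snd (snd ((parent m ^^ n) y))"
proof (induction n)
  case (Suc n)
  obtain w j k where z: "(parent m ^^ n) y = (w, j, k)" by (metis prod_cases3)
  have "parent m (w, j, k) \<in> nodes m" using Suc.prems z by simp
  then have p: "w \<in> reps j" "w \<noteq> []" "k < m" by (auto simp: parent_in_nodes)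
  then have "(parent m ^^ n) y \<in> nodes m" using z by (simp add: nodes_def)
  then show ?case using Suc.IH z p by (simp add: parent_def)
qed simp

text \<open>A step to the parent removes a letter and raises the counter, so
  \<open>k + length w\<close> is preserved along the chain. Fixing the counter at the root therefore
  fixes the length of the word, which is how spheres arise.\<close>

lemma parent_iterate_root:
  assumes "w \<in> reps j"
  shows "(\<exists>n. (parent m ^^ n) (w, j, k) = ([], i, m)) \<longleftrightarrow> k + length w = m \<and> i = root_type w j"
  using assms
proof (induction w arbitrary: j k rule: rev_induct)
  have out: "(parent m ^^ n) y \<notin> nodes m" if "y \<notin> nodes m" for n y
    using that by (induction n) (simp_all add: parent_out)
  have root: "([], i, m) \<in> nodes m" by (simp add: nodes_def reps_def)
  have step: "(\<exists>n. (parent m ^^ n) y = z) \<longleftrightarrow> y = z \<or> (\<exists>n. (parent m ^^ n) (parent m y) = z)" for y z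
    by (metis funpow_0 funpow_Suc_right comp_apply not0_implies_Suc)
  {
    case Nil
    have "parent m ([], j, k) \<notin> nodes m" by (simp add: parent_in_nodes)
    then have "\<not> (\<exists>n. (parent m ^^ n) (parent m ([], j, k)) = ([], i, m))" using out root by metis
    then show ?case unfolding step[of "([], j, k)"] by (auto simp: root_type_def)
  next
    case (snoc l w)
    then have w: "w \<in> reps (isl l)" by (auto simp: reps_def append_R)
    have rt: "root_type (w @ [l]) j = root_type w (isl l)" by (simp add: root_type_def)
    show ?case
    proof (cases "k < m")
      case True
      then show ?thesis
        unfolding step[of "(w @ [l], j, k)"] parent_snoc[OF snoc.prems True] snoc.IH[OF w] rt by auto
    next
      case False
      then have "parent m (w @ [l], j, k) \<notin> nodes m" by (simp add: parent_in_nodes)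
      then have "\<not> (\<exists>n. (parent m ^^ n) (parent m (w @ [l], j, k)) = ([], i, m))" using out root by metis
      then show ?thesis unfolding step[of "(w @ [l], j, k)"] using False by auto
    qed
  }
qed

lemma coset_element:
  assumes "u \<in> R" shows "inv\<^bsub>F\<^esub> (strip j u) \<otimes>\<^bsub>F\<^esub> u \<in> factor j"
proof -
  obtain k where k: "k \<in> factor j" "u = strip j u \<otimes>\<^bsub>F\<^esub> k" using strip_decomp_mult[OF assms] .
  have "inv\<^bsub>F\<^esub> (strip j u) \<otimes>\<^bsub>F\<^esub> (strip j u \<otimes>\<^bsub>F\<^esub> k) = k"
    using F.l_inv[unfolded carrier_F one_F] strip_R[OF assms] factor_R[OF k(1)]
    by (simp add: F_inv_closed flip: F_assoc)
  then show ?thesis using k by simp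
qed

end

section \<open>Transfer from one factor to the free product\<close>

text \<open>\<open>K\<close> stands for either factor, embedded as the words of at most one letter
  of type \<open>j0\<close>, so both are treated at once.\<close>

locale free_factor = free_factors A B
  for A :: "('a, 'm) monoid_scheme" and B :: "('b, 'n) monoid_scheme" +
  fixes K :: "('k, 'r) monoid_scheme" and \<iota> :: "'k \<Rightarrow> ('a + 'b) list" and j0 :: bool
  assumes K: "group K" and \<iota>_hom: "\<iota> \<in> hom K (free_product A B)" and \<iota>_inj: "inj_on \<iota> (carrier K)"
    and \<iota>_image: "\<iota> ` carrier K = factor j0"
begin

interpretation F: group F by (rule group_F)
interpretation K: group K by (rule K)

definition \<epsilon> :: "('a + 'b) list \<Rightarrow> 'k" where "\<epsilon> = inv_into (carrier K) \<iota>"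

lemma \<epsilon>: "u \<in> factor j0 \<Longrightarrow> \<epsilon> u \<in> carrier K" "u \<in> factor j0 \<Longrightarrow> \<iota> (\<epsilon> u) = u" "k \<in> carrier K \<Longrightarrow> \<epsilon> (\<iota> k) = k"
  using \<iota>_image \<iota>_inj by (auto simp: \<epsilon>_def inv_into_into f_inv_into_f)

lemma \<iota>_factor: "k \<in> carrier K \<Longrightarrow> \<iota> k \<in> factor j0" using \<iota>_image by auto

lemma \<epsilon>_mult: "u \<in> factor j0 \<Longrightarrow> v \<in> factor j0 \<Longrightarrow> \<epsilon> (u \<otimes>\<^bsub>F\<^esub> v) = \<epsilon> u \<otimes>\<^bsub>K\<^esub> \<epsilon> v"
proof -
  assume u: "u \<in> factor j0" and v: "v \<in> factor j0"
  have "\<iota> (\<epsilon> u \<otimes>\<^bsub>K\<^esub> \<epsilon> v) = u \<otimes>\<^bsub>F\<^esub> v"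
    using hom_mult[OF \<iota>_hom \<epsilon>(1)[OF u] \<epsilon>(1)[OF v]] u v by (simp add: \<epsilon>(2))
  then show ?thesis using \<epsilon>(3)[OF K.m_closed[OF \<epsilon>(1)[OF u] \<epsilon>(1)[OF v]]] by simp
qed

lemma \<epsilon>_Nil: "\<epsilon> [] = \<one>\<^bsub>K\<^esub>"
  using \<epsilon>(3)[OF K.one_closed] hom_one[OF \<iota>_hom K group_F] by (simp add: one_F)

lemma coset_cocycle_mult:
  assumes s: "s \<in> R" and t: "t \<in> R" and y: "y \<in> nodes m"
  shows "coset_cocycle j0 \<epsilon> K (s \<otimes>\<^bsub>F\<^esub> t) y = coset_cocycle j0 \<epsilon> K s (node_act t y) \<otimes>\<^bsub>K\<^esub> coset_cocycle j0 \<epsilon> K t y"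
proof -
  obtain w j k where y': "y = (w, j, k)" "w \<in> reps j" using y by (auto simp: nodes_def)
  let ?u = "t \<otimes>\<^bsub>F\<^esub> w"
  have wR: "w \<in> R" and uR: "?u \<in> R" "s \<otimes>\<^bsub>F\<^esub> ?u \<in> R" and sR: "strip j ?u \<in> R" "s \<otimes>\<^bsub>F\<^esub> strip j ?u \<in> R"
    using y' s t by (auto simp: reps_R F_closed strip_R)
  have assoc: "s \<otimes>\<^bsub>F\<^esub> t \<otimes>\<^bsub>F\<^esub> w = s \<otimes>\<^bsub>F\<^esub> ?u" by (rule F_assoc[OF s t wR])
  have st: "strip j (s \<otimes>\<^bsub>F\<^esub> strip j ?u) = strip j (s \<otimes>\<^bsub>F\<^esub> ?u)" by (rule strip_mult_strip[OF s uR(1)])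
  let ?b = "strip j (s \<otimes>\<^bsub>F\<^esub> ?u)"
  have bR: "?b \<in> R" by (rule strip_R[OF uR(2)])
  have "(inv\<^bsub>F\<^esub> ?b \<otimes>\<^bsub>F\<^esub> (s \<otimes>\<^bsub>F\<^esub> strip j ?u)) \<otimes>\<^bsub>F\<^esub> (inv\<^bsub>F\<^esub> (strip j ?u) \<otimes>\<^bsub>F\<^esub> ?u) = inv\<^bsub>F\<^esub> ?b \<otimes>\<^bsub>F\<^esub> (s \<otimes>\<^bsub>F\<^esub> ?u)"
  proof -
    have "strip j ?u \<otimes>\<^bsub>F\<^esub> (inv\<^bsub>F\<^esub> (strip j ?u) \<otimes>\<^bsub>F\<^esub> ?u) = ?u"
      using sR uR F.r_inv[unfolded carrier_F one_F] by (simp add: F_inv_closed flip: F_assoc)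
    then show ?thesis
      using s sR uR bR by (simp add: F_assoc F_inv_closed F_closed)
  qed
  then have \<epsilon>: "\<epsilon> (inv\<^bsub>F\<^esub> ?b \<otimes>\<^bsub>F\<^esub> (s \<otimes>\<^bsub>F\<^esub> ?u)) =
      \<epsilon> (inv\<^bsub>F\<^esub> ?b \<otimes>\<^bsub>F\<^esub> (s \<otimes>\<^bsub>F\<^esub> strip j ?u)) \<otimes>\<^bsub>K\<^esub> \<epsilon> (inv\<^bsub>F\<^esub> (strip j ?u) \<otimes>\<^bsub>F\<^esub> ?u)" if "j = j0"
    using \<epsilon>_mult[of "inv\<^bsub>F\<^esub> ?b \<otimes>\<^bsub>F\<^esub> (s \<otimes>\<^bsub>F\<^esub> strip j ?u)" "inv\<^bsub>F\<^esub> (strip j ?u) \<otimes>\<^bsub>F\<^esub> ?u"]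
      coset_element[OF sR(2), of j, unfolded st] coset_element[OF uR(1), of j] that
    by simp
  show ?thesis
  proof (cases "j = j0 \<and> k = 0")
    case True
    then have "j = j0" by simp
    from \<epsilon>[OF this] show ?thesis
      by (simp only: y' coset_cocycle_def node_act_def prod.case assoc st st[unfolded \<open>j = j0\<close>] True simp_thms if_True)
  next
    case False
    then show ?thesis by (auto simp: y' coset_cocycle_def node_act_def)
  qed
qed

text \<open>The exceptional nodes of \<open>t\<close> lie on the geodesic towards the inverse of
  \<open>t\<close>. They are moved to the geodesic towards \<open>t\<close> itself; for all others
  \<open>mult_snoc_cases\<close> leaves only the surviving letter.\<close>

lemma forest_cocycle_free_product:
  "forest_cocycle F K (nodes m) node_act (coset_cocycle j0 \<epsilon> K) (parent m)
    (\<lambda>t. initial_nodes m (word_inv t)) (initial_nodes m) m"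
proof (rule forest_cocycle.intro)
  show "group F" "group K" by (rule group_F K)+
  fix t assume "t \<in> carrier F"
  then have t: "t \<in> R" by (simp add: carrier_F)
  show "initial_nodes m (word_inv t) \<subseteq> nodes m" "initial_nodes m t \<subseteq> nodes m"
    by (auto simp: initial_nodes_def)
  show "inj_on (parent m) {y \<in> initial_nodes m (word_inv t). parent m y \<in> nodes m}"
    "inj_on (parent m) {y \<in> initial_nodes m t. parent m y \<in> nodes m}" by (rule parent_inj)+
  fix y
  show "parent m y \<in> initial_nodes m (word_inv t)"
    if "y \<in> initial_nodes m (word_inv t)" "parent m y \<in> nodes m" using that by (rule parent_initial)
  show "parent m y \<in> initial_nodes m t"
    if "y \<in> initial_nodes m t" "parent m y \<in> nodes m" using that by (rule parent_initial)
  show "node_act t y \<in> initial_nodes m t" if init: "y \<in> initial_nodes m (word_inv t)"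
  proof -
    obtain w j k v where y: "y = (w, j, k)" "w \<in> reps j" "k \<le> m" "word_inv t = w @ v"
      using init by (auto simp: initial_nodes_def nodes_def)
    note pc = prefix_cancel[OF t y(4)]
    have "\<exists>v'. word_inv v = strip j (word_inv v) @ v'" using strip_decomp[OF pc(3)] by blast
    then have "\<exists>v'. t = strip j (word_inv v) @ v'" using pc(1) by (metis append_assoc)
    then show ?thesis
      using y strip_reps[OF pc(3)] by (simp add: initial_nodes_def nodes_def node_act_def pc(2))
  qed
  assume y: "y \<in> nodes m"
  then obtain w j k where wjk: "y = (w, j, k)" "w \<in> reps j" "k \<le> m" by (auto simp: nodes_def)
  then have wR: "w \<in> R" by (simp add: reps_R)
  show "node_act t y \<in> nodes m"
    by (rule node_act_closed[OF t y])
  show "coset_cocycle j0 \<epsilon> K t y \<in> carrier K"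
    using wjk coset_element[OF F_closed[OF t wR]] by (auto simp: coset_cocycle_def \<epsilon>)
  show "node_act (s \<otimes>\<^bsub>F\<^esub> t) y = node_act s (node_act t y)" if "s \<in> carrier F" for s
    using that t y by (simp add: node_act_mult carrier_F)
  show "coset_cocycle j0 \<epsilon> K (s \<otimes>\<^bsub>F\<^esub> t) y = coset_cocycle j0 \<epsilon> K s (node_act t y) \<otimes>\<^bsub>K\<^esub> coset_cocycle j0 \<epsilon> K t y"
    if "s \<in> carrier F" for s
    using coset_cocycle_mult[OF _ t y] that by (simp add: carrier_F)
  assume off: "y \<notin> initial_nodes m (word_inv t)"
  then have "w \<noteq> []" using y wjk by (auto simp: initial_nodes_def)
  then obtain w' l where w: "w = w' @ [l]" by (cases w rule: rev_cases) auto
  have "\<nexists>v. word_inv t = (w' @ [l]) @ v" using off y wjk w by (auto simp: initial_nodes_def)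
  then obtain l' where l': "isl l' = isl l" "t \<otimes>\<^bsub>F\<^esub> w = strip (isl l) (t \<otimes>\<^bsub>F\<^esub> w') @ [l']"
    using mult_snoc_cases[OF t wR[unfolded w]] w by blast
  have w'R: "w' \<in> R" using wR w by (simp add: append_R)
  have lj: "isl l \<noteq> j" using wjk(2) w by (simp add: reps_def)
  have tw: "t \<otimes>\<^bsub>F\<^esub> w \<in> reps j" using F_closed[OF t wR] l' lj by (simp add: reps_def)
  then have act: "node_act t y = (t \<otimes>\<^bsub>F\<^esub> w, j, k)" by (simp add: wjk node_act_def strip_reps_id)
  show "if parent m y \<in> nodes m
      then parent m (node_act t y) = node_act t (parent m y) \<and> coset_cocycle j0 \<epsilon> K t (parent m y) = coset_cocycle j0 \<epsilon> K t y
      else parent m (node_act t y) \<notin> nodes m"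
  proof (cases "k < m")
    case True
    have "parent m y = (w', isl l, Suc k)" using parent_snoc wjk(2) True w by (simp add: wjk(1))
    moreover have "parent m (node_act t y) = (strip (isl l) (t \<otimes>\<^bsub>F\<^esub> w'), isl l, Suc k)"
      using parent_snoc[of "strip (isl l) (t \<otimes>\<^bsub>F\<^esub> w')" l' j k m] tw l' True by (simp add: act)
    \<comment> \<open>At \<open>y\<close> the word \<open>t w\<close> is already a representative,
      so its coset element is the unit; at the parent the counter is positive.\<close>
    moreover have "coset_cocycle j0 \<epsilon> K t y = \<one>\<^bsub>K\<^esub>"
      unfolding wjk(1) coset_cocycle_def prod.case strip_reps_id[OF tw]
        F.l_inv[unfolded carrier_F one_F, OF reps_R[OF tw]] \<epsilon>_Nil by simp
    moreover have "parent m y \<in> nodes m" using wjk w True by (simp add: parent_in_nodes)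
    ultimately show ?thesis by (simp add: node_act_def coset_cocycle_def)
  next
    case False
    then show ?thesis unfolding act by (simp add: wjk(1) parent_in_nodes)
  qed
next
  show "node_act \<one>\<^bsub>F\<^esub> y = y" if "y \<in> nodes m" for y
    using node_act_one[OF that] by (simp add: one_F)
  show "parent m y \<notin> nodes m" if "y \<notin> nodes m" for y using that by (rule parent_out)
  show "(parent m ^^ Suc m) y \<notin> nodes m" for y
  proof
    assume z: "(parent m ^^ Suc m) y \<in> nodes m"
    have "snd (snd z) \<le> m" if "z \<in> nodes m" for z using that by (auto simp: nodes_def)
    from this[OF z] parent_iterate_counter[OF z] show False by simp
  qed
qed

end

text \<open>The translation by \<open>w0\<close> cannot be avoided, since point masses of a factor
  transfer to translated spheres. The type \<open>i\<close> is present because the transfer pairs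
  with one of the two roots.\<close>

definition (in free_factors) sphere :: "nat \<Rightarrow> bool \<Rightarrow> bool \<Rightarrow> ('a + 'b) list \<Rightarrow> ('a + 'b) list \<Rightarrow> complex" where
  "sphere m j i w0 = (\<lambda>g\<in>carrier F. if g \<otimes>\<^bsub>F\<^esub> w0 \<in> reps j \<and> length (g \<otimes>\<^bsub>F\<^esub> w0) = m \<and>
     i = root_type (g \<otimes>\<^bsub>F\<^esub> w0) j then 1 else 0)"

text \<open>The sphere, enlarged by one optional letter of type \<open>j\<close> at the end.\<close>

definition (in free_factors) coset_sphere :: "nat \<Rightarrow> bool \<Rightarrow> bool \<Rightarrow> ('a + 'b) list \<Rightarrow> ('a + 'b) list \<Rightarrow> complex" where
  "coset_sphere m j i w0 = (\<lambda>g\<in>carrier F. if length (strip j (g \<otimes>\<^bsub>F\<^esub> w0)) = m \<and>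
     i = root_type (strip j (g \<otimes>\<^bsub>F\<^esub> w0)) j then 1 else 0)"

context free_factor
begin

interpretation F: group F by (rule group_F)
interpretation K: group K by (rule K)

interpretation T: forest_cocycle F K "nodes m" node_act "coset_cocycle j0 \<epsilon> K" "parent m"
    "\<lambda>t. initial_nodes m (word_inv t)" "initial_nodes m" m for m
  by (rule forest_cocycle_free_product)

lemma transfer_eq:
  assumes w0: "w0 \<in> R"
  shows "T.transfer m (strip j0 w0, j0, 0) ([], i, m) \<phi> = (\<lambda>g\<in>carrier F.
    if length (strip j0 (g \<otimes>\<^bsub>F\<^esub> w0)) = m \<and> i = root_type (strip j0 (g \<otimes>\<^bsub>F\<^esub> w0)) j0
    then \<phi> (\<epsilon> (inv\<^bsub>F\<^esub> (strip j0 (g \<otimes>\<^bsub>F\<^esub> w0)) \<otimes>\<^bsub>F\<^esub> (g \<otimes>\<^bsub>F\<^esub> strip j0 w0))) else 0)"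
proof -
  have "strip j0 (g \<otimes>\<^bsub>F\<^esub> strip j0 w0) = strip j0 (g \<otimes>\<^bsub>F\<^esub> w0)"
    "strip j0 (g \<otimes>\<^bsub>F\<^esub> w0) \<in> reps j0" if "g \<in> carrier F" for g
    using strip_mult_strip[OF _ w0] strip_reps F_closed[OF _ w0] that by (auto simp: carrier_F)
  then show ?thesis
    unfolding T.transfer_def by (auto simp: node_act_def parent_iterate_root coset_cocycle_def)
qed

lemma transfer_one:
  assumes w0: "w0 \<in> R"
  shows "T.transfer m (strip j0 w0, j0, 0) ([], i, m) (\<lambda>k\<in>carrier K. 1) = coset_sphere m j0 i w0"
proof -
  have "\<epsilon> (inv\<^bsub>F\<^esub> (strip j0 (g \<otimes>\<^bsub>F\<^esub> w0)) \<otimes>\<^bsub>F\<^esub> (g \<otimes>\<^bsub>F\<^esub> strip j0 w0)) \<in> carrier K" if "g \<in> carrier F" for g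
    using coset_element[of "g \<otimes>\<^bsub>F\<^esub> strip j0 w0" j0] strip_mult_strip[OF _ w0, of g j0] that w0
    by (intro \<epsilon>(1)) (simp add: carrier_F F_closed strip_R)
  then show ?thesis unfolding transfer_eq[OF w0] coset_sphere_def by (auto simp: fun_eq_iff)
qed

text \<open>The cocycle takes the value \<open>k\<close> at \<open>g\<close> exactly when
  \<open>g\<close> times the translating word is its own representative. This cuts the coset sphere
  down to a sphere.\<close>

lemma transfer_delta:
  assumes w0: "w0 \<in> R" and k: "k \<in> carrier K"
  shows "T.transfer m (strip j0 w0, j0, 0) ([], i, m) (delta K k) = sphere m j0 i (strip j0 w0 \<otimes>\<^bsub>F\<^esub> inv\<^bsub>F\<^esub> (\<iota> k))"
proof -
  have key: "\<epsilon> (inv\<^bsub>F\<^esub> (strip j0 (g \<otimes>\<^bsub>F\<^esub> w0)) \<otimes>\<^bsub>F\<^esub> (g \<otimes>\<^bsub>F\<^esub> strip j0 w0)) \<in> carrier K"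
    "\<epsilon> (inv\<^bsub>F\<^esub> (strip j0 (g \<otimes>\<^bsub>F\<^esub> w0)) \<otimes>\<^bsub>F\<^esub> (g \<otimes>\<^bsub>F\<^esub> strip j0 w0)) = k \<longleftrightarrow>
      g \<otimes>\<^bsub>F\<^esub> (strip j0 w0 \<otimes>\<^bsub>F\<^esub> inv\<^bsub>F\<^esub> (\<iota> k)) \<in> reps j0"
    "g \<otimes>\<^bsub>F\<^esub> (strip j0 w0 \<otimes>\<^bsub>F\<^esub> inv\<^bsub>F\<^esub> (\<iota> k)) \<in> reps j0 \<Longrightarrow>
      g \<otimes>\<^bsub>F\<^esub> (strip j0 w0 \<otimes>\<^bsub>F\<^esub> inv\<^bsub>F\<^esub> (\<iota> k)) = strip j0 (g \<otimes>\<^bsub>F\<^esub> w0)"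
    if g: "g \<in> carrier F" for g
  proof -
    let ?u = "g \<otimes>\<^bsub>F\<^esub> strip j0 w0" and ?s = "strip j0 (g \<otimes>\<^bsub>F\<^esub> w0)"
    have gR: "g \<in> R" using g by (simp add: carrier_F)
    have uR: "?u \<in> R" using gR w0 by (simp add: F_closed strip_R)
    have su: "strip j0 ?u = ?s" by (rule strip_mult_strip[OF gR w0])
    have sreps: "?s \<in> reps j0" using strip_reps[OF uR, of j0] by (simp only: su)
    have sR: "?s \<in> R" by (rule reps_R[OF sreps])
    have \<iota>k: "\<iota> k \<in> factor j0" "\<iota> k \<in> R" using \<iota>_factor[OF k] factor_R by auto
    have \<iota>ki: "inv\<^bsub>F\<^esub> (\<iota> k) \<in> factor j0"
      using \<iota>_factor[OF K.inv_closed[OF k]] group_hom.hom_inv[of K F \<iota> k] \<iota>_hom K group_F k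
      by (simp add: group_hom_def group_hom_axioms_def)
    have el: "inv\<^bsub>F\<^esub> ?s \<otimes>\<^bsub>F\<^esub> ?u \<in> factor j0" using coset_element[OF uR, of j0] by (simp only: su)
    show "\<epsilon> (inv\<^bsub>F\<^esub> ?s \<otimes>\<^bsub>F\<^esub> ?u) \<in> carrier K" by (rule \<epsilon>(1)[OF el])
    have v: "g \<otimes>\<^bsub>F\<^esub> (strip j0 w0 \<otimes>\<^bsub>F\<^esub> inv\<^bsub>F\<^esub> (\<iota> k)) = ?u \<otimes>\<^bsub>F\<^esub> inv\<^bsub>F\<^esub> (\<iota> k)"
      using gR w0 \<iota>k by (simp add: F_assoc strip_R F_inv_closed)
    have sv: "strip j0 (?u \<otimes>\<^bsub>F\<^esub> inv\<^bsub>F\<^esub> (\<iota> k)) = ?s"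
      using strip_mult[OF uR \<iota>ki] su by simp
    show eq: "g \<otimes>\<^bsub>F\<^esub> (strip j0 w0 \<otimes>\<^bsub>F\<^esub> inv\<^bsub>F\<^esub> (\<iota> k)) = ?s"
      if "g \<otimes>\<^bsub>F\<^esub> (strip j0 w0 \<otimes>\<^bsub>F\<^esub> inv\<^bsub>F\<^esub> (\<iota> k)) \<in> reps j0"
      using strip_reps_id[OF that] unfolding v sv by simp
    have "\<epsilon> (inv\<^bsub>F\<^esub> ?s \<otimes>\<^bsub>F\<^esub> ?u) = k \<longleftrightarrow> inv\<^bsub>F\<^esub> ?s \<otimes>\<^bsub>F\<^esub> ?u = \<iota> k"
      using \<epsilon>(2)[OF el] \<epsilon>(3)[OF k] by auto
    also have "\<dots> \<longleftrightarrow> ?u = ?s \<otimes>\<^bsub>F\<^esub> \<iota> k"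
      using F.inv_solve_left'[of "\<iota> k" ?s ?u] uR sR \<iota>k by (simp add: carrier_F)
    also have "\<dots> \<longleftrightarrow> ?u \<otimes>\<^bsub>F\<^esub> inv\<^bsub>F\<^esub> (\<iota> k) = ?s"
      using F.inv_solve_right'[of ?s ?u "\<iota> k"] uR sR \<iota>k by (simp add: carrier_F)
    also have "\<dots> \<longleftrightarrow> g \<otimes>\<^bsub>F\<^esub> (strip j0 w0 \<otimes>\<^bsub>F\<^esub> inv\<^bsub>F\<^esub> (\<iota> k)) \<in> reps j0"
      using eq sreps v by auto
    finally show "\<epsilon> (inv\<^bsub>F\<^esub> ?s \<otimes>\<^bsub>F\<^esub> ?u) = k \<longleftrightarrow> g \<otimes>\<^bsub>F\<^esub> (strip j0 w0 \<otimes>\<^bsub>F\<^esub> inv\<^bsub>F\<^esub> (\<iota> k)) \<in> reps j0" .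
  qed
  show ?thesis
    unfolding transfer_eq[OF w0] sphere_def
  proof (rule restrict_ext)
    fix g assume g: "g \<in> carrier F"
    let ?s = "strip j0 (g \<otimes>\<^bsub>F\<^esub> w0)" and ?v = "g \<otimes>\<^bsub>F\<^esub> (strip j0 w0 \<otimes>\<^bsub>F\<^esub> inv\<^bsub>F\<^esub> (\<iota> k))"
    let ?e = "\<epsilon> (inv\<^bsub>F\<^esub> ?s \<otimes>\<^bsub>F\<^esub> (g \<otimes>\<^bsub>F\<^esub> strip j0 w0))"
    have \<delta>: "delta K k ?e = (if ?v \<in> reps j0 then 1 else 0)"
      unfolding delta_def restrict_def key(2)[OF g] using key(1)[OF g] by simp
    show "(if length ?s = m \<and> i = root_type ?s j0 then delta K k ?e else 0) =
        (if ?v \<in> reps j0 \<and> length ?v = m \<and> i = root_type ?v j0 then 1 else 0)"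
      unfolding \<delta> using key(3)[OF g] by (cases "?v \<in> reps j0") simp_all
  qed
qed

lemma root_nodes: "w0 \<in> R \<Longrightarrow> (strip j0 w0, j0, 0) \<in> nodes m" "([], i, m) \<in> nodes m"
  by (simp_all add: nodes_def strip_reps) (simp add: reps_def)

lemma coset_sphere_Md:
  assumes d: "2 \<le> d" and w0: "w0 \<in> R"
  shows "coset_sphere m j0 i w0 \<in> Md d F" "Md_norm d F (coset_sphere m j0 i w0) \<le> real (2 * m + 3) ^ Suc d"
proof -
  interpret K: multipliers d K using d K by (rule multipliers.intro)
  note T = T.transfer[OF K.one_Md(1) d root_nodes(1)[OF w0] root_nodes(2), of m i, unfolded transfer_one[OF w0]]
  show "coset_sphere m j0 i w0 \<in> Md d F" by (rule T(1))
  have "real (2 * m + 3) ^ Suc d * Md_norm d K (\<lambda>k\<in>carrier K. 1) \<le> real (2 * m + 3) ^ Suc d * 1"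
    by (rule mult_left_mono[OF K.one_Md(2)]) simp
  then show "Md_norm d F (coset_sphere m j0 i w0) \<le> real (2 * m + 3) ^ Suc d"
    using order_trans[OF T(2)] by simp
qed

lemma sphere_Md:
  assumes d: "2 \<le> d" and w0: "w0 \<in> R"
  shows "sphere m j0 i w0 \<in> Md d F"
proof -
  interpret K: multipliers d K using d K by (rule multipliers.intro)
  obtain k where k: "k \<in> factor j0" "w0 = strip j0 w0 \<otimes>\<^bsub>F\<^esub> k" using strip_decomp_mult[OF w0] .
  have kR: "k \<in> R" by (rule factor_R[OF k(1)])
  \<comment> \<open>Inverted because \<open>transfer_delta\<close> translates by the inverse of
    \<open>\<iota> k\<close>; the translate then becomes \<open>w0\<close>.\<close>
  let ?k = "inv\<^bsub>K\<^esub> (\<epsilon> k)"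
  have "inv\<^bsub>F\<^esub> (\<iota> ?k) = k"
    using group_hom.hom_inv[of K F \<iota> "\<epsilon> k"] \<iota>_hom K group_F \<epsilon>(1,2)[OF k(1)] F.inv_inv[of k] kR
    by (simp add: group_hom_def group_hom_axioms_def carrier_F)
  then have "sphere m j0 i w0 = T.transfer m (strip j0 w0, j0, 0) ([], i, m) (delta K ?k)"
    using transfer_delta[OF w0, of ?k m i] \<epsilon>(1)[OF k(1)] k(2) by simp
  then show ?thesis
    using T.transfer(1)[OF K.delta_Md d root_nodes(1)[OF w0] root_nodes(2), of ?k m i] \<epsilon>(1)[OF k(1)] by simp
qed

text \<open>In the factor, point masses correspond to translated spheres and the constant 1 to the
  coset sphere; hence \<open>zero\<close> is assumed for all translates.\<close>

lemma coset_sphere_annihilated: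
  assumes d: "2 \<le> d" and AP: "Md_AP d K" and L: "normal_functional d F L"
    and zero: "\<And>w. w \<in> R \<Longrightarrow> L (sphere m j0 i w) = 0" and w0: "w0 \<in> R"
  shows "L (coset_sphere m j0 i w0) = 0"
proof -
  interpret K: multipliers d K using d K by (rule multipliers.intro)
  have "normal_functional d K (\<lambda>\<phi>. L (T.transfer m (strip j0 w0, j0, 0) ([], i, m) \<phi>))"
    by (rule T.normal_transfer[OF L d root_nodes(1)[OF w0] root_nodes(2)])
  moreover have "L (T.transfer m (strip j0 w0, j0, 0) ([], i, m) (delta K k)) = 0" if "k \<in> carrier K" for k
    unfolding transfer_delta[OF w0 that]
    by (intro zero F_closed strip_R F_inv_closed w0 factor_R[OF \<iota>_factor[OF that]])
  ultimately have "L (T.transfer m (strip j0 w0, j0, 0) ([], i, m) (\<lambda>k\<in>carrier K. 1)) = 0"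
    using AP unfolding K.Md_AP_iff by blast
  then show ?thesis by (simp only: transfer_one[OF w0])
qed

end

section \<open>Positive definite functions on free products\<close>

definition rotation :: "'y \<Rightarrow> 'y \<Rightarrow> real \<Rightarrow> real \<Rightarrow> ('y \<Rightarrow> complex) \<Rightarrow> 'y \<Rightarrow> complex" where
  "rotation a b c s f = f(a := of_real c * f a - of_real s * f b, b := of_real s * f a + of_real c * f b)"

lemma rotation_inverse:
  assumes "c\<^sup>2 + s\<^sup>2 = 1" "a \<noteq> b" shows "rotation a b c (- s) (rotation a b c s f) = f"
proof -
  have cs: "of_real c * of_real c + of_real s * of_real s = (1 :: complex)"
    using assms(1) by (simp add: power2_eq_square flip: of_real_mult of_real_add)
  have "of_real c * (of_real c * x - of_real s * y) + of_real s * (of_real s * x + of_real c * y) = x" for x y :: complex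
  proof -
    have "of_real c * (of_real c * x - of_real s * y) + of_real s * (of_real s * x + of_real c * y) =
        (of_real c * of_real c + of_real s * of_real s) * x" by (simp add: algebra_simps)
    then show ?thesis by (simp add: cs)
  qed
  moreover have "of_real c * (of_real s * x + of_real c * y) - of_real s * (of_real c * x - of_real s * y) = y" for x y :: complex
  proof -
    have "of_real c * (of_real s * x + of_real c * y) - of_real s * (of_real c * x - of_real s * y) =
        (of_real c * of_real c + of_real s * of_real s) * y" by (simp add: algebra_simps)
    then show ?thesis by (simp add: cs)
  qed
  ultimately show ?thesis using assms(2) by (auto simp: rotation_def fun_eq_iff)
qed

lemma op_bound_rotation:
  assumes cs: "c\<^sup>2 + s\<^sup>2 = 1" and ab: "a \<noteq> b"
  shows "op_bound 1 (l2 complex_space) (l2 complex_space) (rotation a b c s)"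
proof -
  interpret C: additive_hilbert_space complex_space by (rule additive_hilbert_space_complex)
  interpret l2: additive_hilbert_space "l2 complex_space :: ('a \<Rightarrow> complex) cspace"
    by (rule C.additive_hilbert_space_l2)
  have eq: "rotation a b c s f = f + (single a (of_real c * f a - of_real s * f b - f a) +
      single b (of_real s * f a + of_real c * f b - f b))" for f
    using ab by (auto simp: rotation_def single_def fun_eq_iff)
  have mem: "rotation a b c s f \<in> vecs (l2 complex_space)" if "f \<in> vecs (l2 complex_space)" for f
    unfolding eq by (intro l2.plus_mem that C.single_mem) simp_all
  have norm: "(vnorm (l2 complex_space) f)\<^sup>2 = ((norm (f a))\<^sup>2 + (norm (f b))\<^sup>2) + (\<Sum>\<^sub>\<infinity>y\<in>- {a, b}. (norm (f y))\<^sup>2)"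
    if f: "f \<in> vecs (l2 complex_space)" for f
  proof -
    have s: "(\<lambda>y. (norm (f y))\<^sup>2) summable_on UNIV" using f by (simp add: l2_mem)
    have "(vnorm (l2 complex_space) f)\<^sup>2 = (\<Sum>\<^sub>\<infinity>y\<in>{a, b} \<union> - {a, b}. (norm (f y))\<^sup>2)"
      using C.l2_norm_sq[OF f] by simp
    also have "\<dots> = (\<Sum>\<^sub>\<infinity>y\<in>{a, b}. (norm (f y))\<^sup>2) + (\<Sum>\<^sub>\<infinity>y\<in>- {a, b}. (norm (f y))\<^sup>2)"
      by (rule infsum_Un_disjoint) (auto intro: summable_on_subset_banach[OF s])
    finally show ?thesis using ab by simp
  qed
  have iso: "(norm (of_real c * x - of_real s * y))\<^sup>2 + (norm (of_real s * x + of_real c * y))\<^sup>2 =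
      (norm x)\<^sup>2 + (norm y)\<^sup>2" for x y :: complex
  proof -
    have "(norm (of_real c * x - of_real s * y))\<^sup>2 + (norm (of_real s * x + of_real c * y))\<^sup>2 =
        (c\<^sup>2 + s\<^sup>2) * ((norm x)\<^sup>2 + (norm y)\<^sup>2)"
      by (simp add: cmod_power2) (simp add: power2_eq_square algebra_simps)
    then show ?thesis by (simp add: cs)
  qed
  show ?thesis
  proof (rule op_boundI)
    fix f :: "'a \<Rightarrow> complex" assume f: "f \<in> vecs (l2 complex_space)"
    show "rotation a b c s f \<in> vecs (l2 complex_space)" by (rule mem[OF f])
    show "rotation a b c s (vscale (l2 complex_space) k f) = vscale (l2 complex_space) k (rotation a b c s f)" for k
      by (auto simp: rotation_def fun_eq_iff algebra_simps)
    show "rotation a b c s (vadd (l2 complex_space) f g) = vadd (l2 complex_space) (rotation a b c s f) (rotation a b c s g)"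
      if "g \<in> vecs (l2 complex_space)" for g
      unfolding l2.vadd_eq[OF f that] l2.vadd_eq[OF mem[OF f] mem[OF that]]
      by (auto simp: rotation_def fun_eq_iff algebra_simps)
    have "(\<Sum>\<^sub>\<infinity>y\<in>- {a, b}. (norm (rotation a b c s f y))\<^sup>2) = (\<Sum>\<^sub>\<infinity>y\<in>- {a, b}. (norm (f y))\<^sup>2)"
      by (rule infsum_cong) (auto simp: rotation_def)
    then have "(vnorm (l2 complex_space) (rotation a b c s f))\<^sup>2 = (vnorm (l2 complex_space) f)\<^sup>2"
      unfolding norm[OF f] norm[OF mem[OF f]] using iso[of "f a" "f b"] ab by (simp add: rotation_def)
    then show "vnorm (l2 complex_space) (rotation a b c s f) \<le> 1 * vnorm (l2 complex_space) f"
      using l2.vnorm_nonneg f mem[OF f] by (simp add: power2_eq_iff_nonneg)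
  qed
qed

context free_factors
begin

interpretation GA: group A by (rule A)
interpretation GB: group B by (rule B)
interpretation F: group F by (rule group_F)
interpretation C: additive_hilbert_space complex_space by (rule additive_hilbert_space_complex)

text \<open>The permutation representation on the vertices of the tree. No chains are required here,
  so the counter stays 0. Coordinates that are not vertices are annihilated.\<close>

definition translation :: "('a + 'b) list \<Rightarrow> (('a + 'b) list \<times> bool \<times> nat \<Rightarrow> complex) \<Rightarrow>
    ('a + 'b) list \<times> bool \<times> nat \<Rightarrow> complex" where
  "translation t = pinj (nodes 0) (node_act t) (\<lambda>_ z. z)"

lemma node_act_inv:
  assumes "t \<in> R" "y \<in> nodes m"
  shows "node_act (inv\<^bsub>F\<^esub> t) (node_act t y) = y" "node_act t (node_act (inv\<^bsub>F\<^esub> t) y) = y"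
  using assms node_act_mult[of "inv\<^bsub>F\<^esub> t" t y m] node_act_mult[of t "inv\<^bsub>F\<^esub> t" y m]
    F.l_inv[unfolded carrier_F one_F, OF assms(1)] F.r_inv[unfolded carrier_F one_F, OF assms(1)]
  by (simp_all add: F_inv_closed node_act_one)

lemma node_act_inj: "t \<in> R \<Longrightarrow> inj_on (node_act t) (nodes m)"
  by (rule inj_on_inverseI) (rule node_act_inv)

lemma translation_apply:
  assumes t: "t \<in> R"
  shows "translation t f z = (if z \<in> nodes 0 then f (node_act (inv\<^bsub>F\<^esub> t) z) else 0)"
proof (cases "z \<in> nodes 0")
  case True
  have z: "node_act (inv\<^bsub>F\<^esub> t) z \<in> nodes 0" "node_act t (node_act (inv\<^bsub>F\<^esub> t) z) = z"
    using node_act_closed[OF F_inv_closed[OF t] True] node_act_inv[OF t True] by auto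
  then have "z \<in> node_act t ` nodes 0" by force
  moreover have "inv_into (nodes 0) (node_act t) z = node_act (inv\<^bsub>F\<^esub> t) z"
    by (rule inv_into_f_eq[OF node_act_inj[OF t] z])
  ultimately show ?thesis using True by (simp add: translation_def pinj_def)
next
  case False
  then show ?thesis using node_act_closed[OF t] by (auto simp: translation_def pinj_def)
qed

lemma translation_mult:
  assumes "s \<in> R" "t \<in> R"
  shows "translation s (translation t f) = translation (s \<otimes>\<^bsub>F\<^esub> t) f"
proof
  fix z
  show "translation s (translation t f) z = translation (s \<otimes>\<^bsub>F\<^esub> t) f z"
    using assms node_act_mult[OF F_inv_closed[OF assms(2)] F_inv_closed[OF assms(1)], of z 0]
      node_act_closed[OF F_inv_closed[OF assms(1)], of z 0] F.inv_mult_group[of s t]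
    by (simp add: translation_apply F_closed carrier_F)
qed

lemma translation_one: "(\<And>z. z \<notin> nodes 0 \<Longrightarrow> f z = 0) \<Longrightarrow> translation [] f = f"
  using F.inv_one unfolding one_F by (auto simp: translation_apply node_act_one fun_eq_iff)

lemma op_bound_translation:
  "t \<in> R \<Longrightarrow> op_bound 1 (l2 complex_space) (l2 complex_space) (translation t)"
  unfolding translation_def
  by (intro op_bound_pinj node_act_inj additive_hilbert_space_complex op_boundI) simp_all

text \<open>Bozejko's free product of the positive definite functions that are 1 on the first factor and,
  off the unit, \<open>r\<^sup>2\<close> on the second one. The first factor fixes the node \<open>([], True, 0)\<close>; the
  second one fixes \<open>([], False, 0)\<close>, and is conjugated by a rotation that mixes the two.\<close>

abbreviation rot :: "real \<Rightarrow> _" where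
  "rot \<equiv> rotation ([] :: ('a + 'b) list, True, 0 :: nat) ([], False, 0)"

text \<open>After the rotation the root vector has component \<open>r\<close> along the vector fixed
  by the second factor. A letter of that factor preserves this component only, and rotating back
  contributes another \<open>r\<close>, hence \<open>r\<^sup>2\<close>.\<close>

definition letter_op :: "real \<Rightarrow> 'a + 'b \<Rightarrow> (('a + 'b) list \<times> bool \<times> nat \<Rightarrow> complex) \<Rightarrow>
    ('a + 'b) list \<times> bool \<times> nat \<Rightarrow> complex" where
  "letter_op r l f = (if isl l then translation [l] f
     else rot (sqrt (1 - r\<^sup>2)) (- r) (translation [l] (rot (sqrt (1 - r\<^sup>2)) r f)))"

definition orbit_vector :: "real \<Rightarrow> ('a + 'b) list \<Rightarrow> ('a + 'b) list \<times> bool \<times> nat \<Rightarrow> complex" where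
  "orbit_vector r g = foldr (letter_op r) g (single ([], True, 0) 1)"

definition right_letters :: "('a + 'b) list \<Rightarrow> nat" where
  "right_letters g = length (filter (\<lambda>l. \<not> isl l) g)"

lemma letter_R: "l \<in> letters \<Longrightarrow> [l] \<in> R" by (simp add: Cons_R)

context
  fixes r :: real assumes r: "0 \<le> r" "r < 1"
begin

lemma cs: "(sqrt (1 - r\<^sup>2))\<^sup>2 + r\<^sup>2 = 1" "(sqrt (1 - r\<^sup>2))\<^sup>2 + (- r)\<^sup>2 = 1"
  using r by (simp_all add: abs_square_le_1)

lemma op_bound_letter_op:
  assumes "l \<in> letters"
  shows "op_bound 1 (l2 complex_space) (l2 complex_space) (letter_op r l)"
proof -
  note tr = op_bound_translation[OF letter_R[OF assms]]
  have "op_bound (1 * (1 * 1)) (l2 complex_space) (l2 complex_space)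
      (\<lambda>f. rot (sqrt (1 - r\<^sup>2)) (- r) (translation [l] (rot (sqrt (1 - r\<^sup>2)) r f)))"
    by (intro op_bound_comp[OF op_bound_comp[OF op_bound_rotation[OF cs(1)] tr] op_bound_rotation[OF cs(2)]]) simp_all
  then show ?thesis using tr by (cases "isl l") (simp_all add: letter_op_def[abs_def])
qed

lemma op_bound_word_op:
  "set t \<subseteq> letters \<Longrightarrow> op_bound 1 (l2 complex_space) (l2 complex_space) (foldr (letter_op r) t)"
proof (induction t)
  case Nil
  show ?case by (rule op_boundI) simp_all
next
  case (Cons l t)
  then have "op_bound (1 * 1) (l2 complex_space) (l2 complex_space) (\<lambda>f. letter_op r l (foldr (letter_op r) t f))"
    by (intro op_bound_comp[OF _ op_bound_letter_op]) auto
  then show ?case by (simp add: o_def)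
qed

text \<open>Translation by the unit is the projection onto the vertices, so cancelling letters gives
  back a vector only if it is supported there.\<close>

lemma orbit_vector_nodes:
  assumes "set g \<subseteq> letters" "z \<notin> nodes 0" shows "orbit_vector r g z = 0"
proof -
  have "([], True, 0) \<in> nodes 0" "([], False, 0) \<in> nodes 0" by (auto simp: nodes_def reps_def)
  then show ?thesis
    using assms by (cases g) (auto simp: orbit_vector_def single_def letter_op_def rotation_def translation_apply letter_R)
qed

lemma letter_op_letter_op:
  assumes l: "l \<in> letters" "l' \<in> letters" "isl l = isl l'"
  shows "letter_op r l (letter_op r l' f) = (if isl l then translation ([l] \<otimes>\<^bsub>F\<^esub> [l']) f
     else rot (sqrt (1 - r\<^sup>2)) (- r) (translation ([l] \<otimes>\<^bsub>F\<^esub> [l']) (rot (sqrt (1 - r\<^sup>2)) r f)))"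
  using l translation_mult[OF letter_R[OF l(1)] letter_R[OF l(2)]] rotation_inverse[OF cs(2)]
  by (simp add: letter_op_def rotation_inverse[OF cs(2), simplified])

text \<open>On each factor \<open>letter_op\<close> is multiplicative, as the inner rotations
  cancel. Neighbouring letters of one type thus merge or cancel exactly as in
  \<open>prepend_letter\<close>.\<close>

lemma letter_op_orbit_vector:
  assumes l: "l \<in> letters" and g: "g \<in> R"
  shows "letter_op r l (orbit_vector r g) = orbit_vector r (prepend_letter A B l g)"
proof (cases "g \<noteq> [] \<and> isl (hd g) = isl l")
  case False
  then have "l # g \<in> R" using l g by (auto simp: Cons_R)
  then show ?thesis by (simp add: prepend_Cons orbit_vector_def)
next
  case True
  then obtain l' g' where g': "g = l' # g'" "isl l = isl l'" by (cases g) auto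
  have l': "l' \<in> letters" "g' \<in> R" using g g' by (auto simp: Cons_R)
  then have "set g' \<subseteq> letters" by (simp add: reduced_words_def)
  have zero: "orbit_vector r g' z = 0" if "z \<notin> nodes 0" for z by (rule orbit_vector_nodes[OF \<open>set g' \<subseteq> letters\<close> that])
  have zero': "rot (sqrt (1 - r\<^sup>2)) r (orbit_vector r g') z = 0" if "z \<notin> nodes 0" for z
    using zero[OF that] that by (auto simp: rotation_def nodes_def reps_def)
  have "letter_op r l (orbit_vector r g) = letter_op r l (letter_op r l' (orbit_vector r g'))"
    by (simp add: g' orbit_vector_def)
  also have "\<dots> = orbit_vector r (prepend_letter A B l g)"
  proof (cases "[l] \<otimes>\<^bsub>F\<^esub> [l'] = []")
    case True
    then have "prepend_letter A B l g = g'" using g' by (cases l; cases l') (auto simp: mult_F split: if_splits)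
    then show ?thesis
      using True letter_op_letter_op[OF l l'(1) g'(2)]
      by (simp add: translation_one zero zero' rotation_inverse[OF cs(1)])
  next
    case False
    then obtain l'' where l'': "[l] \<otimes>\<^bsub>F\<^esub> [l'] = [l'']" "isl l'' = isl l" "prepend_letter A B l g = l'' # g'"
      using g' by (cases l; cases l') (auto simp: mult_F split: if_splits)
    then show ?thesis
      unfolding letter_op_letter_op[OF l l'(1) g'(2)] l''(1,3) by (simp add: orbit_vector_def letter_op_def)
  qed
  finally show ?thesis .
qed

lemma word_op_orbit_vector:
  "t \<in> R \<Longrightarrow> g \<in> R \<Longrightarrow> foldr (letter_op r) t (orbit_vector r g) = orbit_vector r (t \<otimes>\<^bsub>F\<^esub> g)"
proof (induction t)
  case (Cons l t)
  then have "t \<in> R" "l \<in> letters" by (auto simp: Cons_R)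
  then show ?case using Cons letter_op_orbit_vector[of l "t \<otimes>\<^bsub>F\<^esub> g"] F_closed[of t g] by (simp add: mult_F)
qed (simp add: mult_F)

text \<open>The support clause carries the induction: the root moved by a new letter
  \<open>l\<close> receives its coordinate from a word beginning with the type of \<open>l\<close>,
  where the old vector vanishes. Only the root fixed by \<open>l\<close> contributes.\<close>

lemma orbit_vector_root:
  assumes "g \<in> R"
  shows "orbit_vector r g ([], True, 0) = of_real (r ^ (2 * right_letters g)) \<and>
    (\<forall>w j. (w \<noteq> [] \<and> (g = [] \<or> isl (hd w) \<noteq> isl (hd g)) \<or> (w, j) = ([], False) \<and> (g = [] \<or> isl (hd g))) \<longrightarrow>
      orbit_vector r g (w, j, 0) = 0)"
  using assms
proof (induction g)
  case Nil
  show ?case by (auto simp: orbit_vector_def single_def right_letters_def)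
next
  case (Cons l g)
  have l: "l \<in> letters" "[l] \<in> R" and g: "g \<in> R" "g \<noteq> [] \<longrightarrow> isl (hd g) \<noteq> isl l"
    using Cons.prems by (auto simp: Cons_R)
  note IH = Cons.IH[OF g(1)]
  define l' where "l' = map_sum (m_inv A) (m_inv B) l"
  have l': "inv\<^bsub>F\<^esub> [l] = [l']" "isl l' = isl l" "l' \<in> letters"
    using inv_F[OF l(2)] l(1) by (auto simp: word_inv_def l'_def isl_map_sum Cons_R)
  have act_other: "node_act [l'] (w, j, 0) = (l' # w, j, 0)" if "w \<in> reps j" "w \<noteq> []" "isl (hd w) \<noteq> isl l" for w j
  proof -
    have "[l'] @ w \<in> R" using that l' by (auto simp: Cons_R reps_def)
    then have "[l'] \<otimes>\<^bsub>F\<^esub> w = l' # w" using mult_append[of "[l']" w] by simp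
    then show ?thesis using that by (simp add: node_act_def strip_def reps_def)
  qed
  have act_root: "node_act [l'] ([], j, 0) = (if isl l = j then [] else [l'], j, 0)" for j
    using l' by (auto simp: node_act_def strip_def mult_F)
  have roots: "([], True, 0) \<in> nodes 0" "([], False, 0) \<in> nodes 0" by (auto simp: nodes_def reps_def)
  have ov: "orbit_vector r (l # g) = letter_op r l (orbit_vector r g)" by (simp add: orbit_vector_def)
  have IH_supp: "orbit_vector r g (w, j, 0) = 0" if "w \<noteq> []" "isl (hd w) = isl l" for w j
    using IH that g(2) by metis
  have IH_root: "orbit_vector r g ([], False, 0) = 0" if "\<not> isl l"
    using IH that g(2) by metis
  have supp: "f (node_act [l'] (w, j, 0)) = 0"
    if "w \<in> reps j" "w \<noteq> []" "isl (hd w) \<noteq> isl l" "\<And>w j. w \<noteq> [] \<Longrightarrow> isl (hd w) = isl l \<Longrightarrow> f (w, j, 0) = 0"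
    for f :: "('a + 'b) list \<times> bool \<times> nat \<Rightarrow> complex" and w j
    using that l'(2) by (simp add: act_other)
  show ?case
  proof (cases "isl l")
    case True
    have ov': "orbit_vector r (l # g) z = (if z \<in> nodes 0 then orbit_vector r g (node_act [l'] z) else 0)" for z
      using True by (simp add: ov letter_op_def translation_apply l l')
    have "orbit_vector r (l # g) ([], True, 0) = orbit_vector r g ([], True, 0)"
      using True by (simp add: ov' roots act_root)
    moreover have "orbit_vector r (l # g) (w, j, 0) = 0" if "w \<noteq> []" "isl (hd w) \<noteq> isl l" for w j
      using that supp[of w j "orbit_vector r g"] IH_supp by (simp add: ov' nodes_def)
    moreover have "orbit_vector r (l # g) ([], False, 0) = 0"
      using True IH_supp[of "[l']"] l' by (simp add: ov' act_root)
    ultimately show ?thesis using True IH by (auto simp: right_letters_def)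
  next
    case False
    define f where "f = rot (sqrt (1 - r\<^sup>2)) r (orbit_vector r g)"
    define h where "h = translation [l] f"
    have f: "f ([], False, 0) = of_real r * orbit_vector r g ([], True, 0)"
      "w \<noteq> [] \<Longrightarrow> f (w, j, 0) = orbit_vector r g (w, j, 0)" for w j
      using IH_root[OF False] by (simp_all add: f_def rotation_def)
    have h: "h z = (if z \<in> nodes 0 then f (node_act [l'] z) else 0)" for z
      by (simp add: h_def translation_apply l l')
    have ov': "orbit_vector r (l # g) = rot (sqrt (1 - r\<^sup>2)) (- r) h"
      using False by (simp add: ov letter_op_def h_def f_def)
    have "h ([], True, 0) = 0"
      using False IH_supp[of "[l']"] l' f(2)[of "[l']"] by (simp add: h act_root)
    moreover have "h ([], False, 0) = of_real r * orbit_vector r g ([], True, 0)"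
      using False f(1) by (simp add: h roots act_root)
    ultimately have "orbit_vector r (l # g) ([], True, 0) = of_real r * (of_real r * orbit_vector r g ([], True, 0))"
      by (simp add: ov' rotation_def)
    moreover have "orbit_vector r (l # g) (w, j, 0) = 0" if "w \<noteq> []" "isl (hd w) \<noteq> isl l" for w j
      using that supp[of w j f] f(2) IH_supp by (simp add: ov' rotation_def h nodes_def)
    ultimately show ?thesis using False IH by (auto simp: right_letters_def)
  qed
qed

lemma free_positive_definite:
  assumes d: "2 \<le> d"
  defines "\<phi> \<equiv> \<lambda>g\<in>carrier F. complex_of_real (r ^ (2 * right_letters g))"
  shows "\<phi> \<in> Md d F" "Md_norm d F \<phi> \<le> 1"
proof -
  let ?\<delta> = "single ([], True, 0) 1 :: ('a + 'b) list \<times> bool \<times> nat \<Rightarrow> complex"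
  interpret l2: additive_hilbert_space "l2 complex_space :: (('a + 'b) list \<times> bool \<times> nat \<Rightarrow> complex) cspace"
    by (rule C.additive_hilbert_space_l2)
  have \<delta>: "?\<delta> \<in> vecs (l2 complex_space)" by (rule C.single_mem) simp
  have "\<phi> \<in> Md d F \<and> Md_norm d F \<phi> \<le> (\<Prod>i=1..d. 1) * vnorm (l2 complex_space) ?\<delta> * vnorm (l2 complex_space) ?\<delta>"
  proof (rule Md_coefficientI[OF d group_F, where B = "\<lambda>_ t. foldr (letter_op r) t"])
    show "\<phi> \<in> extensional (carrier F)" by (simp add: \<phi>_def)
    show "complex_hilbert_space (l2 complex_space :: (('a + 'b) list \<times> bool \<times> nat \<Rightarrow> complex) cspace)"
      by unfold_locales
    show "op_bound 1 (l2 complex_space) (l2 complex_space) (foldr (letter_op r) t)" if "t \<in> carrier F" for t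
      using that by (intro op_bound_word_op) (simp add: carrier_F reduced_words_def)
    fix t assume t: "t \<in> {1..d} \<rightarrow> carrier F"
    let ?R = "\<lambda>_ x y. x \<in> R \<and> y = orbit_vector r x"
    have "?R 0 (foldr (\<lambda>i x. t i \<otimes>\<^bsub>F\<^esub> x) [1..<Suc d] \<one>\<^bsub>F\<^esub>) (foldr (\<lambda>i. foldr (letter_op r) (t i)) [1..<Suc d] ?\<delta>)"
    proof (rule foldr_suffix_induct[where R = ?R])
      show "?R d \<one>\<^bsub>F\<^esub> ?\<delta>" by (simp add: one_F orbit_vector_def)
      fix i x y assume "1 \<le> i" "i \<le> d" "?R i x y"
      moreover from this have "t i \<in> R" using t by (auto simp: carrier_F)
      ultimately show "?R (i - 1) (t i \<otimes>\<^bsub>F\<^esub> x) (foldr (letter_op r) (t i) y)"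
        by (simp add: F_closed word_op_orbit_vector)
    qed
    moreover have "vinner (l2 complex_space) (orbit_vector r x) ?\<delta> = orbit_vector r x ([], True, 0)" if "x \<in> R" for x
    proof -
      have "orbit_vector r x \<in> vecs (l2 complex_space)"
        unfolding orbit_vector_def
        using that by (intro op_boundD(1)[OF op_bound_word_op] \<delta>) (simp add: reduced_words_def)
      from C.vinner_single[OF this, of 1] show ?thesis by simp
    qed
    ultimately show "\<phi> (foldr (\<lambda>i x. t i \<otimes>\<^bsub>F\<^esub> x) [1..<Suc d] \<one>\<^bsub>F\<^esub>) =
        vinner (l2 complex_space) (foldr (\<lambda>i. foldr (letter_op r) (t i)) [1..<Suc d] ?\<delta>) ?\<delta>"
      using orbit_vector_root by (simp add: \<phi>_def carrier_F del: upt_Suc)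
  qed (use \<delta> in simp_all)
  then show "\<phi> \<in> Md d F" "Md_norm d F \<phi> \<le> 1" by (simp_all add: C.vnorm_single)
qed

end

end

section \<open>The approximation property of free products\<close>

lemma summable_power_times_poly:
  fixes r :: real assumes r: "0 \<le> r" "r < 1"
  shows "summable (\<lambda>m. r ^ m * real (2 * m + 3) ^ k)"
proof -
  have "(\<lambda>n. 2 / real (2 * n + 3)) \<longlonglongrightarrow> 0"
  proof (rule Lim_null_comparison)
    show "(\<lambda>n. 2 * inverse (real (Suc n))) \<longlonglongrightarrow> 0"
      using tendsto_mult_left[OF LIMSEQ_inverse_real_of_nat, of 2] by simp
    show "\<forall>\<^sub>F n in sequentially. norm (2 / real (2 * n + 3)) \<le> 2 * inverse (real (Suc n))"
      by (intro always_eventually allI) (simp add: field_simps)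
  qed
  then have "(\<lambda>n. r * (1 + 2 / real (2 * n + 3)) ^ k) \<longlonglongrightarrow> r * (1 + 0) ^ k"
    by (intro tendsto_intros)
  \<comment> \<open>The ratios tend to \<open>r\<close>, and \<open>(1 + r) / 2\<close> lies
    strictly between \<open>r\<close> and 1.\<close>
  moreover have "r * (1 + 0) ^ k < (1 + r) / 2" using r by simp
  ultimately have "\<forall>\<^sub>F n in sequentially. r * (1 + 2 / real (2 * n + 3)) ^ k < (1 + r) / 2"
    by (rule order_tendstoD)
  then obtain N where N: "\<And>n. n \<ge> N \<Longrightarrow> r * (1 + 2 / real (2 * n + 3)) ^ k < (1 + r) / 2"
    by (auto simp: eventually_sequentially)
  show ?thesis
  proof (rule summable_ratio_test[of "(1 + r) / 2" N])
    show "(1 + r) / 2 < 1" using r by simp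
    fix n assume n: "n \<ge> N"
    have step: "real (2 * Suc n + 3) = (1 + 2 / real (2 * n + 3)) * real (2 * n + 3)"
      by (simp add: field_simps)
    have "norm (r ^ Suc n * real (2 * Suc n + 3) ^ k) =
        (r * (1 + 2 / real (2 * n + 3)) ^ k) * (r ^ n * real (2 * n + 3) ^ k)"
      unfolding step using r by (simp add: power_mult_distrib abs_mult)
    also have "\<dots> \<le> (1 + r) / 2 * (r ^ n * real (2 * n + 3) ^ k)"
      using N[OF n] r by (intro mult_right_mono) auto
    finally show "norm (r ^ Suc n * real (2 * Suc n + 3) ^ k) \<le> (1 + r) / 2 * norm (r ^ n * real (2 * n + 3) ^ k)"
      using r by simp
  qed
qed

context free_factors
begin

interpretation GA: group A by (rule A)
interpretation GB: group B by (rule B)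
interpretation F: group F by (rule group_F)

lemma left_factor: "free_factor A B A (\<lambda>x. if x = \<one>\<^bsub>A\<^esub> then [] else [Inl x]) True"
proof (intro free_factor.intro free_factors_axioms free_factor_axioms.intro)
  show "(\<lambda>x. if x = \<one>\<^bsub>A\<^esub> then [] else [Inl x]) \<in> hom A F"
    by (auto simp: hom_def carrier_F mult_F Cons_R)
  show "(\<lambda>x. if x = \<one>\<^bsub>A\<^esub> then [] else [Inl x]) ` carrier A = factor True"
    by (auto simp: factor_def image_iff)
qed (auto simp: A inj_on_def)

lemma right_factor: "free_factor A B B (\<lambda>x. if x = \<one>\<^bsub>B\<^esub> then [] else [Inr x]) False"
proof (intro free_factor.intro free_factors_axioms free_factor_axioms.intro)
  show "(\<lambda>x. if x = \<one>\<^bsub>B\<^esub> then [] else [Inr x]) \<in> hom B F"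
    by (auto simp: hom_def carrier_F mult_F Cons_R)
  show "(\<lambda>x. if x = \<one>\<^bsub>B\<^esub> then [] else [Inr x]) ` carrier B = factor False"
    by (auto simp: factor_def image_iff)
qed (auto simp: B inj_on_def)

text \<open>A nonempty word represents a coset of type \<open>j\<close> iff it ends in the other
  type. Stripping that last letter gives a word of length \<open>m\<close> in the coset sphere of
  type \<open>\<not> j\<close>; what remains of that coset sphere are the words with no letter to
  strip.\<close>

lemma sphere_Suc:
  assumes g: "g \<in> R" and w0: "w0 \<in> R"
  shows "sphere (Suc m) j i w0 g = coset_sphere m (\<not> j) i w0 g + (- 1) * sphere m (\<not> j) i w0 g"
proof -
  define u where "u = g \<otimes>\<^bsub>F\<^esub> w0"
  have u: "u \<in> R" using g w0 by (simp add: u_def F_closed)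
  have "(if u \<in> reps j \<and> length u = Suc m \<and> i = root_type u j then 1 else 0 :: complex) =
      (if length (strip (\<not> j) u) = m \<and> i = root_type (strip (\<not> j) u) (\<not> j) then 1 else 0) +
      (- 1) * (if u \<in> reps (\<not> j) \<and> length u = m \<and> i = root_type u (\<not> j) then 1 else 0)"
  proof (cases "u \<in> reps (\<not> j)")
    case True
    then have "u \<in> reps j \<Longrightarrow> u = []" by (auto simp: reps_def)
    then show ?thesis using True by (auto simp: strip_reps_id)
  next
    case False
    then obtain v l where v: "u = v @ [l]" "isl l = (\<not> j)" using u by (cases u rule: rev_cases) (auto simp: reps_def)
    then have "u \<in> reps j" using u by (simp add: reps_def)
    moreover have "strip (\<not> j) u = v" using v by (simp add: strip_def)
    moreover have "root_type u j = root_type v (\<not> j)" using v by (simp add: root_type_def)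
    ultimately show ?thesis using False v by simp
  qed
  then show ?thesis using g by (simp add: sphere_def coset_sphere_def carrier_F flip: u_def)
qed

text \<open>The stripped word alternates and, if nonempty, ends in a letter of the second factor, so
  its length and first letter determine the count. Hence the positive definite functions are
  constant on coset spheres of type \<open>True\<close>.\<close>

lemma right_letters_eq:
  "u \<in> R \<Longrightarrow> 2 * right_letters u =
    length (strip True u) + (if root_type (strip True u) True then 0 else 1)"
proof -
  assume u: "u \<in> R"
  have reps: "2 * right_letters s = length s + (if root_type s True then 0 else 1)" if "s \<in> reps True" for s
    using that
  proof (induction s)
    case (Cons l s)
    then have "s \<in> reps True" "s = [] \<Longrightarrow> \<not> isl l" "s \<noteq> [] \<Longrightarrow> isl (hd s) \<noteq> isl l"
      by (auto simp: reps_def Cons_R)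
    then show ?case using Cons.IH by (cases "s = []"; cases "isl l") (auto simp: right_letters_def root_type_def)
  qed (simp add: right_letters_def root_type_def)
  obtain k where k: "k \<in> factor True" "u = strip True u @ k" using strip_decomp[OF u] by blast
  have "right_letters (strip True u @ k) = right_letters (strip True u) + right_letters k"
    by (simp add: right_letters_def)
  moreover have "right_letters k = 0" using k(1) by (auto simp: right_letters_def factor_def)
  ultimately have "right_letters u = right_letters (strip True u)" using k(2) by simp
  then show ?thesis using reps[OF strip_reps[OF u]] by simp
qed

theorem Md_AP_free_product:
  assumes d: "2 \<le> d" and APA: "Md_AP d A" and APB: "Md_AP d B"
  shows "Md_AP d F"
proof -
  interpret left: free_factor A B A "\<lambda>x. if x = \<one>\<^bsub>A\<^esub> then [] else [Inl x]" True by (rule left_factor)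
  interpret right: free_factor A B B "\<lambda>x. if x = \<one>\<^bsub>B\<^esub> then [] else [Inr x]" False by (rule right_factor)
  interpret multipliers d F using d group_F by (rule multipliers.intro)
  have sphere_Md: "sphere m j i w \<in> Md d F" if "w \<in> R" for m j i w
    using left.sphere_Md[OF d that] right.sphere_Md[OF d that] by (cases j) auto
  have coset_sphere_Md: "coset_sphere m j i w \<in> Md d F"
      "Md_norm d F (coset_sphere m j i w) \<le> real (2 * m + 3) ^ Suc d" if "w \<in> R" for m j i w
    using left.coset_sphere_Md[OF d that, of m i] right.coset_sphere_Md[OF d that, of m i]
    by (cases j; simp)+
  show ?thesis
    unfolding Md_AP_iff
  proof (intro allI impI)
    fix L assume L: "normal_functional d F L" and zero: "\<forall>t\<in>carrier F. L (delta F t) = 0"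
    have coset: "L (coset_sphere m j i w0) = 0" if "\<And>w. w \<in> R \<Longrightarrow> L (sphere m j i w) = 0" "w0 \<in> R" for m j i w0
      using left.coset_sphere_annihilated[OF d APA L, of m i w0]
        right.coset_sphere_annihilated[OF d APB L, of m i w0] that by (cases j) auto
    have sphere: "L (sphere m j i w) = 0" if "w \<in> R" for m j i w
      using that
    proof (induction m arbitrary: j w)
      case 0
      \<comment> \<open>A word of length 0 is the unit, so only the inverse of \<open>w\<close> can
        lie in this sphere.\<close>
      have "{g \<in> carrier F. sphere 0 j i w g \<noteq> 0} \<subseteq> {inv\<^bsub>F\<^esub> w}"
        using F.inv_equality[of _ w] 0 by (auto simp: sphere_def carrier_F one_F)
      then have "finite {g \<in> carrier F. sphere 0 j i w g \<noteq> 0}" by (rule finite_subset) simp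
      moreover have "sphere 0 j i w \<in> extensional (carrier F)" by (simp add: sphere_def)
      ultimately have "sphere 0 j i w \<in> finsupp_fun F" unfolding finsupp_fun_def by simp
      then show ?case using normal_finsupp[OF L] zero by simp
    next
      case (Suc m)
      have "L (sphere (Suc m) j i w) = L (coset_sphere m (\<not> j) i w) + (- 1) * L (sphere m (\<not> j) i w)"
        by (rule normal_add[OF L coset_sphere_Md(1) sphere_Md sphere_Md])
          (use Suc.prems in \<open>simp_all add: sphere_Suc carrier_F\<close>)
      then show ?case using Suc coset[of m "\<not> j" i w] by simp
    qed
    let ?\<phi> = "\<lambda>r. \<lambda>g\<in>carrier F. complex_of_real (r ^ (2 * right_letters g))"
    have L\<phi>: "L (?\<phi> r) = 0" if r: "0 \<le> r" "r < 1" for r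
    proof -
      note \<phi> = free_positive_definite[OF r d]
      define S where "S = (\<Sum>m. r ^ m * real (2 * m + 3) ^ Suc d)"
      have summable: "summable (\<lambda>m. r ^ m * real (2 * m + 3) ^ Suc d)" by (rule summable_power_times_poly[OF r])
      have S: "0 \<le> S" unfolding S_def using r by (intro suminf_nonneg summable) simp
      \<comment> \<open>The value on a coset sphere by \<open>right_letters_eq\<close>; a root of
        the second type adds 1 to the exponent.\<close>
      define a where "a m i = (if i then r ^ m else r ^ Suc m)" for m and i :: bool
      \<comment> \<open>As \<open>L\<close> kills every coset sphere, its approximant is at most
        \<open>e\<close> times the norm there. The geometric weights sum these polynomial bounds to
        \<open>2 * e * S\<close>, with \<open>S\<close> independent of the approximant.\<close>
      have bound: "norm (L (?\<phi> r)) \<le> e * (1 + 2 * S)" if e: "e > 0" for e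
      proof -
        obtain X g where X: "finite X" "X \<subseteq> carrier F"
          and g: "\<And>\<phi>. \<phi> \<in> Md d F \<Longrightarrow> norm (L \<phi> - (\<Sum>t\<in>X. \<phi> t * g t)) \<le> e * Md_norm d F \<phi>"
          using L e unfolding normal_functional_def by metis
        \<comment> \<open>Beyond this radius the coset spheres no longer meet the finite set
          \<open>X\<close>, so the expansion stops.\<close>
        define M where "M = Suc (Max (insert 0 ((\<lambda>t. length (strip True t)) ` X)))"
        have M: "length (strip True t) < M" if "t \<in> X" for t
          using that X(1) by (simp add: M_def less_Suc_eq_le)
        have expand: "?\<phi> r t = (\<Sum>m<M. \<Sum>i\<in>UNIV. of_real (a m i) * coset_sphere m True i [] t)" if t: "t \<in> X" for t
        proof -
          have tR: "t \<in> R" using t X(2) by (auto simp: carrier_F)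
          let ?n = "length (strip True t)" and ?b = "root_type (strip True t) True"
          have "(\<Sum>m<M. \<Sum>i\<in>UNIV. of_real (a m i) * coset_sphere m True i [] t) =
              (\<Sum>m<M. if m = ?n then of_real (a m ?b) else 0 :: complex)"
            using tR by (intro sum.cong refl) (auto simp: coset_sphere_def carrier_F UNIV_bool)
          also have "\<dots> = of_real (a ?n ?b)" using M[OF t] by (simp add: sum.delta)
          also have "a ?n ?b = r ^ (2 * right_letters t)" by (simp add: a_def right_letters_eq[OF tR])
          finally show ?thesis using tR by (simp add: carrier_F)
        qed
        have "(\<Sum>t\<in>X. ?\<phi> r t * g t) =
            (\<Sum>t\<in>X. \<Sum>m<M. \<Sum>i\<in>UNIV. of_real (a m i) * (coset_sphere m True i [] t * g t))"
          by (intro sum.cong refl) (simp only: expand sum_distrib_right mult.assoc)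
        also have "\<dots> = (\<Sum>m<M. \<Sum>t\<in>X. \<Sum>i\<in>UNIV. of_real (a m i) * (coset_sphere m True i [] t * g t))"
          by (rule sum.swap)
        also have "\<dots> = (\<Sum>m<M. \<Sum>i\<in>UNIV. of_real (a m i) * (\<Sum>t\<in>X. coset_sphere m True i [] t * g t))"
          unfolding sum_distrib_left by (intro sum.cong refl sum.swap)
        finally have swap: "(\<Sum>t\<in>X. ?\<phi> r t * g t) =
            (\<Sum>m<M. \<Sum>i\<in>UNIV. of_real (a m i) * (\<Sum>t\<in>X. coset_sphere m True i [] t * g t))" .
        have summand: "norm (of_real (a m i) * (\<Sum>t\<in>X. coset_sphere m True i [] t * g t)) \<le>
            e * (r ^ m * real (2 * m + 3) ^ Suc d)" for m i
        proof -
          have "norm (\<Sum>t\<in>X. coset_sphere m True i [] t * g t) \<le> e * Md_norm d F (coset_sphere m True i [])"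
            using g[OF coset_sphere_Md(1)[OF Nil_R], of m True i] coset[OF sphere Nil_R, of m True i] by simp
          also have "\<dots> \<le> e * real (2 * m + 3) ^ Suc d"
            using e by (intro mult_left_mono coset_sphere_Md Nil_R) simp
          finally have "norm (\<Sum>t\<in>X. coset_sphere m True i [] t * g t) \<le> e * real (2 * m + 3) ^ Suc d" .
          moreover have "0 \<le> a m i" "a m i \<le> r ^ m"
            using r mult_left_le_one_le[of "r ^ m" r] by (auto simp: a_def)
          ultimately have "a m i * norm (\<Sum>t\<in>X. coset_sphere m True i [] t * g t) \<le> r ^ m * (e * real (2 * m + 3) ^ Suc d)"
            using r by (intro mult_mono) auto
          then show ?thesis using \<open>0 \<le> a m i\<close> by (simp add: norm_mult mult_ac)
        qed
        have "norm (\<Sum>t\<in>X. ?\<phi> r t * g t) \<le> (\<Sum>m<M. \<Sum>i\<in>(UNIV :: bool set). e * (r ^ m * real (2 * m + 3) ^ Suc d))"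
          unfolding swap by (intro sum_norm_le summand)
        also have "\<dots> = 2 * e * (\<Sum>m<M. r ^ m * real (2 * m + 3) ^ Suc d)"
          by (simp add: sum_distrib_left UNIV_bool mult_ac)
        also have "\<dots> \<le> 2 * e * S"
          unfolding S_def using e r by (intro mult_left_mono sum_le_suminf[OF summable]) auto
        finally have "norm (\<Sum>t\<in>X. ?\<phi> r t * g t) \<le> 2 * e * S" .
        moreover have "norm (L (?\<phi> r) - (\<Sum>t\<in>X. ?\<phi> r t * g t)) \<le> e * 1"
          using g[OF \<phi>(1)] mult_left_mono[OF \<phi>(2), of e] e by linarith
        ultimately show ?thesis
          using norm_triangle_sub[of "L (?\<phi> r)" "\<Sum>t\<in>X. ?\<phi> r t * g t"] by (simp add: algebra_simps)
      qed
      have "norm (L (?\<phi> r)) \<le> 0 + e" if "e > 0" for e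
        using bound[of "e / (1 + 2 * S)"] that S by simp
      then have "norm (L (?\<phi> r)) \<le> 0" by (rule field_le_epsilon)
      then show ?thesis by simp
    qed
    let ?one = "\<lambda>t\<in>carrier F. 1 :: complex"
    have "norm (L ?one) \<le> 0 + e" if e: "e > 0" for e
    proof -
      have e2: "e / 2 > 0" using e by simp
      obtain X g where X: "finite X" "X \<subseteq> carrier F"
        and g: "\<And>\<phi>. \<phi> \<in> Md d F \<Longrightarrow> norm (L \<phi> - (\<Sum>t\<in>X. \<phi> t * g t)) \<le> e / 2 * Md_norm d F \<phi>"
        using L e2 unfolding normal_functional_def by metis
      \<comment> \<open>A sequence in \<open>[0, 1)\<close> tending to 1. The norms of the functions
        are at most 1 and the approximant sees only the points of \<open>X\<close>, so pointwise
        convergence is enough.\<close>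
      define q where "q n = 1 - inverse (real (Suc n))" for n
      have q: "0 \<le> q n" "q n < 1" for n by (simp_all add: q_def inverse_le_1_iff)
      have "q \<longlonglongrightarrow> 1 - 0"
        unfolding q_def[abs_def] by (intro tendsto_diff tendsto_const LIMSEQ_inverse_real_of_nat)
      then have "(\<lambda>n. \<Sum>t\<in>X. complex_of_real (q n ^ (2 * right_letters t)) * g t) \<longlonglongrightarrow>
          (\<Sum>t\<in>X. complex_of_real ((1 - 0) ^ (2 * right_letters t)) * g t)"
        by (intro tendsto_sum tendsto_mult tendsto_const tendsto_of_real tendsto_power)
      then have "(\<lambda>n. norm (\<Sum>t\<in>X. complex_of_real (q n ^ (2 * right_letters t)) * g t)) \<longlonglongrightarrow> norm (\<Sum>t\<in>X. g t)"
        by (intro tendsto_norm) simp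
      moreover have "norm (\<Sum>t\<in>X. complex_of_real (q n ^ (2 * right_letters t)) * g t) \<le> e / 2" for n
      proof -
        note \<phi> = free_positive_definite[OF q d, of n]
        have "norm (\<Sum>t\<in>X. ?\<phi> (q n) t * g t) \<le> e / 2 * 1"
          using order_trans[OF g[OF \<phi>(1)] mult_left_mono[OF \<phi>(2)]] e
          unfolding L\<phi>[OF q] diff_0 norm_minus_cancel by simp
        moreover have "(\<Sum>t\<in>X. ?\<phi> (q n) t * g t) = (\<Sum>t\<in>X. complex_of_real (q n ^ (2 * right_letters t)) * g t)"
          using X(2) by (intro sum.cong) auto
        ultimately show ?thesis by simp
      qed
      ultimately have "norm (\<Sum>t\<in>X. g t) \<le> e / 2" by (intro LIMSEQ_le_const2) auto
      moreover have "(\<Sum>t\<in>X. ?one t * g t) = (\<Sum>t\<in>X. g t)" using X(2) by (intro sum.cong) auto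
      moreover have "norm (L ?one - (\<Sum>t\<in>X. ?one t * g t)) \<le> e / 2 * 1"
        by (rule order_trans[OF g[OF one_Md(1)] mult_left_mono[OF one_Md(2)]]) (use e in simp)
      ultimately show ?thesis using norm_triangle_sub[of "L ?one" "\<Sum>t\<in>X. g t"] by simp
    qed
    then have "norm (L ?one) \<le> 0" by (rule field_le_epsilon)
    then show "L ?one = 0" by simp
  qed
qed

end

theorem corollary1p4:
  fixes d :: nat
    and G1 :: "('a, 'm) monoid_scheme"
    and G2 :: "('b, 'n) monoid_scheme"
  assumes "d \<ge> 2"
    and "group G1" and "group G2"
    and "Md_AP d G1" and "Md_AP d G2"
  shows "Md_AP d (G1 \<times>\<times> G2) \<and>
    (\<forall>\<alpha> \<in> hom G1 (AutoGroup G2). Md_AP d (semidirect_product G1 \<alpha> G2)) \<and>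
    Md_AP d (free_product G1 G2)"
  using Md_AP_direct_product[OF assms] Md_AP_semidirect_product[OF assms]
    free_factors.Md_AP_free_product[OF free_factors.intro[OF assms(2,3)] assms(1,4,5)]
  by blast

end
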